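(* Let $h$ be a function belonging to a Hardy field with polynomial growth (i.e., there exist $c,d\ge1$ with $|h(x)|\le x^d$ for all $x\ge c$). The following are equivalent: (i) the sequence $(h(n))_{n\in\mathbb{N}}$ is uniformly distributed mod $1$ with respect to $\mathbb{E}^{2\mathrm{bin}}$ averages; (ii) one of the following two (mutually exclusive) conditions holds: (a) $\lim_{x\to\infty}\frac{|h(x)-p(x)|}{x\log x}=\infty$ for all $p\in\mathbb{Q}[x]$; (b) $\lim_{x\to\infty}\frac{|h(x)-p(x)|}{\sqrt{x}}=\infty$ for each $p\in\mathbb{Q}[x]$, and there exists $q\in\mathbb{Q}[x]$ such that $\lim_{x\to\infty}\frac{|h(x)-q(x)|}{x}<\infty$.
   Context: A Hardy field is a field of germs at $\infty$ of real-valued differentiable functions closed under differentiation. The parity-neutral binomial mean is $\mathbb{E}^{2\mathrm{bin}}_{n\le N}a_n=\frac{1}{2^{N+1}}\sum_{n=1}^{2N}\binom{N}{\lfloor n/2\rfloor}a_n$. A real sequence $(x_n)$ is uniformly distributed mod $1$ with respect to $\mathbb{E}^{2\mathrm{bin}}$ averages if $\lim_{N\to\infty}\mathbb{E}^{2\mathrm{bin}}_{n\le N}e^{2\pi i k x_n}=0$ for every nonzero integer $k$. (Finitely many initial terms where $h$ may be undefined do not affect these limits.) *)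

theory Defs
  imports "HOL-Analysis.Analysis" "HOL-Computational_Algebra.Polynomial"
begin

section \<open>Germs at infinity and Hardy fields\<close>

text \<open>
  A function defined only on some half-line \<open>(c, \<infinity>)\<close> is represented by any
  total extension; all extensions have the same germ.
\<close>

quotient_type real_germ =
  "real \<Rightarrow> real" / "\<lambda>f g. eventually (\<lambda>x. f x = g x) at_top"
  morphisms rep_real_germ germ
proof (rule equivpI)
  show "reflp (\<lambda>f g :: real \<Rightarrow> real. eventually (\<lambda>x. f x = g x) at_top)"
    by (simp add: reflp_def)
  show "symp (\<lambda>f g :: real \<Rightarrow> real. eventually (\<lambda>x. f x = g x) at_top)"
    by (simp add: symp_def eq_commute)
  show "transp (\<lambda>f g :: real \<Rightarrow> real. eventually (\<lambda>x. f x = g x) at_top)"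
    unfolding transp_def by (auto elim: eventually_elim2)
qed

instantiation real_germ :: comm_ring_1
begin

lift_definition zero_real_germ :: real_germ is "\<lambda>_. 0" .

lift_definition one_real_germ :: real_germ is "\<lambda>_. 1" .

lift_definition plus_real_germ :: "real_germ \<Rightarrow> real_germ \<Rightarrow> real_germ"
  is "\<lambda>f g x. f x + g x" by (auto elim: eventually_elim2)

lift_definition minus_real_germ :: "real_germ \<Rightarrow> real_germ \<Rightarrow> real_germ"
  is "\<lambda>f g x. f x - g x" by (auto elim: eventually_elim2)

lift_definition uminus_real_germ :: "real_germ \<Rightarrow> real_germ"
  is "\<lambda>f x. - f x" by simp

lift_definition times_real_germ :: "real_germ \<Rightarrow> real_germ \<Rightarrow> real_germ"
  is "\<lambda>f g x. f x * g x" by (auto elim: eventually_elim2)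

instance
  by standard (transfer, simp add: algebra_simps)+

end

lemma eventually_at_top_nhds:
  fixes P :: "real \<Rightarrow> bool"
  assumes "eventually P at_top"
  shows "eventually (\<lambda>x. eventually P (nhds x)) at_top"
proof -
  obtain c where c: "\<And>x. x > c \<Longrightarrow> P x"
    using assms unfolding eventually_at_top_dense by blast
  have "eventually P (nhds x)" if "x > c" for x
    using c that by (intro eventually_nhds_in_open[THEN eventually_mono, of "{c<..}"]) auto
  then show ?thesis
    by (intro eventually_mono[OF eventually_gt_at_top[of c]])
qed

lift_definition germ_deriv :: "real_germ \<Rightarrow> real_germ"
  is "\<lambda>f x. deriv f x"
  by (drule eventually_at_top_nhds) (auto elim!: eventually_mono intro: deriv_cong_ev)

lift_definition germ_differentiable :: "real_germ \<Rightarrow> bool"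
  is "\<lambda>f. eventually (\<lambda>x. f differentiable (at x)) at_top"
proof -
  have imp: "eventually (\<lambda>x. g differentiable (at x)) at_top"
    if "eventually (\<lambda>x. f x = g x) at_top" "eventually (\<lambda>x. f differentiable (at x)) at_top"
    for f g :: "real \<Rightarrow> real"
    using eventually_at_top_nhds[OF that(1)] that(2)
    by eventually_elim
      (auto simp: real_differentiable_def elim: DERIV_cong_ev[OF refl _ refl, THEN iffD1])
  show "eventually (\<lambda>x. f differentiable (at x)) at_top \<longleftrightarrow>
        eventually (\<lambda>x. g differentiable (at x)) at_top"
    if "eventually (\<lambda>x. f x = g x) at_top" for f g :: "real \<Rightarrow> real"
    using imp[of f g] imp[of g f] that by (auto simp: eq_commute)
qed

definition hardy_field :: "real_germ set \<Rightarrow> bool" where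
  "hardy_field H \<longleftrightarrow>
     0 \<in> H \<and> 1 \<in> H \<and>
     (\<forall>f\<in>H. \<forall>g\<in>H. f + g \<in> H \<and> f - g \<in> H \<and> f * g \<in> H) \<and>
     (\<forall>f\<in>H. f \<noteq> 0 \<longrightarrow> (\<exists>g\<in>H. f * g = 1)) \<and>
     (\<forall>f\<in>H. germ_differentiable f \<and> germ_deriv f \<in> H)"

section \<open>Parity-neutral binomial means\<close>

definition bin2_mean :: "nat \<Rightarrow> (nat \<Rightarrow> complex) \<Rightarrow> complex" where
  "bin2_mean N a = 1 / 2 ^ (N + 1) * (\<Sum>n = 1..2 * N. of_nat (N choose (n div 2)) * a n)"

definition bin2_uniformly_distributed_mod_1 :: "(nat \<Rightarrow> real) \<Rightarrow> bool" where
  "bin2_uniformly_distributed_mod_1 x \<longleftrightarrow>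
     (\<forall>k :: int. k \<noteq> 0 \<longrightarrow>
        (\<lambda>N. bin2_mean N
           (\<lambda>n. exp (2 * complex_of_real pi * \<i> * of_int k * complex_of_real (x n))))
        \<longlonglongrightarrow> 0)"

section \<open>Distance to rational polynomials\<close>

definition rat_poly_dist :: "(real \<Rightarrow> real) \<Rightarrow> rat poly \<Rightarrow> real \<Rightarrow> real" where
  "rat_poly_dist h p x = \<bar>h x - poly (map_poly of_rat p) x\<bar>"

end

theory Submission
  imports Defs
begin

text \<open>
The binomial weights are nearly invariant under shifts of size \<open>o(\<surd>N)\<close>, so a mean at \<open>N\<close> is small
  as soon as all exponential sums of some length \<open>L = o(\<surd>N)\<close> starting within \<open>O(\<surd>N)\<close> of \<open>N\<close> are small.
  Write \<open>h = p + g\<close> with \<open>p\<close> rational and \<open>g\<close> without rational leading term; running through steps that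
  are multiples of the denominator of \<open>p\<close> removes \<open>p\<close>. If \<open>g\<^sup>(\<^sup>d\<^sup>)\<close> has an irrational limit, Weyl's theorem
  applies with constant \<open>L\<close>. If \<open>g\<^sup>(\<^sup>d\<^sup>)\<close> tends to \<open>0\<close> and \<open>g\<^sup>(\<^sup>d\<^sup>) x\<^sup>d\<^sup>/\<^sup>2\<close> tends to \<open>\<plusminus>\<infinity>\<close>, then \<open>g\<^sup>(\<^sup>d\<^sup>)\<close> is slowly
  varying and \<open>g\<close> is close to a polynomial with small leading coefficient on intervals of length
  \<open>L \<approx> K |g\<^sup>(\<^sup>d\<^sup>)|\<^sup>-\<^sup>1\<^sup>/\<^sup>d\<close>, where Weyl differencing gives cancellation. Conditions (a) and (b) say exactly
  that one of these cases occurs. Otherwise, at the scale \<open>\<surd>N\<close>, \<open>g\<close> is asymptotically linear with slope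
  \<open>O(1/\<surd>N)\<close>, or, near points where \<open>g'\<close> is an integer, quadratic with second derivative \<open>O(1/N)\<close>; in both
  cases the mean of the phase over a random walk stays away from \<open>0\<close>.
\<close>

section \<open>Hardy fields as sets of functions\<close>

text \<open>The thresholds sqrt x and x log x are those at which a phase turns a bounded number of
  times over a window of width sqrt N, the standard deviation of the weights: the derivative of sqrt
  x has order 1 / sqrt x, and the second derivative of x log x is 1 / x. From the third derivative
  on there is no such threshold, because abs f tending to infinity already forces abs f' x^(3/2) to
  tend to infinity. Information on h must therefore be carried to its derivatives, which is the
  wrong direction for L'Hopital's rule. In a Hardy field every quotient has a limit, possibly
  infinite, and this reverses the rule. The given field need not contain x, ln or sqrt, so it is
  enlarged by them. Between x and x log x the obstacle is that g' is unbounded. A lower bound is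
  obtained only along those N at which g' is close to an integer, where the linear phase disappears
  on integer points; infinitely many such N are enough to refute convergence.\<close>

locale hardy_functions =
  fixes F :: "(real \<Rightarrow> real) set"
  assumes cong: "f \<in> F \<Longrightarrow> eventually (\<lambda>x. f x = g x) at_top \<Longrightarrow> g \<in> F"
    and one: "(\<lambda>_. 1) \<in> F"
    and add: "f \<in> F \<Longrightarrow> g \<in> F \<Longrightarrow> (\<lambda>x. f x + g x) \<in> F"
    and diff: "f \<in> F \<Longrightarrow> g \<in> F \<Longrightarrow> (\<lambda>x. f x - g x) \<in> F"
    and mult: "f \<in> F \<Longrightarrow> g \<in> F \<Longrightarrow> (\<lambda>x. f x * g x) \<in> F"
    and inverse: "f \<in> F \<Longrightarrow> (\<lambda>x. inverse (f x)) \<in> F"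
    and deriv: "f \<in> F \<Longrightarrow> deriv f \<in> F"
    and differentiable: "f \<in> F \<Longrightarrow> eventually (\<lambda>x. f differentiable at x) at_top"
    and zero_or_nonzero:
      "f \<in> F \<Longrightarrow> eventually (\<lambda>x. f x = 0) at_top \<or> eventually (\<lambda>x. f x \<noteq> 0) at_top"
begin

lemma zero: "(\<lambda>_. 0) \<in> F"
  using diff[OF one one] by simp

lemma uminus: "f \<in> F \<Longrightarrow> (\<lambda>x. - f x) \<in> F"
  using diff[OF zero] by simp

lemma divide: "f \<in> F \<Longrightarrow> g \<in> F \<Longrightarrow> (\<lambda>x. f x / g x) \<in> F"
  using mult[OF _ inverse] by (simp add: divide_inverse)

lemma power: "f \<in> F \<Longrightarrow> (\<lambda>x. f x ^ n) \<in> F"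
  by (induction n) (auto intro: one mult)

lemma of_nat: "(\<lambda>_. of_nat n) \<in> F"
  by (induction n) (auto intro: zero one add)

lemma of_int: "(\<lambda>_. of_int k) \<in> F"
  by (cases k rule: int_cases2) (auto intro: of_nat uminus)

lemma of_rat: "(\<lambda>_. of_rat r) \<in> F"
  by (cases r) (auto simp: of_rat_rat intro: divide of_int)

lemma has_deriv:
  assumes "f \<in> F"
  shows "eventually (\<lambda>x. (f has_real_derivative deriv f x) (at x)) at_top"
  using differentiable[OF assms]
  by eventually_elim (metis DERIV_deriv_iff_real_differentiable)

lemma deriv_eqI:
  assumes "eventually (\<lambda>x. (f has_real_derivative f' x) (at x)) at_top"
  shows "eventually (\<lambda>x. deriv f x = f' x) at_top"
  using assms by eventually_elim (rule DERIV_imp_deriv)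

lemma iter_deriv: "f \<in> F \<Longrightarrow> (deriv ^^ n) f \<in> F"
  by (induction n) (auto intro: deriv)

text \<open>Eventually nonzero and continuous, \<open>f\<close> keeps its sign by the intermediate
  value theorem. Applied to differences, this orders \<open>F\<close> totally at infinity, which is
  the source of all limits below.\<close>

lemma sign_cases:
  assumes "f \<in> F"
  obtains "eventually (\<lambda>x. f x = 0) at_top" | "eventually (\<lambda>x. f x > 0) at_top"
    | "eventually (\<lambda>x. f x < 0) at_top"
proof -
  consider "eventually (\<lambda>x. f x = 0) at_top" | "eventually (\<lambda>x. f x \<noteq> 0) at_top"
    using zero_or_nonzero[OF assms] by blast
  then show ?thesis
  proof cases
    case 2
    then have "eventually (\<lambda>x. f x \<noteq> 0 \<and> f differentiable at x) at_top"
      using differentiable[OF assms] by eventually_elim simp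
    then obtain X where X: "\<And>x. x \<ge> X \<Longrightarrow> f x \<noteq> 0 \<and> f differentiable at x"
      unfolding eventually_at_top_linorder by blast
    have cont: "continuous_on {X..y} f" for y
      using X by (auto intro!: continuous_at_imp_continuous_on differentiable_imp_continuous_within)
    consider "f X > 0" | "f X < 0" using X[of X] by linarith
    then show ?thesis
    proof cases
      case 1
      have "f y > 0" if "y \<ge> X" for y
      proof (rule ccontr)
        assume "\<not> f y > 0"
        then have "\<exists>x. X \<le> x \<and> x \<le> y \<and> f x = 0"
          by (intro IVT2'[of f]) (use 1 that cont in auto)
        then show False using X by blast
      qed
      then show ?thesis using that(2) unfolding eventually_at_top_linorder by blast
    next
      case 2
      have "f y < 0" if "y \<ge> X" for y
      proof (rule ccontr)
        assume "\<not> f y < 0"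
        then have "\<exists>x. X \<le> x \<and> x \<le> y \<and> f x = 0"
          by (intro IVT'[of f]) (use 2 that cont in auto)
        then show False using X by blast
      qed
      then show ?thesis using that(3) unfolding eventually_at_top_linorder by blast
    qed
  qed (use that in blast)
qed

end

text \<open>\<open>zero_or_nonzero\<close> is the field property in disguise: a germ with a
  multiplicative inverse is represented by a function without zeros near infinity. Since
  \<open>inverse 0 = 0\<close>, closure under \<open>inverse\<close> can be stated without a side
  condition, the zero germ being sent to itself.\<close>

lemma hardy_functions_of_hardy_field:
  assumes "hardy_field H"
  shows "hardy_functions {f. germ f \<in> H}"
proof
  have H0: "0 \<in> H" and H1: "1 \<in> H"
    and Hr: "\<And>f g. f \<in> H \<Longrightarrow> g \<in> H \<Longrightarrow> f + g \<in> H \<and> f - g \<in> H \<and> f * g \<in> H"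
    and Hi: "\<And>f. f \<in> H \<Longrightarrow> f \<noteq> 0 \<Longrightarrow> \<exists>g\<in>H. f * g = 1"
    and Hd: "\<And>f. f \<in> H \<Longrightarrow> germ_differentiable f \<and> germ_deriv f \<in> H"
    using assms by (simp_all add: hardy_field_def)
  have germ_eq: "germ f = germ g \<longleftrightarrow> eventually (\<lambda>x. f x = g x) at_top" for f g
    by (rule real_germ.abs_eq_iff)
  have unit: "eventually (\<lambda>x. f x \<noteq> 0) at_top \<and> germ (\<lambda>x. inverse (f x)) \<in> H"
    if f: "germ f \<in> H" and nz: "\<not> eventually (\<lambda>x. f x = 0) at_top" for f
  proof -
    have "germ f \<noteq> 0"
      using nz by (simp add: zero_real_germ_def germ_eq)
    then obtain g where g: "g \<in> H" "germ f * g = 1"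
      using Hi f by blast
    obtain g' where g': "g = germ g'"
      by (induct g rule: real_germ.abs_induct) blast
    have ev: "eventually (\<lambda>x. f x * g' x = 1) at_top"
      using g(2) by (simp add: g' times_real_germ.abs_eq one_real_germ_def germ_eq)
    have "eventually (\<lambda>x. g' x = inverse (f x)) at_top"
      using ev by eventually_elim (simp add: inverse_unique)
    then have "germ g' = germ (\<lambda>x. inverse (f x))"
      by (simp add: germ_eq)
    then have "germ (\<lambda>x. inverse (f x)) = g"
      by (simp add: g')
    moreover have "eventually (\<lambda>x. f x \<noteq> 0) at_top"
      using ev by eventually_elim auto
    ultimately show ?thesis using g by simp
  qed
  show "g \<in> {f. germ f \<in> H}"
    if "f \<in> {f. germ f \<in> H}" "eventually (\<lambda>x. f x = g x) at_top" for f g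
    using that germ_eq[of f g] by simp
  show "(\<lambda>_. 1) \<in> {f. germ f \<in> H}"
    using H1 by (simp add: one_real_germ_def)
  fix f g assume f: "f \<in> {f. germ f \<in> H}"
  show "(\<lambda>x. inverse (f x)) \<in> {f. germ f \<in> H}"
  proof (cases "eventually (\<lambda>x. f x = 0) at_top")
    case True
    then have "eventually (\<lambda>x. inverse (f x) = 0) at_top"
      by eventually_elim simp
    then have "germ (\<lambda>x. inverse (f x)) = 0"
      by (simp add: zero_real_germ_def germ_eq)
    then show ?thesis using H0 by simp
  qed (use unit f in blast)
  show "eventually (\<lambda>x. f x = 0) at_top \<or> eventually (\<lambda>x. f x \<noteq> 0) at_top"
    using unit f by blast
  show "deriv f \<in> {f. germ f \<in> H}" "eventually (\<lambda>x. f differentiable at x) at_top"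
    using Hd[of "germ f"] f by (auto simp: germ_deriv.abs_eq germ_differentiable.abs_eq)
  assume g: "g \<in> {f. germ f \<in> H}"
  show "(\<lambda>x. f x + g x) \<in> {f. germ f \<in> H}" "(\<lambda>x. f x - g x) \<in> {f. germ f \<in> H}"
    "(\<lambda>x. f x * g x) \<in> {f. germ f \<in> H}"
    using Hr[of "germ f" "germ g"] f g
    by (auto simp: plus_real_germ.abs_eq minus_real_germ.abs_eq times_real_germ.abs_eq)
qed

section \<open>Adjoining a solution of a linear first-order equation\<close>

locale hardy_adjoin = hardy_functions +
  fixes y a b E :: "real \<Rightarrow> real"
  assumes a: "a \<in> F" and b: "b \<in> F"
    and y': "eventually (\<lambda>x. (y has_real_derivative a x * y x + b x) (at x)) at_top"
    and E': "eventually (\<lambda>x. (E has_real_derivative a x * E x) (at x)) at_top"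
    and E: "eventually (\<lambda>x. E x > 0) at_top"
begin

text \<open>The polynomials in \<open>y\<close> of degree at most \<open>n\<close> over
  \<open>F\<close>, taken as functions and not as formal expressions: \<open>y\<close> may be
  algebraic over \<open>F\<close> or even belong to it, and the leading coefficient may
  vanish.\<close>

primrec pol :: "nat \<Rightarrow> (real \<Rightarrow> real) set" where
  "pol 0 = F"
| "pol (Suc n) = {(\<lambda>x. c x * y x ^ Suc n + f x) | c f. c \<in> F \<and> f \<in> pol n}"

lemma pol_SucI: "c \<in> F \<Longrightarrow> f \<in> pol n \<Longrightarrow> (\<lambda>x. c x * y x ^ Suc n + f x) \<in> pol (Suc n)"
  by auto

lemma pol_mono_Suc: "f \<in> pol n \<Longrightarrow> f \<in> pol (Suc n)"
  using pol_SucI[OF zero, of f n] by simp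

lemma pol_mono: "m \<le> n \<Longrightarrow> f \<in> pol m \<Longrightarrow> f \<in> pol n"
  by (induction rule: dec_induct) (auto simp del: pol.simps intro: pol_mono_Suc)

lemma pol_add: "f \<in> pol n \<Longrightarrow> g \<in> pol n \<Longrightarrow> (\<lambda>x. f x + g x) \<in> pol n"
proof (induction n arbitrary: f g)
  case (Suc n)
  then obtain c f' d g' where *: "c \<in> F" "d \<in> F" "f' \<in> pol n" "g' \<in> pol n"
    "f = (\<lambda>x. c x * y x ^ Suc n + f' x)" "g = (\<lambda>x. d x * y x ^ Suc n + g' x)"
    by auto
  have "(\<lambda>x. f x + g x) = (\<lambda>x. (c x + d x) * y x ^ Suc n + (f' x + g' x))"
    by (simp add: * algebra_simps)
  then show ?case
    using add[OF *(1,2)] Suc.IH[OF *(3,4)] by auto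
qed (auto intro: add)

lemma pol_scale: "c \<in> F \<Longrightarrow> f \<in> pol n \<Longrightarrow> (\<lambda>x. c x * f x) \<in> pol n"
proof (induction n arbitrary: f)
  case (Suc n)
  then obtain d f' where *: "d \<in> F" "f' \<in> pol n" "f = (\<lambda>x. d x * y x ^ Suc n + f' x)"
    by auto
  have "(\<lambda>x. c x * f x) = (\<lambda>x. (c x * d x) * y x ^ Suc n + c x * f' x)"
    by (simp add: * algebra_simps)
  then show ?case
    using mult[OF Suc.prems(1) *(1)] Suc.IH[OF Suc.prems(1) *(2)] by auto
qed (auto intro: mult)

lemma pol_times_y: "f \<in> pol n \<Longrightarrow> (\<lambda>x. y x * f x) \<in> pol (Suc n)"
proof (induction n arbitrary: f)
  case 0
  then show ?case using pol_SucI[of f "\<lambda>_. 0" 0] zero by (simp add: mult.commute)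
next
  case (Suc n)
  then obtain d f' where *: "d \<in> F" "f' \<in> pol n" "f = (\<lambda>x. d x * y x ^ Suc n + f' x)"
    by auto
  have "(\<lambda>x. y x * f x) = (\<lambda>x. d x * y x ^ Suc (Suc n) + y x * f' x)"
    by (simp add: * algebra_simps)
  then show ?case
    using pol_SucI[OF *(1) Suc.IH[OF *(2)]] by simp
qed

lemma pol_times_power: "f \<in> pol n \<Longrightarrow> (\<lambda>x. y x ^ k * f x) \<in> pol (k + n)"
proof (induction k)
  case (Suc k)
  have "(\<lambda>x. y x * (y x ^ k * f x)) \<in> pol (Suc (k + n))"
    by (rule pol_times_y) (use Suc in auto)
  then show ?case by (simp add: mult.assoc)
qed auto

lemma pol_mult: "f \<in> pol m \<Longrightarrow> g \<in> pol n \<Longrightarrow> (\<lambda>x. f x * g x) \<in> pol (m + n)"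
proof (induction m arbitrary: f)
  case (Suc m)
  then obtain d f' where *: "d \<in> F" "f' \<in> pol m" "f = (\<lambda>x. d x * y x ^ Suc m + f' x)"
    by auto
  have 1: "(\<lambda>x. f x * g x) = (\<lambda>x. d x * (y x ^ Suc m * g x) + f' x * g x)"
    by (simp add: * algebra_simps)
  have 2: "(\<lambda>x. d x * (y x ^ Suc m * g x)) \<in> pol (Suc m + n)"
    by (intro pol_scale * pol_times_power Suc.prems)
  have 3: "(\<lambda>x. f' x * g x) \<in> pol (Suc m + n)"
    by (rule pol_mono[OF _ Suc.IH[OF *(2) Suc.prems(2)]]) simp
  show ?case
    unfolding 1 by (rule pol_add[OF 2 3])
qed (auto intro: pol_scale)

text \<open>Linearity of y' = a y + b keeps the degree from growing: the derivative of c y^(n+1) is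
  (c' + (n+1) c a) y^(n+1) + (n+1) c b y^n.\<close>

lemma pol_deriv:
  "f \<in> pol n \<Longrightarrow> \<exists>g\<in>pol n. eventually (\<lambda>x. (f has_real_derivative g x) (at x)) at_top"
proof (induction n arbitrary: f)
  case 0
  then show ?case using deriv has_deriv by auto
next
  case (Suc n)
  then obtain c f' where *: "c \<in> F" "f' \<in> pol n" "f = (\<lambda>x. c x * y x ^ Suc n + f' x)"
    by auto
  obtain g where g: "g \<in> pol n" "eventually (\<lambda>x. (f' has_real_derivative g x) (at x)) at_top"
    using Suc.IH[OF *(2)] by blast
  define k where "k x = (deriv c x + real (Suc n) * (c x * a x)) * y x ^ Suc n +
    ((real (Suc n) * (c x * b x)) * y x ^ n + g x)" for x
  have "(\<lambda>x. y x ^ n * (real (Suc n) * (c x * b x))) \<in> pol (n + 0)"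
    by (rule pol_times_power) (auto intro!: mult of_nat * b simp del: of_nat_Suc)
  then have "(\<lambda>x. (real (Suc n) * (c x * b x)) * y x ^ n + g x) \<in> pol n"
    using g(1) pol_add by (simp add: mult.commute)
  moreover have "(\<lambda>x. deriv c x + real (Suc n) * (c x * a x)) \<in> F"
    by (intro add mult deriv * of_nat a)
  ultimately have "k \<in> pol (Suc n)"
    unfolding k_def[abs_def] by (intro pol_SucI)
  moreover have "eventually (\<lambda>x. (f has_real_derivative k x) (at x)) at_top"
    using g(2) has_deriv[OF *(1)] y'
  proof eventually_elim
    case (elim x)
    have "((\<lambda>x. c x * y x ^ Suc n + f' x) has_real_derivative
      (deriv c x * y x ^ Suc n + (real (Suc n) * ((a x * y x + b x) * y x ^ n)) * c x + g x)) (at x)"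
      using elim by (auto intro!: derivative_eq_intros simp del: of_nat_Suc power_Suc)
    then show ?case
      by (simp add: * k_def algebra_simps)
  qed
  ultimately show ?case by blast
qed

text \<open>Divide a polynomial of degree \<open>n\<close> in \<open>y\<close> by its leading coefficient and by \<open>E\<^sup>n\<close>. The numerator of the
  derivative of the result has degree less than \<open>n\<close>, because \<open>y\<close> and \<open>E\<close> have the same
  homogeneous equation; if it is eventually nonzero, Rolle's theorem leaves at most one zero.\<close>

lemma pol_zero_or_nonzero:
  "f \<in> pol n \<Longrightarrow> eventually (\<lambda>x. f x = 0) at_top \<or> eventually (\<lambda>x. f x \<noteq> 0) at_top"
proof (induction n arbitrary: f)
  case 0
  then show ?case using zero_or_nonzero by auto
next
  case (Suc n)
  then obtain c f' where *: "c \<in> F" "f' \<in> pol n" "f = (\<lambda>x. c x * y x ^ Suc n + f' x)"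
    by auto
  consider "eventually (\<lambda>x. c x = 0) at_top" | "eventually (\<lambda>x. c x \<noteq> 0) at_top"
    using zero_or_nonzero[OF *(1)] by blast
  then show ?case
  proof cases
    case 1
    then have "eventually (\<lambda>x. f x = f' x) at_top"
      by eventually_elim (simp add: *)
    moreover from this have "eventually (\<lambda>x. f x = 0) at_top" if "eventually (\<lambda>x. f' x = 0) at_top"
      using that by eventually_elim simp
    moreover have "eventually (\<lambda>x. f x \<noteq> 0) at_top" if "eventually (\<lambda>x. f' x \<noteq> 0) at_top"
      using that calculation(1) by eventually_elim simp
    ultimately show ?thesis
      using Suc.IH[OF *(2)] by blast
  next
    case 2
    define r where "r x = inverse (c x) * f' x" for x
    have r: "r \<in> pol n"
      unfolding r_def by (intro pol_scale inverse *)
    obtain r' where r': "r' \<in> pol n" "eventually (\<lambda>x. (r has_real_derivative r' x) (at x)) at_top"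
      using pol_deriv[OF r] by blast
    define Q where "Q x = y x ^ n * (real (Suc n) * b x) +
      (r' x + (- (real (Suc n) * a x)) * r x)" for x
    have "(\<lambda>x. y x ^ n * (real (Suc n) * b x)) \<in> pol (n + 0)"
      by (rule pol_times_power) (auto intro!: mult of_nat b simp del: of_nat_Suc)
    moreover have "(\<lambda>x. (- (real (Suc n) * a x)) * r x) \<in> pol n"
      by (intro pol_scale uminus mult of_nat a r)
    ultimately have Q: "Q \<in> pol n"
      unfolding Q_def add_0_right by (intro pol_add r')
    define G where "G x = (y x ^ Suc n + r x) / E x ^ Suc n" for x
    have G': "eventually (\<lambda>x. (G has_real_derivative Q x / E x ^ Suc n) (at x)) at_top"
      using r'(2) y' E' E
    proof eventually_elim
      case (elim x)
      have "((\<lambda>x. (y x ^ Suc n + r x) / E x ^ Suc n) has_real_derivative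
        ((real (Suc n) * ((a x * y x + b x) * y x ^ n) + r' x) * E x ^ Suc n -
         (y x ^ Suc n + r x) * (real (Suc n) * ((a x * E x) * E x ^ n))) / (E x ^ Suc n * E x ^ Suc n))
        (at x)"
        using elim
        by (auto intro!: derivative_eq_intros simp del: of_nat_Suc power_Suc)
      also have "((real (Suc n) * ((a x * y x + b x) * y x ^ n) + r' x) * E x ^ Suc n -
         (y x ^ Suc n + r x) * (real (Suc n) * ((a x * E x) * E x ^ n))) = Q x * E x ^ Suc n"
        by (simp add: Q_def algebra_simps)
      finally show ?case using elim by (simp add: G_def[abs_def])
    qed
    have fG: "eventually (\<lambda>x. f x = 0 \<longleftrightarrow> G x = 0) at_top"
      using 2 E by eventually_elim (auto simp: G_def r_def * field_simps)
    have "eventually (\<lambda>x. G x = 0) at_top \<or> eventually (\<lambda>x. G x \<noteq> 0) at_top"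
    proof (cases "eventually (\<lambda>x. Q x = 0) at_top")
      case True
      then have "eventually (\<lambda>x. (G has_real_derivative 0) (at x)) at_top"
        using G' by eventually_elim simp
      then obtain X where X: "\<And>x. x \<ge> X \<Longrightarrow> (G has_real_derivative 0) (at x)"
        unfolding eventually_at_top_linorder by blast
      have const: "G x = G X" if "x \<ge> X" for x
      proof (cases "x = X")
        case False
        then have "X < x" using that by simp
        then have "\<exists>z>X. z < x \<and> G x - G X = (x - X) * 0"
          by (rule MVT2[of X x G "\<lambda>_. 0"]) (use X in auto)
        then show ?thesis by auto
      qed simp
      have ev: "eventually (\<lambda>x. G x = G X) at_top"
        using eventually_ge_at_top[of X] by eventually_elim (rule const)
      show ?thesis
      proof (cases "G X = 0")
        case True
        then show ?thesis using ev by simp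
      next
        case False
        have "eventually (\<lambda>x. G x \<noteq> 0) at_top" using ev by eventually_elim (simp add: False)
        then show ?thesis ..
      qed
    next
      case False
      then have "eventually (\<lambda>x. Q x \<noteq> 0) at_top"
        using Suc.IH[OF Q] by blast
      then have "eventually (\<lambda>x. (G has_real_derivative Q x / E x ^ Suc n) (at x) \<and>
        Q x / E x ^ Suc n \<noteq> 0) at_top"
        using G' E by eventually_elim simp
      then obtain X where X: "\<And>x. x \<ge> X \<Longrightarrow> (G has_real_derivative Q x / E x ^ Suc n) (at x) \<and>
          Q x / E x ^ Suc n \<noteq> 0"
        unfolding eventually_at_top_linorder by blast
      have inj: "False" if "X \<le> u" "u < v" "G u = 0" "G v = 0" for u v
      proof -
        have "\<exists>z>u. z < v \<and> (G has_real_derivative 0) (at z)"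
        proof (rule Rolle)
          show "continuous_on {u..v} G"
          proof (intro continuous_at_imp_continuous_on ballI)
            fix x assume "x \<in> {u..v}"
            then show "isCont G x" using X[of x] \<open>X \<le> u\<close> by (auto intro: DERIV_isCont)
          qed
          show "G differentiable at x" if "u < x" "x < v" for x
            using X[of x] that \<open>X \<le> u\<close> unfolding real_differentiable_def by auto
        qed (use that in auto)
        then obtain z where z: "z > u" "(G has_real_derivative 0) (at z)" by blast
        then have "(G has_real_derivative Q z / E z ^ Suc n) (at z)" "Q z / E z ^ Suc n \<noteq> 0"
          using X[of z] \<open>X \<le> u\<close> by auto
        then show False
          using DERIV_unique[OF z(2)] by metis
      qed
      show ?thesis
      proof (cases "\<exists>u\<ge>X. G u = 0")
        case True
        then obtain u where "u \<ge> X" "G u = 0" by blast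
        then have "\<forall>x>u. G x \<noteq> 0" using inj by blast
        then show ?thesis by (auto simp: eventually_at_top_dense)
      qed (auto simp: eventually_at_top_linorder)
    qed
    then show ?thesis
    proof
      assume "eventually (\<lambda>x. G x = 0) at_top"
      then have "eventually (\<lambda>x. f x = 0) at_top" using fG by eventually_elim simp
      then show ?thesis ..
    next
      assume "eventually (\<lambda>x. G x \<noteq> 0) at_top"
      then have "eventually (\<lambda>x. f x \<noteq> 0) at_top" using fG by eventually_elim simp
      then show ?thesis ..
    qed
  qed
qed

definition adjoined :: "(real \<Rightarrow> real) set" where
  "adjoined = {f. \<exists>m n. \<exists>p\<in>pol m. \<exists>q\<in>pol n. eventually (\<lambda>x. q x \<noteq> 0 \<and> f x = p x / q x) at_top}"

lemma adjoinedI: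
  "p \<in> pol m \<Longrightarrow> q \<in> pol n \<Longrightarrow> eventually (\<lambda>x. q x \<noteq> 0 \<and> f x = p x / q x) at_top \<Longrightarrow> f \<in> adjoined"
  unfolding adjoined_def by blast

lemma adjoinedE:
  assumes "f \<in> adjoined"
  obtains n p q where "p \<in> pol n" "q \<in> pol n"
    "eventually (\<lambda>x. q x \<noteq> 0 \<and> f x = p x / q x) at_top"
proof -
  obtain m n p q where *: "p \<in> pol m" "q \<in> pol n"
    "eventually (\<lambda>x. q x \<noteq> 0 \<and> f x = p x / q x) at_top"
    using assms unfolding adjoined_def by blast
  show ?thesis
    by (rule that[of p "max m n" q]) (use * in \<open>auto intro: pol_mono[rotated]\<close>)
qed

lemma pol_adjoined: "f \<in> pol n \<Longrightarrow> f \<in> adjoined"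
  by (rule adjoinedI[of _ n "\<lambda>_. 1" 0]) (auto intro: one)

lemma pol_quotient_deriv:
  assumes "p \<in> pol n" "q \<in> pol n" "eventually (\<lambda>x. q x \<noteq> 0 \<and> f x = p x / q x) at_top"
  obtains r where "r \<in> pol (n + n)"
    "eventually (\<lambda>x. (f has_real_derivative r x / (q x * q x)) (at x)) at_top"
proof -
  obtain p' where p': "p' \<in> pol n" "eventually (\<lambda>x. (p has_real_derivative p' x) (at x)) at_top"
    using pol_deriv[OF assms(1)] by blast
  obtain q' where q': "q' \<in> pol n" "eventually (\<lambda>x. (q has_real_derivative q' x) (at x)) at_top"
    using pol_deriv[OF assms(2)] by blast
  show ?thesis
  proof
    have "(\<lambda>_. -1) \<in> F" using uminus[OF one] by simp
    then have "(\<lambda>x. p' x * q x + (-1) * (p x * q' x)) \<in> pol (n + n)"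
      by (intro pol_add pol_scale pol_mult p' q' assms)
    then show "(\<lambda>x. p' x * q x - p x * q' x) \<in> pol (n + n)" by simp
    show "eventually (\<lambda>x. (f has_real_derivative (p' x * q x - p x * q' x) / (q x * q x)) (at x)) at_top"
      \<comment> \<open>Equality at a point says nothing about derivatives. An identity that holds
        eventually also holds on a neighbourhood of every large \<open>x\<close>, and in that form
        it can be differentiated.\<close>
      using eventually_at_top_nhds[OF assms(3)] p'(2) q'(2)
    proof eventually_elim
      case (elim x)
      then have ev: "eventually (\<lambda>x. f x = p x / q x) (nhds x)" and "q x \<noteq> 0"
        by (auto elim: eventually_mono dest: eventually_nhds_x_imp_x)
      have "((\<lambda>x. p x / q x) has_real_derivative (p' x * q x - p x * q' x) / (q x * q x)) (at x)"
        by (rule DERIV_divide) (use elim \<open>q x \<noteq> 0\<close> in auto)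
      then show ?case
        using DERIV_cong_ev[OF refl ev refl] by simp
    qed
  qed
qed

lemma hardy_functions_adjoined: "hardy_functions adjoined"
proof
  show "g \<in> adjoined" if f: "f \<in> adjoined" and fg: "eventually (\<lambda>x. f x = g x) at_top" for f g
  proof -
    obtain n p q where *: "p \<in> pol n" "q \<in> pol n"
      "eventually (\<lambda>x. q x \<noteq> 0 \<and> f x = p x / q x) at_top"
      using adjoinedE[OF f] .
    show ?thesis
      by (rule adjoinedI[OF *(1,2)]) (use fg *(3) in eventually_elim, simp)
  qed
  show "(\<lambda>_. 1) \<in> adjoined"
    by (rule pol_adjoined[of _ 0]) (auto intro: one)
  fix f assume f: "f \<in> adjoined"
  obtain n p q where pq: "p \<in> pol n" "q \<in> pol n"
    "eventually (\<lambda>x. q x \<noteq> 0 \<and> f x = p x / q x) at_top"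
    using adjoinedE[OF f] .
  obtain r where r: "r \<in> pol (n + n)"
    "eventually (\<lambda>x. (f has_real_derivative r x / (q x * q x)) (at x)) at_top"
    using pol_quotient_deriv[OF pq] .
  show "deriv f \<in> adjoined"
  proof (rule adjoinedI[OF r(1) pol_mult[OF pq(2) pq(2)]])
    show "eventually (\<lambda>x. q x * q x \<noteq> 0 \<and> deriv f x = r x / (q x * q x)) at_top"
      using r(2) pq(3) by eventually_elim (auto intro: DERIV_imp_deriv)
  qed
  show "eventually (\<lambda>x. f differentiable at x) at_top"
    using r(2) by eventually_elim (auto simp: real_differentiable_def)
  consider (z) "eventually (\<lambda>x. p x = 0) at_top" | (nz) "eventually (\<lambda>x. p x \<noteq> 0) at_top"
    using pol_zero_or_nonzero[OF pq(1)] by blast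
  then show "eventually (\<lambda>x. f x = 0) at_top \<or> eventually (\<lambda>x. f x \<noteq> 0) at_top"
  proof cases
    case z
    then have "eventually (\<lambda>x. f x = 0) at_top" using pq(3) by eventually_elim simp
    then show ?thesis ..
  next
    case nz
    then have "eventually (\<lambda>x. f x \<noteq> 0) at_top" using pq(3) by eventually_elim simp
    then show ?thesis ..
  qed
  show "(\<lambda>x. inverse (f x)) \<in> adjoined"
    using pol_zero_or_nonzero[OF pq(1)]
  proof
    assume "eventually (\<lambda>x. p x = 0) at_top"
    then show ?thesis
      by (rule adjoinedI[OF pq(1,2), OF eventually_elim2[OF pq(3)]]) simp
  next
    assume "eventually (\<lambda>x. p x \<noteq> 0) at_top"
    then show ?thesis
      by (rule adjoinedI[OF pq(2,1), OF eventually_elim2[OF pq(3)]]) simp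
  qed
  fix g assume g: "g \<in> adjoined"
  obtain k u v where uv: "u \<in> pol k" "v \<in> pol k"
    "eventually (\<lambda>x. v x \<noteq> 0 \<and> g x = u x / v x) at_top"
    using adjoinedE[OF g] .
  have "(\<lambda>_. -1) \<in> F" using uminus[OF one] by simp
  then have m: "(\<lambda>x. (-1) * u x) \<in> pol k" by (rule pol_scale) (rule uv)
  have "(\<lambda>x. p x * v x + q x * u x) \<in> pol (n + k)"
    by (intro pol_add pol_mult pq uv)
  then show "(\<lambda>x. f x + g x) \<in> adjoined"
    by (rule adjoinedI[OF _ pol_mult[OF pq(2) uv(2)]])
       (use pq(3) uv(3) in eventually_elim, auto simp: field_simps)
  have "(\<lambda>x. p x * v x + q x * ((-1) * u x)) \<in> pol (n + k)"
    by (intro pol_add pol_mult pq uv m)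
  then show "(\<lambda>x. f x - g x) \<in> adjoined"
    by (rule adjoinedI[OF _ pol_mult[OF pq(2) uv(2)]])
       (use pq(3) uv(3) in eventually_elim, auto simp: field_simps)
  show "(\<lambda>x. f x * g x) \<in> adjoined"
    by (rule adjoinedI[OF pol_mult[OF pq(1) uv(1)] pol_mult[OF pq(2) uv(2)]])
       (use pq(3) uv(3) in eventually_elim, auto)
qed

lemma adjoined_superset: "F \<subseteq> adjoined"
  using pol_adjoined[of _ 0] by auto

lemma y_adjoined: "y \<in> adjoined"
proof -
  have "(\<lambda>x. y x * 1) \<in> pol (Suc 0)"
    by (rule pol_times_y) (simp add: one)
  from pol_adjoined[OF this] show ?thesis by simp
qed

end

locale hardy_functions_ln = hardy_functions +
  assumes ident: "(\<lambda>x. x) \<in> F" and ln: "ln \<in> F" and sqrt: "sqrt \<in> F"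

text \<open>Each function solves y' = a y + b over the field reached so far: x with a = 0 and b = 1,
  then ln with a = 0 and b = 1/x, then sqrt with a = 1/(2x) and b = 0. The positive homogeneous
  solution \<open>E\<close> is 1 in the first two cases and sqrt itself in the third.\<close>

lemma hardy_functions_extend:
  assumes "hardy_functions F"
  obtains G where "hardy_functions_ln G" "F \<subseteq> G"
proof -
  have A0: "hardy_adjoin F (\<lambda>x. x) (\<lambda>_. 0) (\<lambda>_. 1) (\<lambda>_. 1)"
    using assms by (auto simp: hardy_adjoin_def hardy_adjoin_axioms_def hardy_functions.zero hardy_functions.one)
  obtain F1 where F1: "hardy_functions F1" "F \<subseteq> F1" "(\<lambda>x. x) \<in> F1"
    using hardy_adjoin.hardy_functions_adjoined[OF A0] hardy_adjoin.adjoined_superset[OF A0]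
      hardy_adjoin.y_adjoined[OF A0] by blast
  have "eventually (\<lambda>x. (ln has_real_derivative inverse x) (at x)) at_top"
    using eventually_gt_at_top[of 0] by eventually_elim (rule DERIV_ln)
  then have A1: "hardy_adjoin F1 ln (\<lambda>_. 0) (\<lambda>x. inverse x) (\<lambda>_. 1)"
    using F1 hardy_functions.inverse[OF F1(1,3)]
    by (auto simp: hardy_adjoin_def hardy_adjoin_axioms_def hardy_functions.zero hardy_functions.one)
  obtain F2 where F2: "hardy_functions F2" "F1 \<subseteq> F2" "ln \<in> F2"
    using hardy_adjoin.hardy_functions_adjoined[OF A1] hardy_adjoin.adjoined_superset[OF A1]
      hardy_adjoin.y_adjoined[OF A1] by blast
  have sq: "eventually (\<lambda>x. (sqrt has_real_derivative inverse (x + x) * sqrt x) (at x)) at_top"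
    using eventually_gt_at_top[of 0]
  proof eventually_elim
    case (elim x)
    have "inverse (sqrt x) / 2 = inverse (x + x) * sqrt x"
      using elim by (simp add: field_simps)
    with DERIV_real_sqrt[OF elim] show ?case by simp
  qed
  have "(\<lambda>x. inverse (x + x)) \<in> F2"
    using F1 F2 by (intro hardy_functions.inverse hardy_functions.add) auto
  then have A2: "hardy_adjoin F2 sqrt (\<lambda>x. inverse (x + x)) (\<lambda>_. 0) sqrt"
    using F2 sq by (auto simp: hardy_adjoin_def hardy_adjoin_axioms_def hardy_functions.zero
      hardy_functions.one intro: eventually_mono[OF eventually_gt_at_top[of 0]])
  have "hardy_functions_ln (hardy_adjoin.adjoined F2 sqrt)"
    using hardy_adjoin.hardy_functions_adjoined[OF A2] hardy_adjoin.adjoined_superset[OF A2]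
      hardy_adjoin.y_adjoined[OF A2] F1 F2
    by (auto simp: hardy_functions_ln_def hardy_functions_ln_axioms_def)
  moreover have "F \<subseteq> hardy_adjoin.adjoined F2 sqrt"
    using hardy_adjoin.adjoined_superset[OF A2] F1 F2 by blast
  ultimately show ?thesis using that by blast
qed

section \<open>Limits and derivatives in a Hardy field\<close>

lemma nondecreasing_of_deriv:
  fixes f f' :: "real \<Rightarrow> real"
  assumes "eventually (\<lambda>x. (f has_real_derivative f' x) (at x)) at_top"
    and "eventually (\<lambda>x. f' x \<ge> 0) at_top"
  obtains X where "\<And>x y. X \<le> x \<Longrightarrow> x \<le> y \<Longrightarrow> f x \<le> f y"
proof -
  have "eventually (\<lambda>x. (f has_real_derivative f' x) (at x) \<and> f' x \<ge> 0) at_top"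
    using assms by eventually_elim simp
  then obtain X where X: "\<And>x. x \<ge> X \<Longrightarrow> (f has_real_derivative f' x) (at x) \<and> f' x \<ge> 0"
    unfolding eventually_at_top_linorder by blast
  have "f x \<le> f y" if "X \<le> x" "x \<le> y" for x y
  proof (rule DERIV_nonneg_imp_nondecreasing[OF \<open>x \<le> y\<close>])
    fix u assume "x \<le> u"
    then show "\<exists>z. (f has_real_derivative z) (at u) \<and> 0 \<le> z" using X[of u] that by auto
  qed
  then show ?thesis by (rule that)
qed

lemma bounded_below_of_deriv:
  fixes f f' :: "real \<Rightarrow> real"
  assumes "eventually (\<lambda>x. (f has_real_derivative f' x) (at x)) at_top"
    and "eventually (\<lambda>x. f' x \<ge> 0) at_top"
  obtains c where "eventually (\<lambda>x. c \<le> f x) at_top"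
proof -
  obtain X where X: "\<And>x y. X \<le> x \<Longrightarrow> x \<le> y \<Longrightarrow> f x \<le> f y"
    using nondecreasing_of_deriv[OF assms] by blast
  have "eventually (\<lambda>x. f X \<le> f x) at_top"
    using eventually_ge_at_top[of X] by eventually_elim (rule X, auto)
  then show ?thesis by (rule that)
qed

lemma bounded_above_of_deriv:
  fixes f f' :: "real \<Rightarrow> real"
  assumes "eventually (\<lambda>x. (f has_real_derivative f' x) (at x)) at_top"
    and "eventually (\<lambda>x. f' x \<le> 0) at_top"
  obtains c where "eventually (\<lambda>x. f x \<le> c) at_top"
proof -
  have "eventually (\<lambda>x. ((\<lambda>x. - f x) has_real_derivative - f' x) (at x)) at_top"
    using assms(1) by eventually_elim (rule DERIV_minus)
  moreover have "eventually (\<lambda>x. - f' x \<ge> 0) at_top"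
    using assms(2) by eventually_elim simp
  ultimately obtain c where "eventually (\<lambda>x. c \<le> - f x) at_top"
      by (rule bounded_below_of_deriv)
  then have "eventually (\<lambda>x. f x \<le> - c) at_top" by eventually_elim simp
  then show ?thesis by (rule that)
qed

lemma not_bounded_above_at_top:
  fixes f :: "real \<Rightarrow> real"
  assumes "filterlim f at_top at_top" "eventually (\<lambda>x. f x \<le> c) at_top"
  shows False
proof -
  have "eventually (\<lambda>x. f x > c) at_top"
    using assms(1) by (simp add: filterlim_at_top_dense)
  with assms(2) have "eventually (\<lambda>x::real. False) at_top"
    by eventually_elim simp
  then show False by simp
qed

lemma tendsto_not_abs_at_top:
  fixes f :: "real \<Rightarrow> real"
  assumes "(f \<longlongrightarrow> c) at_top" "filterlim (\<lambda>x. \<bar>f x\<bar>) at_top at_top"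
  shows False
proof -
  have "eventually (\<lambda>x. \<bar>f x\<bar> < \<bar>c\<bar> + 1) at_top"
    by (rule order_tendstoD[OF tendsto_rabs[OF assms(1)]]) simp
  then have "eventually (\<lambda>x. \<bar>f x\<bar> \<le> \<bar>c\<bar> + 1) at_top"
    by eventually_elim simp
  then show False using not_bounded_above_at_top[OF assms(2)] by blast
qed

lemma filterlim_at_top_cong:
  assumes "filterlim f at_top G" "eventually (\<lambda>x. f x = g x) G"
  shows "filterlim g at_top G"
  using assms filterlim_cong[OF refl refl assms(2)] by simp

context hardy_functions
begin

text \<open>If liminf and limsup differed, a rational level strictly between them would be crossed
  again and again, against the eventual sign of \<open>f\<close> minus that level. The level is
  rational because those are the constants known to lie in \<open>F\<close>.\<close>

lemma limit_cases:
  assumes f: "f \<in> F"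
  obtains c where "(f \<longlongrightarrow> c) at_top" | "filterlim f at_top at_top" | "filterlim f at_bot at_top"
proof -
  define g where "g x = ereal (f x)" for x
  have "\<not> Liminf at_top g < Limsup at_top g"
  proof
    assume "Liminf at_top g < Limsup at_top g"
    then obtain r where r: "Liminf at_top g < ereal (real_of_rat r)" "ereal (real_of_rat r) < Limsup at_top g"
      using ereal_dense3 by blast
    have "(\<lambda>x. f x - real_of_rat r) \<in> F"
      by (intro diff f of_rat)
    then show False
    proof (cases rule: sign_cases)
      case 1
      then have "eventually (\<lambda>x. ereal (real_of_rat r) \<le> g x) at_top"
        by eventually_elim (simp add: g_def)
      then show False using Liminf_bounded r(1) by fastforce
    next
      case 2
      then have "eventually (\<lambda>x. ereal (real_of_rat r) \<le> g x) at_top"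
        by eventually_elim (simp add: g_def)
      then show False using Liminf_bounded r(1) by fastforce
    next
      case 3
      then have "eventually (\<lambda>x. g x \<le> ereal (real_of_rat r)) at_top"
        by eventually_elim (simp add: g_def)
      then show False using Limsup_bounded r(2) by fastforce
    qed
  qed
  then have "Liminf at_top g = Limsup at_top g"
    using Liminf_le_Limsup[of at_top g] by (simp add: order.order_iff_strict)
  then have lim: "(g \<longlongrightarrow> Liminf at_top g) at_top"
    by (simp add: tendsto_iff_Liminf_eq_Limsup)
  show ?thesis
  proof (cases "Liminf at_top g")
    case (real c)
    then have "(f \<longlongrightarrow> c) at_top" using lim by (simp add: g_def[abs_def])
    then show ?thesis by (rule that(1))
  next
    case PInf
    then have "filterlim f at_top at_top"
      using lim by (simp add: g_def[abs_def] tendsto_PInfty filterlim_at_top_dense)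
    then show ?thesis by (rule that(2))
  next
    case MInf
    then have "filterlim f at_bot at_top"
      using lim by (simp add: g_def[abs_def] tendsto_MInfty filterlim_at_bot_dense)
    then show ?thesis by (rule that(3))
  qed
qed

lemma abs_limit_cases:
  assumes "f \<in> F"
  obtains c where "(f \<longlongrightarrow> c) at_top" | "filterlim (\<lambda>x. \<bar>f x\<bar>) at_top at_top"
  using assms
proof (cases rule: limit_cases)
  case 2
  then show ?thesis by (intro that(2) filterlim_compose[OF filterlim_abs_real])
next
  case 3
  then show ?thesis
    using filterlim_compose[OF filterlim_abs_real, of "\<lambda>x. - f x"]
    by (intro that(2)) (simp add: filterlim_uminus_at_bot)
qed (use that in blast)

section \<open>L'Hopital's rule and its converse\<close>

lemma deriv_pos:
  assumes "\<phi> \<in> F" "filterlim \<phi> at_top at_top"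
  shows "eventually (\<lambda>x. deriv \<phi> x > 0) at_top"
proof -
  have "\<not> eventually (\<lambda>x. deriv \<phi> x \<le> 0) at_top"
  proof
    assume "eventually (\<lambda>x. deriv \<phi> x \<le> 0) at_top"
    then obtain c where "eventually (\<lambda>x. \<phi> x \<le> c) at_top"
      using bounded_above_of_deriv[OF has_deriv[OF assms(1)]] by blast
    then show False by (rule not_bounded_above_at_top[OF assms(2)])
  qed
  moreover have "eventually (\<lambda>x. deriv \<phi> x \<le> 0) at_top" if "eventually (\<lambda>x. deriv \<phi> x = 0) at_top"
    using that by eventually_elim simp
  moreover have "eventually (\<lambda>x. deriv \<phi> x \<le> 0) at_top" if "eventually (\<lambda>x. deriv \<phi> x < 0) at_top"
    using that by eventually_elim simp
  ultimately show ?thesis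
    using deriv[OF assms(1)] sign_cases by blast
qed

lemma quotient_tendsto_of_deriv:
  assumes "f \<in> F" "\<phi> \<in> F" "filterlim \<phi> at_top at_top"
    and "((\<lambda>x. deriv f x / deriv \<phi> x) \<longlongrightarrow> c) at_top"
  shows "((\<lambda>x. f x / \<phi> x) \<longlongrightarrow> c) at_top"
  using lhospital_at_top_at_top[of \<phi> "deriv \<phi>" f "deriv f" c] assms
    eventually_mono[OF deriv_pos[OF assms(2,3)], of "\<lambda>x. deriv \<phi> x \<noteq> 0"]
    has_deriv[OF assms(1)] has_deriv[OF assms(2)]
  by simp

lemma quotient_at_top_of_deriv:
  assumes f: "f \<in> F" and \<phi>: "\<phi> \<in> F" "filterlim \<phi> at_top at_top"
    and q: "filterlim (\<lambda>x. deriv f x / deriv \<phi> x) at_top at_top"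
  shows "filterlim (\<lambda>x. f x / \<phi> x) at_top at_top"
  unfolding filterlim_at_top
proof
  fix K
  \<comment> \<open>The surplus of one \<open>\<phi>\<close> in \<open>(K + 1) * \<phi>\<close>
    absorbs the unknown lower bound \<open>c\<close> once \<open>\<phi>\<close> exceeds
    \<open>\<bar>c\<bar> + 1\<close>.\<close>
  have "eventually (\<lambda>x. ((\<lambda>x. f x - (K + 1) * \<phi> x) has_real_derivative deriv f x - (K + 1) * deriv \<phi> x) (at x)) at_top"
    using has_deriv[OF f] has_deriv[OF \<phi>(1)]
    by eventually_elim (auto intro!: derivative_eq_intros)
  moreover have "eventually (\<lambda>x. deriv f x - (K + 1) * deriv \<phi> x \<ge> 0) at_top"
    using q[unfolded filterlim_at_top, rule_format, of "K + 1"] deriv_pos[OF \<phi>]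
    by eventually_elim (simp add: field_simps)
  ultimately obtain c where "eventually (\<lambda>x. c \<le> f x - (K + 1) * \<phi> x) at_top"
      by (rule bounded_below_of_deriv)
  then show "eventually (\<lambda>x. K \<le> f x / \<phi> x) at_top"
    using \<phi>(2)[unfolded filterlim_at_top, rule_format, of "\<bar>c\<bar> + 1"]
  proof eventually_elim
    case (elim x)
    then have "K * \<phi> x \<le> f x" by (simp add: algebra_simps)
    then show ?case using elim by (simp add: field_simps)
  qed
qed

text \<open>The converse of L'Hopital's rule fails in general only because the quotient of the
  derivatives may oscillate. Here that quotient lies in \<open>F\<close> and has a limit, finite or
  infinite, which the direct rule identifies with the limit of \<open>f / \<phi>\<close>. The
  version for infinite limits below rests on the same argument.\<close>

lemma deriv_quotient_tendsto:
  assumes f: "f \<in> F" and \<phi>: "\<phi> \<in> F" "filterlim \<phi> at_top at_top"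
    and lim: "((\<lambda>x. f x / \<phi> x) \<longlongrightarrow> c) at_top"
  shows "((\<lambda>x. deriv f x / deriv \<phi> x) \<longlongrightarrow> c) at_top"
proof -
  have *: "\<not> filterlim (\<lambda>x. deriv g x / deriv \<phi> x) at_top at_top"
    if g: "g \<in> F" "((\<lambda>x. g x / \<phi> x) \<longlongrightarrow> d) at_top" for g d
  proof
    assume "filterlim (\<lambda>x. deriv g x / deriv \<phi> x) at_top at_top"
    from quotient_at_top_of_deriv[OF g(1) \<phi> this]
    have "filterlim (\<lambda>x. \<bar>g x / \<phi> x\<bar>) at_top at_top"
      by (rule filterlim_at_top_mono) (intro always_eventually allI abs_ge_self)
    then show False using tendsto_not_abs_at_top[OF g(2)] by simp
  qed
  have "(\<lambda>x. deriv f x / deriv \<phi> x) \<in> F"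
    by (intro divide deriv f \<phi>)
  then show ?thesis
  proof (cases rule: limit_cases)
    case (1 d)
    from quotient_tendsto_of_deriv[OF f \<phi> this] have "d = c"
      using lim tendsto_unique[of at_top] by (metis trivial_limit_at_top_linorder)
    with 1 show ?thesis by simp
  next
    case 2
    then show ?thesis using *[OF f lim] by simp
  next
    case 3
    have "filterlim (\<lambda>x. - (deriv f x / deriv \<phi> x)) at_top at_top"
      using 3 by (simp add: filterlim_uminus_at_top)
    moreover have "eventually (\<lambda>x. - (deriv f x / deriv \<phi> x) = deriv (\<lambda>x. - f x) x / deriv \<phi> x) at_top"
      using deriv_eqI[of "\<lambda>x. - f x" "\<lambda>x. - deriv f x"] has_deriv[OF f]
      by (auto elim!: eventually_mono intro!: derivative_intros dest: DERIV_imp_deriv[OF DERIV_minus])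
    ultimately have "filterlim (\<lambda>x. deriv (\<lambda>x. - f x) x / deriv \<phi> x) at_top at_top"
      by (rule filterlim_at_top_cong)
    moreover have "((\<lambda>x. - f x / \<phi> x) \<longlongrightarrow> - c) at_top"
      using tendsto_minus[OF lim] by simp
    ultimately show ?thesis
      using *[OF uminus[OF f]] by blast
  qed
qed

lemma deriv_quotient_abs_at_top:
  assumes f: "f \<in> F" and \<phi>: "\<phi> \<in> F" "filterlim \<phi> at_top at_top"
    and lim: "filterlim (\<lambda>x. \<bar>f x / \<phi> x\<bar>) at_top at_top"
  shows "filterlim (\<lambda>x. \<bar>deriv f x / deriv \<phi> x\<bar>) at_top at_top"
proof -
  have "(\<lambda>x. deriv f x / deriv \<phi> x) \<in> F"
    by (intro divide deriv f \<phi>)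
  then show ?thesis
  proof (cases rule: abs_limit_cases)
    case (1 d)
    from tendsto_not_abs_at_top[OF quotient_tendsto_of_deriv[OF f \<phi> this] lim]
    show ?thesis ..
  qed
qed

end

section \<open>Derivatives on the scales x^n, sqrt x and x log x\<close>

lemma deriv_power_Suc: "deriv (\<lambda>x::real. x ^ Suc n) x = real (Suc n) * x ^ n"
  using DERIV_pow[of "Suc n" x] by (intro DERIV_imp_deriv) simp

lemma deriv_sqrt_eventually: "eventually (\<lambda>x. deriv sqrt x = 1 / (2 * sqrt x)) at_top"
  using eventually_gt_at_top[of 0]
  by eventually_elim (rule DERIV_imp_deriv, auto intro!: derivative_eq_intros simp: field_simps)

lemma xlnx_at_top: "filterlim (\<lambda>x::real. x * ln x) at_top at_top"
  by (intro filterlim_at_top_mult_at_top filterlim_ident ln_at_top)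

lemma deriv_xlnx: "eventually (\<lambda>x::real. deriv (\<lambda>x. x * ln x) x = ln x + 1) at_top"
  using eventually_gt_at_top[of 0]
  by eventually_elim (rule DERIV_imp_deriv, auto intro!: derivative_eq_intros)

lemma deriv_ln_plus_1: "eventually (\<lambda>x::real. deriv (\<lambda>x. ln x + 1) x = 1 / x) at_top"
  using eventually_gt_at_top[of 0]
  by eventually_elim (rule DERIV_imp_deriv, auto intro!: derivative_eq_intros)

lemma ln_plus_1_at_top: "filterlim (\<lambda>x::real. ln x + 1) at_top at_top"
  using filterlim_tendsto_add_at_top[OF tendsto_const ln_at_top, of "1::real"] by (simp add: add.commute)

context hardy_functions_ln
begin

lemma ident_power: "(\<lambda>x. x ^ n) \<in> F"
  by (intro power ident)

lemma iter_deriv_tendsto: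
  assumes "g \<in> F" "((\<lambda>x. g x / x ^ n) \<longlongrightarrow> c) at_top"
  shows "((deriv ^^ n) g \<longlongrightarrow> fact n * c) at_top"
  using assms
proof (induction n arbitrary: g c)
  case (Suc n)
  have "((\<lambda>x. deriv g x / deriv (\<lambda>x. x ^ Suc n) x) \<longlongrightarrow> c) at_top"
    by (intro deriv_quotient_tendsto Suc.prems ident_power filterlim_pow_at_top filterlim_ident) simp
  from tendsto_mult_left[OF this, of "real (Suc n)"]
  have "((\<lambda>x. deriv g x / x ^ n) \<longlongrightarrow> real (Suc n) * c) at_top"
    by (simp add: deriv_power_Suc del: of_nat_Suc power_Suc)
  from Suc.IH[OF deriv[OF Suc.prems(1)] this] show ?case
    by (simp add: funpow_swap1 mult.commute mult.left_commute)
qed simp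

lemma iter_deriv_abs_at_top:
  assumes "g \<in> F" "filterlim (\<lambda>x. \<bar>g x / x ^ n\<bar>) at_top at_top"
  shows "filterlim (\<lambda>x. \<bar>(deriv ^^ n) g x\<bar>) at_top at_top"
  using assms
proof (induction n arbitrary: g)
  case (Suc n)
  have "filterlim (\<lambda>x. \<bar>deriv g x / deriv (\<lambda>x. x ^ Suc n) x\<bar>) at_top at_top"
    by (intro deriv_quotient_abs_at_top Suc.prems ident_power filterlim_pow_at_top filterlim_ident) simp
  then have "filterlim (\<lambda>x. \<bar>deriv g x / x ^ n\<bar>) at_top at_top"
  proof (rule filterlim_at_top_mono)
    show "eventually (\<lambda>x. \<bar>deriv g x / deriv (\<lambda>x. x ^ Suc n) x\<bar> \<le> \<bar>deriv g x / x ^ n\<bar>) at_top"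
    proof (intro always_eventually allI)
      fix x
      have "\<bar>deriv g x / (real (Suc n) * x ^ n)\<bar> = \<bar>deriv g x / x ^ n\<bar> / real (Suc n)"
        by (simp add: abs_mult mult.commute)
      also have "\<dots> \<le> \<bar>deriv g x / x ^ n\<bar> / 1"
        by (intro divide_left_mono) auto
      finally show "\<bar>deriv g x / deriv (\<lambda>x. x ^ Suc n) x\<bar> \<le> \<bar>deriv g x / x ^ n\<bar>"
        unfolding deriv_power_Suc by simp
    qed
  qed
  from Suc.IH[OF deriv[OF Suc.prems(1)] this] show ?case
    by (simp add: funpow_swap1)
qed simp

lemma deriv_sqrt_abs_at_top:
  assumes "g \<in> F" "filterlim (\<lambda>x. \<bar>g x / sqrt x\<bar>) at_top at_top"
  shows "filterlim (\<lambda>x. \<bar>deriv g x\<bar> * sqrt x) at_top at_top"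
proof -
  have "filterlim (\<lambda>x. \<bar>deriv g x / deriv sqrt x\<bar>) at_top at_top"
    by (intro deriv_quotient_abs_at_top assms sqrt sqrt_at_top)
  then have "filterlim (\<lambda>x. (1 / 2) * \<bar>deriv g x / deriv sqrt x\<bar>) at_top at_top"
    by (rule filterlim_tendsto_pos_mult_at_top[OF tendsto_const, rotated]) simp
  moreover have "eventually (\<lambda>x. (1 / 2) * \<bar>deriv g x / deriv sqrt x\<bar> = \<bar>deriv g x\<bar> * sqrt x) at_top"
    using deriv_sqrt_eventually eventually_gt_at_top[of 0]
    by eventually_elim (simp add: abs_mult)
  ultimately show ?thesis
    by (rule filterlim_at_top_cong)
qed

lemma deriv_sqrt_tendsto:
  assumes "g \<in> F" "((\<lambda>x. g x / sqrt x) \<longlongrightarrow> c) at_top"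
  shows "((\<lambda>x. deriv g x * sqrt x) \<longlongrightarrow> c / 2) at_top"
proof -
  have "((\<lambda>x. deriv g x / deriv sqrt x) \<longlongrightarrow> c) at_top"
    by (intro deriv_quotient_tendsto assms sqrt sqrt_at_top)
  then have "((\<lambda>x. deriv g x / deriv sqrt x / 2) \<longlongrightarrow> c / 2) at_top"
    by (intro tendsto_divide) auto
  moreover have "eventually (\<lambda>x. deriv g x / deriv sqrt x / 2 = deriv g x * sqrt x) at_top"
    using deriv_sqrt_eventually eventually_gt_at_top[of 0]
    by eventually_elim simp
  ultimately show ?thesis
    by (rule Lim_transform_eventually)
qed

lemma xlnx: "(\<lambda>x. x * ln x) \<in> F"
  by (intro mult ident ln)

text \<open>The converse rule is applied twice, with the gauges x ln x and ln x + 1. Both tend to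
  infinity, and their derivatives are ln x + 1 and 1/x, so the scale x ln x for \<open>g\<close>
  becomes the scale 1/x for its second derivative.\<close>

lemma second_deriv_tendsto:
  assumes g: "g \<in> F" and lim: "((\<lambda>x. g x / (x * ln x)) \<longlongrightarrow> c) at_top"
  shows "((\<lambda>x. (deriv ^^ 2) g x * x) \<longlongrightarrow> c) at_top"
proof -
  have "((\<lambda>x. deriv g x / deriv (\<lambda>x. x * ln x) x) \<longlongrightarrow> c) at_top"
    by (rule deriv_quotient_tendsto[OF g xlnx xlnx_at_top lim])
  then have "((\<lambda>x. deriv g x / (ln x + 1)) \<longlongrightarrow> c) at_top"
    by (rule Lim_transform_eventually) (use deriv_xlnx in eventually_elim, simp)
  then have "((\<lambda>x. deriv (deriv g) x / deriv (\<lambda>x. ln x + 1) x) \<longlongrightarrow> c) at_top"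
    by (intro deriv_quotient_tendsto deriv g add ln one ln_plus_1_at_top)
  then have "((\<lambda>x. deriv (deriv g) x * x) \<longlongrightarrow> c) at_top"
    by (rule Lim_transform_eventually) (use deriv_ln_plus_1 in eventually_elim, simp)
  then show ?thesis by (simp add: numeral_2_eq_2)
qed

lemma second_deriv_abs_at_top:
  assumes g: "g \<in> F" and lim: "filterlim (\<lambda>x. \<bar>g x / (x * ln x)\<bar>) at_top at_top"
  shows "filterlim (\<lambda>x. \<bar>(deriv ^^ 2) g x\<bar> * x) at_top at_top"
proof -
  have "filterlim (\<lambda>x. \<bar>deriv g x / deriv (\<lambda>x. x * ln x) x\<bar>) at_top at_top"
    by (rule deriv_quotient_abs_at_top[OF g xlnx xlnx_at_top lim])
  moreover have "eventually (\<lambda>x. \<bar>deriv g x / deriv (\<lambda>x. x * ln x) x\<bar> = \<bar>deriv g x / (ln x + 1)\<bar>) at_top"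
    using deriv_xlnx by eventually_elim simp
  ultimately have "filterlim (\<lambda>x. \<bar>deriv g x / (ln x + 1)\<bar>) at_top at_top"
    by (rule filterlim_at_top_cong)
  then have "filterlim (\<lambda>x. \<bar>deriv (deriv g) x / deriv (\<lambda>x. ln x + 1) x\<bar>) at_top at_top"
    by (intro deriv_quotient_abs_at_top deriv g add ln one ln_plus_1_at_top)
  moreover have "eventually (\<lambda>x. \<bar>deriv (deriv g) x / deriv (\<lambda>x. ln x + 1) x\<bar> = \<bar>deriv (deriv g) x\<bar> * x) at_top"
    using deriv_ln_plus_1 eventually_gt_at_top[of 0] by eventually_elim (simp add: abs_mult)
  ultimately have "filterlim (\<lambda>x. \<bar>deriv (deriv g) x\<bar> * x) at_top at_top"
    by (rule filterlim_at_top_cong)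
  then show ?thesis by (simp add: numeral_2_eq_2)
qed

text \<open>Otherwise f' would be O(x^(-3/2)), hence integrable, and \<open>f\<close> would be
  bounded. The exponent 3/2 is larger than 1, as integrability requires, and at most d/2 for every d
  >= 3, as the application to derivatives of order d requires.\<close>

lemma deriv_abs_at_top_of_abs_at_top:
  assumes f: "f \<in> F" and lim: "filterlim (\<lambda>x. \<bar>f x\<bar>) at_top at_top"
  shows "filterlim (\<lambda>x. \<bar>deriv f x\<bar> * sqrt x ^ 3) at_top at_top"
proof -
  have "(\<lambda>x. deriv f x * sqrt x ^ 3) \<in> F"
    by (intro mult deriv f power sqrt)
  then show ?thesis
  proof (cases rule: abs_limit_cases)
    case 2
    moreover have "eventually (\<lambda>x. \<bar>deriv f x * sqrt x ^ 3\<bar> = \<bar>deriv f x\<bar> * sqrt x ^ 3) at_top"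
      using eventually_gt_at_top[of 0] by eventually_elim (simp add: abs_mult)
    ultimately show ?thesis by (rule filterlim_at_top_cong)
  next
    case (1 c)
    have *: "\<exists>B. eventually (\<lambda>x. g x \<le> B) at_top"
      if g': "eventually (\<lambda>x. (g has_real_derivative g' x) (at x)) at_top"
        and lim': "((\<lambda>x. g' x * sqrt x ^ 3) \<longlongrightarrow> d) at_top" for g g' d
    proof -
      \<comment> \<open>The derivative of 2 (d+1) / sqrt x is -(d+1) x^(-3/2), which outweighs g'
        eventually; the sum is thus nonincreasing and bounded above, and the added term tends to
        0.\<close>
      have "eventually (\<lambda>x. ((\<lambda>x. g x + 2 * (d + 1) / sqrt x) has_real_derivative
        g' x - (d + 1) / sqrt x ^ 3) (at x)) at_top"
        using g' eventually_gt_at_top[of 0]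
      proof eventually_elim
        case (elim x)
        then have "sqrt x > 0" by simp
        with elim show ?case
          by (auto intro!: derivative_eq_intros simp: field_simps power3_eq_cube)
      qed
      moreover have "eventually (\<lambda>x. g' x * sqrt x ^ 3 < d + 1) at_top"
        by (rule order_tendstoD[OF lim']) simp
      then have "eventually (\<lambda>x. g' x - (d + 1) / sqrt x ^ 3 \<le> 0) at_top"
        using eventually_gt_at_top[of 0] by eventually_elim (simp add: field_simps)
      ultimately obtain B where "eventually (\<lambda>x. g x + 2 * (d + 1) / sqrt x \<le> B) at_top"
      by (rule bounded_above_of_deriv)
      moreover have "((\<lambda>x. 2 * (d + 1) / sqrt x) \<longlongrightarrow> 0) at_top"
        by (intro tendsto_divide_0[OF tendsto_const] filterlim_at_top_imp_at_infinity sqrt_at_top)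
      then have "eventually (\<lambda>x. 2 * (d + 1) / sqrt x > -1) at_top"
        by (rule order_tendstoD) simp
      ultimately have "eventually (\<lambda>x. g x \<le> B + 1) at_top"
        by eventually_elim simp
      then show ?thesis ..
    qed
    obtain B1 where B1: "eventually (\<lambda>x. f x \<le> B1) at_top"
      using *[OF has_deriv[OF f] 1] by blast
    have "eventually (\<lambda>x. ((\<lambda>x. - f x) has_real_derivative - deriv f x) (at x)) at_top"
      using has_deriv[OF f] by eventually_elim (rule DERIV_minus)
    moreover have "((\<lambda>x. - deriv f x * sqrt x ^ 3) \<longlongrightarrow> - c) at_top"
      using tendsto_minus[OF 1] by simp
    ultimately have "\<exists>B. eventually (\<lambda>x. - f x \<le> B) at_top"
      by (rule *)
    then obtain B2 where B2: "eventually (\<lambda>x. - f x \<le> B2) at_top" ..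
    have "eventually (\<lambda>x. \<bar>f x\<bar> \<le> max B1 B2) at_top"
      using B1 B2 by eventually_elim auto
    then show ?thesis using not_bounded_above_at_top[OF lim] by blast
  qed
qed

text \<open>The quotient x w' / w lies in \<open>F\<close>. If it tended to plus infinity, w^2 would
  eventually be nondecreasing, impossible for a nonvanishing function with limit 0. If it tended to
  minus infinity, \<open>w\<close> would decay faster than every power, against the assumed lower
  bound. So its limit is finite.\<close>

lemma log_deriv_bounded:
  assumes w: "w \<in> F" and lim0: "(w \<longlongrightarrow> 0) at_top"
    and lim: "filterlim (\<lambda>x. \<bar>w x\<bar> * sqrt x ^ d) at_top at_top"
  obtains C where "C > 0" "eventually (\<lambda>x. \<bar>x * deriv w x\<bar> \<le> C * \<bar>w x\<bar>) at_top"
    "eventually (\<lambda>x. w x \<noteq> 0) at_top"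
proof -
  have "eventually (\<lambda>x. \<bar>w x\<bar> * sqrt x ^ d > 0) at_top"
    using lim by (simp add: filterlim_at_top_dense)
  then have nz: "eventually (\<lambda>x. w x \<noteq> 0) at_top"
    by eventually_elim auto
  have w2: "eventually (\<lambda>x. ((\<lambda>x. (w x)\<^sup>2) has_real_derivative 2 * (w x * deriv w x)) (at x)) at_top"
    using has_deriv[OF w] by eventually_elim (auto intro!: derivative_eq_intros)
  have "(\<lambda>x. x * deriv w x / w x) \<in> F"
    by (intro mult divide deriv w ident)
  then show ?thesis
  proof (cases rule: limit_cases)
    case (1 c)
    have "eventually (\<lambda>x. \<bar>x * deriv w x / w x\<bar> < \<bar>c\<bar> + 1) at_top"
      by (rule order_tendstoD[OF tendsto_rabs[OF 1]]) simp
    then have "eventually (\<lambda>x. \<bar>x * deriv w x\<bar> \<le> (\<bar>c\<bar> + 1) * \<bar>w x\<bar>) at_top"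
      using nz by eventually_elim (simp add: field_simps)
    then show ?thesis using that[of "\<bar>c\<bar> + 1"] nz by simp
  next
    case 2
    have "eventually (\<lambda>x. 2 * (w x * deriv w x) \<ge> 0) at_top"
      using 2[unfolded filterlim_at_top, rule_format, of 0] nz eventually_gt_at_top[of 0]
    proof eventually_elim
      case (elim x)
      then have "0 \<le> (x * deriv w x / w x) * (w x)\<^sup>2" by (intro mult_nonneg_nonneg) auto
      also have "\<dots> = x * (w x * deriv w x)" using elim by (simp add: power2_eq_square)
      finally show ?case using elim by (simp add: zero_le_mult_iff)
    qed
    with w2 obtain X where X: "\<And>x y. X \<le> x \<Longrightarrow> x \<le> y \<Longrightarrow> (w x)\<^sup>2 \<le> (w y)\<^sup>2"
      by (rule nondecreasing_of_deriv) blast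
    have "eventually (\<lambda>x. w x \<noteq> 0 \<and> X \<le> x) at_top"
      using nz eventually_ge_at_top[of X] by eventually_elim simp
    then obtain x0 where x0: "w x0 \<noteq> 0" "X \<le> x0"
      unfolding eventually_at_top_linorder by blast
    have "((\<lambda>x. (w x)\<^sup>2) \<longlongrightarrow> 0\<^sup>2) at_top"
      by (intro tendsto_power lim0)
    then have "eventually (\<lambda>x. (w x)\<^sup>2 < (w x0)\<^sup>2) at_top"
      by (rule order_tendstoD(2)) (use x0 in simp)
    then have "eventually (\<lambda>x::real. False) at_top"
      using eventually_ge_at_top[of x0]
    proof eventually_elim
      case (elim x)
      then show ?case using X[OF x0(2), of x] by simp
    qed
    then show ?thesis by simp
  next
    case 3
    \<comment> \<open>For x > 0 this derivative is 2 w^2 x^(2d-1) (x w'/w + d), which is nonpositive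
      as soon as x w'/w <= -d. Hence w^2 x^(2d) is bounded, while w^2 x^d is not.\<close>
    have "eventually (\<lambda>x. ((\<lambda>x. (w x)\<^sup>2 * x ^ (2 * d)) has_real_derivative
        2 * (w x * deriv w x) * x ^ (2 * d) + (w x)\<^sup>2 * (real (2 * d) * x ^ (2 * d - 1))) (at x)) at_top"
      using w2
    proof eventually_elim
      case (elim x)
      from DERIV_mult[OF elim DERIV_pow[of "2 * d" x]] show ?case by (simp add: ac_simps)
    qed
    moreover have "eventually (\<lambda>x. 2 * (w x * deriv w x) * x ^ (2 * d) +
        (w x)\<^sup>2 * (real (2 * d) * x ^ (2 * d - 1)) \<le> 0) at_top"
      using 3[unfolded filterlim_at_bot, rule_format, of "- real d"] nz eventually_gt_at_top[of 0]
    proof eventually_elim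
      case (elim x)
      then have "x * deriv w x / w x * (2 * (w x)\<^sup>2) \<le> - real d * (2 * (w x)\<^sup>2)"
        by (intro mult_right_mono) auto
      then have le: "2 * (w x * deriv w x) * x + 2 * real d * (w x)\<^sup>2 \<le> 0"
        using elim by (simp add: power2_eq_square algebra_simps)
      show ?case
      proof (cases d)
        case 0
        then show ?thesis using le elim by (simp add: mult_le_0_iff)
      next
        case (Suc e)
        have "x ^ (2 * d) = x * x ^ (2 * d - 1)" using Suc by (simp flip: power_Suc)
        then have "2 * (w x * deriv w x) * x ^ (2 * d) + (w x)\<^sup>2 * (real (2 * d) * x ^ (2 * d - 1)) =
          (2 * (w x * deriv w x) * x + 2 * real d * (w x)\<^sup>2) * x ^ (2 * d - 1)"
          by (simp add: algebra_simps)
        also have "\<dots> \<le> 0"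
          using le elim by (intro mult_nonpos_nonneg) auto
        finally show ?thesis .
      qed
    qed
    ultimately obtain B where B: "eventually (\<lambda>x. (w x)\<^sup>2 * x ^ (2 * d) \<le> B) at_top"
      by (rule bounded_above_of_deriv)
    have "eventually (\<lambda>x. \<bar>w x\<bar> * sqrt x ^ d \<ge> \<bar>B\<bar> + 1) at_top"
      using lim by (simp add: filterlim_at_top)
    with B have "eventually (\<lambda>x::real. False) at_top"
      using eventually_ge_at_top[of 1]
    proof eventually_elim
      case (elim x)
      have "\<bar>B\<bar> + 1 \<le> (\<bar>B\<bar> + 1)\<^sup>2" by (simp add: power2_eq_square algebra_simps)
      also have "\<dots> \<le> (\<bar>w x\<bar> * sqrt x ^ d)\<^sup>2" using elim by (intro power_mono) auto
      also have "\<dots> = (w x)\<^sup>2 * x ^ d"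
      proof -
        have "(sqrt x ^ d)\<^sup>2 = (sqrt x ^ 2) ^ d"
          by (simp only: power_mult[symmetric] mult.commute)
        then show ?thesis using elim by (simp add: power_mult_distrib)
      qed
      also have "\<dots> \<le> (w x)\<^sup>2 * x ^ (2 * d)"
        using elim by (intro mult_left_mono power_increasing) auto
      finally show ?case using elim by simp
    qed
    then show ?thesis by simp
  qed
qed

end

text \<open>The bound on x w' says that the derivative of ln w is at most C/x in absolute value.
  Over a distance \<delta>x, at points no smaller than x/2, ln w therefore moves by at most 2 C
  \<delta>.\<close>

lemma slowly_varying_aux:
  fixes w w' :: "real \<Rightarrow> real"
  assumes w': "eventually (\<lambda>x. (w has_real_derivative w' x) (at x)) at_top"
    and pos: "eventually (\<lambda>x. w x > 0) at_top"
    and C: "C > 0" "eventually (\<lambda>x. \<bar>x * w' x\<bar> \<le> C * \<bar>w x\<bar>) at_top"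
    and "\<eta> > 0"
  shows "\<exists>\<delta>>0. eventually (\<lambda>x. \<forall>y. \<bar>y - x\<bar> \<le> \<delta> * x \<longrightarrow> \<bar>w y - w x\<bar> \<le> \<eta> * \<bar>w x\<bar>) at_top"
proof -
  \<comment> \<open>The bound 1/2 keeps \<open>y\<close> above x/2; the other bound makes 2 C
    \<delta> at most ln (1 + \<eta>), so that \<open>w\<close> changes by a factor of at most 1 +
    \<eta> in either direction.\<close>
  define \<delta> where "\<delta> = min (1 / 2) (ln (1 + \<eta>) / (2 * C))"
  have "ln (1 + \<eta>) > 0" using \<open>\<eta> > 0\<close> by simp
  then have \<delta>: "\<delta> > 0" "\<delta> \<le> 1 / 2" "2 * C * \<delta> \<le> ln (1 + \<eta>)"
    using C by (auto simp: \<delta>_def min_def field_simps)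
  have "eventually (\<lambda>x. (w has_real_derivative w' x) (at x) \<and> w x > 0 \<and> \<bar>x * w' x\<bar> \<le> C * \<bar>w x\<bar> \<and> x > 0) at_top"
    using w' pos C(2) eventually_gt_at_top[of 0] by eventually_elim simp
  then obtain X where X: "\<And>x. x \<ge> X \<Longrightarrow> (w has_real_derivative w' x) (at x) \<and> w x > 0 \<and>
      \<bar>x * w' x\<bar> \<le> C * \<bar>w x\<bar> \<and> x > 0"
    unfolding eventually_at_top_linorder by blast
  have ln_w: "((\<lambda>x. ln (w x)) has_real_derivative w' x / w x) (at x)" if "x \<ge> X" for x
    using X[OF that] by (auto intro!: derivative_eq_intros)
  have *: "\<bar>ln (w v) - ln (w u)\<bar> \<le> 2 * C * \<delta>"
    if "u \<ge> X" "u \<le> v" "2 * u \<ge> x" "v - u \<le> \<delta> * x" "x > 0" for u v x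
  proof (cases "u = v")
    case False
    then have "\<exists>z>u. z < v \<and> ln (w v) - ln (w u) = (v - u) * (w' z / w z)"
      using that by (intro MVT2[of u v "\<lambda>x. ln (w x)"] ln_w) auto
    then obtain z where z: "z > u" "ln (w v) - ln (w u) = (v - u) * (w' z / w z)" by blast
    have "z \<ge> X" using z that by simp
    have "\<bar>w' z / w z\<bar> \<le> C / z"
      using X[OF \<open>z \<ge> X\<close>] by (auto simp: field_simps abs_mult)
    also have "\<dots> \<le> C / (x / 2)"
      using z that C by (intro divide_left_mono mult_pos_pos) auto
    finally have "\<bar>ln (w v) - ln (w u)\<bar> \<le> \<delta> * x * (C / (x / 2))"
      unfolding z(2) abs_mult using that by (intro mult_mono) auto
    then show ?thesis using that by (simp add: ac_simps)
  qed (use C \<delta> in auto)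
  have "eventually (\<lambda>x. \<forall>y. \<bar>y - x\<bar> \<le> \<delta> * x \<longrightarrow> \<bar>w y - w x\<bar> \<le> \<eta> * \<bar>w x\<bar>) at_top"
    using eventually_ge_at_top[of "2 * \<bar>X\<bar> + 1"]
  proof (eventually_elim, intro allI impI)
    fix x y assume x: "2 * \<bar>X\<bar> + 1 \<le> x" and y: "\<bar>y - x\<bar> \<le> \<delta> * x"
    have "\<delta> * x \<le> 1 / 2 * x" using \<delta> x by (intro mult_right_mono) auto
    then have "y \<ge> x / 2" using y by simp
    have "\<bar>ln (w y) - ln (w x)\<bar> \<le> 2 * C * \<delta>"
    proof (cases "x \<le> y")
      case True
      show ?thesis by (rule *[of x y x]) (use x y True in auto)
    next
      case False
      have "\<bar>ln (w x) - ln (w y)\<bar> \<le> 2 * C * \<delta>"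
        by (rule *[of y x x]) (use x y False \<open>y \<ge> x / 2\<close> in auto)
      then show ?thesis by simp
    qed
    then have u: "\<bar>ln (w y) - ln (w x)\<bar> \<le> ln (1 + \<eta>)" using \<delta> by simp
    have wx: "w x > 0" "w y > 0" using X[of x] X[of y] x \<open>y \<ge> x / 2\<close> by auto
    then have "ln (w y) \<le> ln ((1 + \<eta>) * w x)" "ln (w x) \<le> ln ((1 + \<eta>) * w y)"
      using u \<open>\<eta> > 0\<close> by (auto simp: ln_mult)
    then have *: "w y \<le> (1 + \<eta>) * w x" "w x \<le> (1 + \<eta>) * w y"
      using wx \<open>\<eta> > 0\<close> by (simp_all add: ln_le_cancel_iff)
    have "w x - w y \<le> \<eta> * w x"
    proof (cases "w y \<le> w x")
      case True
      then have "\<eta> * w y \<le> \<eta> * w x" using \<open>\<eta> > 0\<close> by simp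
      then show ?thesis using * by (simp add: algebra_simps)
    next
      case False
      then show ?thesis using wx \<open>\<eta> > 0\<close> by (smt (verit) mult_pos_pos)
    qed
    then show "\<bar>w y - w x\<bar> \<le> \<eta> * \<bar>w x\<bar>"
      using * wx by (simp add: algebra_simps abs_le_iff)
  qed
  with \<delta>(1) show ?thesis by blast
qed

context hardy_functions_ln
begin

lemma slowly_varying:
  assumes w: "w \<in> F" and lim0: "(w \<longlongrightarrow> 0) at_top"
    and lim: "filterlim (\<lambda>x. \<bar>w x\<bar> * sqrt x ^ d) at_top at_top" and "\<eta> > 0"
  shows "\<exists>\<delta>>0. eventually (\<lambda>x. \<forall>y. \<bar>y - x\<bar> \<le> \<delta> * x \<longrightarrow> \<bar>w y - w x\<bar> \<le> \<eta> * \<bar>w x\<bar>) at_top"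
proof -
  obtain C where C: "C > 0" "eventually (\<lambda>x. \<bar>x * deriv w x\<bar> \<le> C * \<bar>w x\<bar>) at_top"
    and nz: "eventually (\<lambda>x. w x \<noteq> 0) at_top"
    using log_deriv_bounded[OF w lim0 lim] .
  from w show ?thesis
  proof (cases rule: sign_cases)
    case 1
    with nz have "eventually (\<lambda>x::real. False) at_top" by eventually_elim simp
    then show ?thesis by simp
  next
    case 2
    then show ?thesis using slowly_varying_aux[OF has_deriv[OF w] _ C \<open>\<eta> > 0\<close>] by blast
  next
    case 3
    have "\<exists>\<delta>>0. eventually (\<lambda>x. \<forall>y. \<bar>y - x\<bar> \<le> \<delta> * x \<longrightarrow> \<bar>- w y - - w x\<bar> \<le> \<eta> * \<bar>- w x\<bar>) at_top"
    proof (rule slowly_varying_aux[OF _ _ C(1) _ \<open>\<eta> > 0\<close>])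
      show "eventually (\<lambda>x. ((\<lambda>x. - w x) has_real_derivative - deriv w x) (at x)) at_top"
        using has_deriv[OF w] by eventually_elim (rule DERIV_minus)
      show "eventually (\<lambda>x. - w x > 0) at_top" using 3 by eventually_elim simp
      show "eventually (\<lambda>x. \<bar>x * - deriv w x\<bar> \<le> C * \<bar>- w x\<bar>) at_top"
        using C(2) by eventually_elim simp
    qed
    moreover have "\<bar>- w y - - w x\<bar> = \<bar>w y - w x\<bar>" for x y by (simp add: abs_minus_commute)
    ultimately show ?thesis by simp
  qed
qed

end

section \<open>Weyl sums\<close>

definition ecis :: "real \<Rightarrow> complex" where
  "ecis x = cis (2 * pi * x)"

lemma norm_ecis [simp]: "norm (ecis x) = 1"
  by (simp add: ecis_def)

lemma ecis_add: "ecis (x + y) = ecis x * ecis y"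
  by (simp add: ecis_def cis_mult algebra_simps)

lemma cnj_ecis: "cnj (ecis x) = ecis (- x)"
  by (simp add: ecis_def cis_cnj)

lemma ecis_diff: "ecis (x - y) = ecis x * cnj (ecis y)"
  using ecis_add[of x "- y"] by (simp add: cnj_ecis)

lemma ecis_of_nat_mult: "ecis (of_nat n * x) = ecis x ^ n"
  by (induction n) (auto simp: ecis_add distrib_right, simp add: ecis_def)

lemma ecis_eq_1_iff: "ecis x = 1 \<longleftrightarrow> x \<in> \<int>"
proof -
  have "ecis x = 1 \<longleftrightarrow> cos (2 * pi * x) = 1"
    unfolding ecis_def by (auto simp: complex_eq_iff cos_one_sin_zero)
  also have "\<dots> \<longleftrightarrow> (\<exists>n::int. 2 * pi * x = of_int n * (2 * pi))"
    by (simp add: cos_one_2pi_int)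
  also have "\<dots> \<longleftrightarrow> x \<in> \<int>"
    by (auto simp: Ints_def)
  finally show ?thesis .
qed

lemma ecis_add_Ints: "y \<in> \<int> \<Longrightarrow> ecis (x + y) = ecis x"
  using ecis_eq_1_iff[of y] by (simp add: ecis_add)

lemma norm_cis_diff_le: "norm (cis x - cis y) \<le> \<bar>x - y\<bar>"
proof -
  have "norm (cis x - cis y) = norm (cis y * (cis (x - y) - 1))"
    by (simp add: right_diff_distrib cis_mult)
  also have "\<dots> = norm (exp (\<i> * of_real (x - y)) - 1)"
    by (simp add: norm_mult cis_conv_exp)
  also have "\<dots> = 2 * \<bar>sin ((x - y) / 2)\<bar>"
    by (rule dist_exp_i_1)
  also have "\<dots> \<le> \<bar>x - y\<bar>"
    using abs_sin_x_le_abs_x[of "(x - y) / 2"] by simp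
  finally show ?thesis .
qed

lemma norm_ecis_diff_le: "norm (ecis x - ecis y) \<le> 2 * pi * \<bar>x - y\<bar>"
  using norm_cis_diff_le[of "2 * pi * x" "2 * pi * y"]
  by (simp add: ecis_def abs_mult flip: right_diff_distrib)

text \<open>The imaginary part sin (2 pi x) is enough. Since sin t - t/2 increases while cos t >=
  1/2, that is, up to pi/3, the bound holds for 2 pi abs x <= pi/3; this is the origin of
  1/6.\<close>

lemma norm_ecis_minus_1_ge:
  assumes "\<bar>x\<bar> \<le> 1 / 6"
  shows "norm (ecis x - 1) \<ge> pi * \<bar>x\<bar>"
proof -
  have sin_ge: "sin t \<ge> t / 2" if "0 \<le> t" "t \<le> pi / 3" for t :: real
  proof -
    have "\<exists>y. ((\<lambda>t. sin t - t / 2) has_real_derivative y) (at u) \<and> 0 \<le> y" if "0 \<le> u" "u \<le> t" for u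
    proof (intro exI conjI)
      show "((\<lambda>t. sin t - t / 2) has_real_derivative cos u - 1 / 2) (at u)"
        by (auto intro!: derivative_eq_intros)
      show "0 \<le> cos u - 1 / 2"
        using cos_monotone_0_pi_le[of u "pi / 3"] that \<open>t \<le> pi / 3\<close> cos_60 by auto
    qed
    with that(1) have "sin 0 - 0 / 2 \<le> sin t - t / 2"
      using DERIV_nonneg_imp_nondecreasing[of 0 t "\<lambda>t. sin t - t / 2"] by blast
    then show ?thesis by simp
  qed
  have "pi * \<bar>x\<bar> \<le> sin (2 * pi * \<bar>x\<bar>)"
    using sin_ge[of "2 * pi * \<bar>x\<bar>"] assms by simp
  also have "\<dots> \<le> \<bar>Im (ecis x - 1)\<bar>"
    by (cases "x \<ge> 0") (auto simp: ecis_def)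
  also have "\<dots> \<le> norm (ecis x - 1)"
    by (rule abs_Im_le_cmod)
  finally show ?thesis .
qed

lemma norm_sum_le_card:
  assumes "\<And>j. j \<in> A \<Longrightarrow> norm (a j) \<le> (1::real)"
  shows "norm (sum a A) \<le> real (card A)"
  using sum_norm_le[of A a "\<lambda>_. 1"] assms by simp

section \<open>Van der Corput differencing and polynomial sequences\<close>

lemma norm_sum_shift_le:
  fixes a :: "nat \<Rightarrow> 'a :: real_normed_vector"
  assumes "\<And>j. norm (a j) \<le> 1"
  shows "norm ((\<Sum>j<L. a (j + h)) - (\<Sum>j<L. a j)) \<le> 2 * real h"
proof (induction h)
  case (Suc h)
  have "(\<Sum>j<L. a (Suc j + h)) - (\<Sum>j<L. a (j + h)) = a (L + h) - a h"
    using sum_lessThan_telescope[of "\<lambda>j. a (j + h)" L] by (simp add: sum_subtractf)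
  then have "(\<Sum>j<L. a (j + Suc h)) - (\<Sum>j<L. a j) =
    ((\<Sum>j<L. a (j + h)) - (\<Sum>j<L. a j)) + (a (L + h) - a h)"
    by (simp add: algebra_simps)
  also have "norm \<dots> \<le> 2 * real h + (1 + 1)"
    by (intro norm_triangle_mono Suc.IH norm_triangle_le_diff add_mono assms)
  finally show ?case by simp
qed auto

text \<open>The sum is replaced by its average over the shifts h < H, at a total cost of H;
  Cauchy-Schwarz in \<open>j\<close> and expansion of the square leave the correlations. As
  \<open>a\<close> is defined on all naturals, every correlation runs over the full range j < L and
  no truncation at the ends appears.\<close>

lemma van_der_Corput:
  fixes a :: "nat \<Rightarrow> complex"
  assumes a: "\<And>j. norm (a j) \<le> 1" and "H \<ge> 1"
  shows "norm (\<Sum>j<L. a j) \<le> real H +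
    sqrt (real L * (\<Sum>h<H. \<Sum>k<H. norm (\<Sum>j<L. a (j + h) * cnj (a (j + k))))) / real H"
proof -
  define S where "S = (\<Sum>j<L. a j)"
  define T where "T = (\<Sum>j<L. \<Sum>h<H. a (j + h))"
  define V where "V = (\<Sum>h<H. \<Sum>k<H. norm (\<Sum>j<L. a (j + h) * cnj (a (j + k))))"
  have T_swap: "T = (\<Sum>h<H. \<Sum>j<L. a (j + h))"
    unfolding T_def by (rule sum.swap)
  have "norm (T - of_nat H * S) = norm (\<Sum>h<H. (\<Sum>j<L. a (j + h)) - S)"
    by (simp add: T_swap sum_subtractf)
  also have "\<dots> \<le> (\<Sum>h<H. 2 * real h)"
    unfolding S_def by (intro sum_norm_le norm_sum_shift_le a)
  also have "\<dots> \<le> real H * real H"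
    by (induction H) (auto simp: algebra_simps)
  finally have 1: "norm (T - of_nat H * S) \<le> real H * real H" .
  have "norm T \<le> (\<Sum>j<L. 1 * norm (\<Sum>h<H. a (j + h)))"
    unfolding T_def by (simp add: norm_sum)
  then have "(norm T)\<^sup>2 \<le> (\<Sum>j<L. 1 * norm (\<Sum>h<H. a (j + h)))\<^sup>2"
    by (intro power_mono) auto
  also have "\<dots> \<le> (\<Sum>j<L. 1\<^sup>2) * (\<Sum>j<L. (norm (\<Sum>h<H. a (j + h)))\<^sup>2)"
    by (rule Cauchy_Schwarz_ineq_sum)
  also have "\<dots> = real L * (\<Sum>j<L. (norm (\<Sum>h<H. a (j + h)))\<^sup>2)"
    by simp
  also have "(\<Sum>j<L. (norm (\<Sum>h<H. a (j + h)))\<^sup>2) =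
      norm (\<Sum>j<L. complex_of_real ((norm (\<Sum>h<H. a (j + h)))\<^sup>2))"
    unfolding of_real_sum[symmetric] norm_of_real by (simp add: sum_nonneg)
  also have "(\<Sum>j<L. complex_of_real ((norm (\<Sum>h<H. a (j + h)))\<^sup>2)) =
      (\<Sum>j<L. \<Sum>h<H. \<Sum>k<H. a (j + h) * cnj (a (j + k)))"
    by (intro sum.cong refl) (simp add: complex_norm_square sum_product del: of_real_power)
  also have "\<dots> = (\<Sum>h<H. \<Sum>j<L. \<Sum>k<H. a (j + h) * cnj (a (j + k)))"
    by (rule sum.swap)
  also have "\<dots> = (\<Sum>h<H. \<Sum>k<H. \<Sum>j<L. a (j + h) * cnj (a (j + k)))"
    by (intro sum.cong refl sum.swap)
  also have "norm \<dots> \<le> V"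
    unfolding V_def by (intro sum_norm_le norm_sum)
  finally have "(norm T)\<^sup>2 \<le> real L * V"
    by (simp add: mult_left_mono)
  then have 2: "norm T \<le> sqrt (real L * V)"
    by (rule real_le_rsqrt)
  have "real H * norm S = norm (T - (T - of_nat H * S))"
    by (simp add: norm_mult)
  also have "\<dots> \<le> norm T + norm (T - of_nat H * S)"
    by (rule norm_triangle_ineq4)
  finally have "real H * norm S \<le> sqrt (real L * V) + real H * real H"
    using 1 2 by simp
  then show ?thesis
    using \<open>H \<ge> 1\<close> by (simp add: S_def V_def field_simps)
qed

text \<open>\<open>poly_seq d c f\<close> says that \<open>f\<close> is a polynomial sequence of degree at most \<open>d\<close>
  with coefficient \<open>c / d!\<close> at \<open>j\<^sup>d\<close>.\<close>

primrec poly_seq :: "nat \<Rightarrow> real \<Rightarrow> (nat \<Rightarrow> real) \<Rightarrow> bool" where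
  "poly_seq 0 c f \<longleftrightarrow> (\<forall>j. f j = c)"
| "poly_seq (Suc d) c f \<longleftrightarrow> (\<forall>r. poly_seq d (c * real r) (\<lambda>j. f (j + r) - f j))"

lemma poly_seq_shift: "poly_seq d c f \<Longrightarrow> poly_seq d c (\<lambda>j. f (j + h))"
proof (induction d arbitrary: c f)
  case (Suc d)
  show ?case
    unfolding poly_seq.simps
  proof
    fix r
    have "poly_seq d (c * real r) (\<lambda>j. f (j + h + r) - f (j + h))"
      using Suc.IH[of "c * real r" "\<lambda>j. f (j + r) - f j"] Suc.prems by simp
    then show "poly_seq d (c * real r) (\<lambda>j. f (j + r + h) - f (j + h))"
      by (simp add: ac_simps)
  qed
qed auto

lemma poly_seq_scale: "poly_seq d c f \<Longrightarrow> poly_seq d (a * c) (\<lambda>j. a * f j)"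
proof (induction d arbitrary: c f)
  case (Suc d)
  show ?case
    unfolding poly_seq.simps
  proof
    fix r
    have "poly_seq d (a * (c * real r)) (\<lambda>j. a * (f (j + r) - f j))"
      by (rule Suc.IH) (use Suc.prems in simp)
    then show "poly_seq d (a * c * real r) (\<lambda>j. a * f (j + r) - a * f j)"
      by (simp add: algebra_simps)
  qed
qed auto

lemma poly_seq_add: "poly_seq d c f \<Longrightarrow> poly_seq d c' g \<Longrightarrow> poly_seq d (c + c') (\<lambda>j. f j + g j)"
proof (induction d arbitrary: c f c' g)
  case (Suc d)
  show ?case
    unfolding poly_seq.simps
  proof
    fix r
    have "poly_seq d (c * real r + c' * real r) (\<lambda>j. (f (j + r) - f j) + (g (j + r) - g j))"
      by (rule Suc.IH) (use Suc.prems in simp_all)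
    then show "poly_seq d ((c + c') * real r) (\<lambda>j. f (j + r) + g (j + r) - (f j + g j))"
      by (simp add: algebra_simps)
  qed
qed auto

lemma poly_seq_zero: "poly_seq d 0 (\<lambda>_. 0)"
  by (induction d) auto

lemma poly_seq_sum:
  assumes "\<And>i. i \<in> A \<Longrightarrow> poly_seq d (c i) (f i)"
  shows "poly_seq d (sum c A) (\<lambda>j. \<Sum>i\<in>A. f i j)"
  using assms by (induction A rule: infinite_finite_induct) (auto intro: poly_seq_zero poly_seq_add)

lemma poly_seq_Suc: "poly_seq d c f \<Longrightarrow> poly_seq (Suc d) 0 f"
proof (induction d arbitrary: c f)
  case (Suc d)
  show ?case
    unfolding poly_seq.simps(2)[of "Suc d"]
  proof
    fix r
    show "poly_seq (Suc d) (0 * real r) (\<lambda>j. f (j + r) - f j)"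
      using Suc.IH[of "c * real r" "\<lambda>j. f (j + r) - f j"] Suc.prems by simp
  qed
qed auto

lemma poly_seq_less:
  assumes "i < d" "poly_seq i c f"
  shows "poly_seq d 0 f"
  using assms(1)
proof (induction d)
  case (Suc d)
  show ?case
  proof (cases "i = d")
    case True
    then show ?thesis using assms(2) poly_seq_Suc by blast
  next
    case False
    then have "poly_seq d 0 f" using Suc by simp
    then show ?thesis by (rule poly_seq_Suc)
  qed
qed simp

text \<open>By the binomial theorem, (j+r)^(e+1) - j^(e+1) has leading term (e+1) r j^e, which by
  induction has parameter (e+1)! r at degree \<open>e\<close>. The lower powers have parameter 0 at
  that degree, hence the \<open>if\<close> in the auxiliary statement.\<close>

lemma poly_seq_power: "poly_seq d (fact d) (\<lambda>j. real j ^ d)"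
proof (induction d rule: less_induct)
  case (less d)
  show ?case
  proof (cases d)
    case (Suc e)
    show ?thesis
      unfolding Suc poly_seq.simps
    proof
      fix r
      have *: "poly_seq e (if i = e then fact (Suc e) * real r else 0)
        (\<lambda>j. real (Suc e choose i) * real r ^ (Suc e - i) * real j ^ i)" if "i \<in> {..e}" for i
      proof (cases "i = e")
        case True
        have "poly_seq e (real (Suc e choose e) * real r * fact e)
          (\<lambda>j. real (Suc e choose e) * real r * real j ^ e)"
          by (rule poly_seq_scale) (use less Suc in simp)
        then show ?thesis using True by (simp add: algebra_simps)
      next
        case False
        with that have "i < e" by simp
        have "poly_seq i (real (Suc e choose i) * real r ^ (Suc e - i) * fact i)
          (\<lambda>j. real (Suc e choose i) * real r ^ (Suc e - i) * real j ^ i)"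
          by (rule poly_seq_scale) (use less Suc \<open>i < e\<close> in simp)
        then show ?thesis using False poly_seq_less[OF \<open>i < e\<close>] by simp
      qed
      have "poly_seq e (\<Sum>i\<le>e. if i = e then fact (Suc e) * real r else 0)
        (\<lambda>j. \<Sum>i\<le>e. real (Suc e choose i) * real r ^ (Suc e - i) * real j ^ i)"
        by (rule poly_seq_sum) (rule *)
      moreover have "(\<Sum>i\<le>e. real (Suc e choose i) * real r ^ (Suc e - i) * real j ^ i) =
          real (j + r) ^ Suc e - real j ^ Suc e" for j
      proof -
        have "real (j + r) ^ Suc e = (real j + real r) ^ Suc e"
          by simp
        also have "\<dots> = (\<Sum>i\<le>Suc e. real (Suc e choose i) * real j ^ i * real r ^ (Suc e - i))"
          by (rule binomial_ring)
        also have "\<dots> = (\<Sum>i\<le>e. real (Suc e choose i) * real r ^ (Suc e - i) * real j ^ i) + real j ^ Suc e"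
          by (simp add: ac_simps)
        finally show ?thesis by simp
      qed
      ultimately show "poly_seq e (fact (Suc e) * real r) (\<lambda>j. real (j + r) ^ Suc e - real j ^ Suc e)"
        by simp
    qed
  qed simp
qed

lemma poly_seq_polynomial:
  "poly_seq d (fact d * c d) (\<lambda>j. (\<Sum>i<d. c i * real j ^ i) + c d * real j ^ d)"
proof -
  have "poly_seq d 0 (\<lambda>j. c i * real j ^ i)" if "i \<in> {..<d}" for i
    using that poly_seq_scale[OF poly_seq_power] by (intro poly_seq_less[of i d]) auto
  then have "poly_seq d (\<Sum>i<d. 0) (\<lambda>j. \<Sum>i<d. c i * real j ^ i)"
    by (rule poly_seq_sum)
  from poly_seq_add[OF this poly_seq_scale[OF poly_seq_power, of d "c d"]] show ?thesis
    by (simp add: mult.commute)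
qed

lemma poly_seq_diff:
  assumes "poly_seq (Suc d) c f"
  shows "poly_seq d (c * (real h - real k)) (\<lambda>j. f (j + h) - f (j + k))"
proof -
  have *: "poly_seq d (c * (real h - real k)) (\<lambda>j. f (j + h) - f (j + k))" if "h \<ge> k" for h k
  proof -
    have "poly_seq d (c * real (h - k)) (\<lambda>j. f (j + (h - k)) - f j)"
      using assms by simp
    from poly_seq_shift[OF this, of k] show ?thesis
      using that by (simp add: of_nat_diff add.assoc)
  qed
  show ?thesis
  proof (cases "h \<ge> k")
    case False
    then have "poly_seq d (-1 * (c * (real k - real h))) (\<lambda>j. -1 * (f (j + k) - f (j + h)))"
      by (intro poly_seq_scale *) simp
    then show ?thesis by (simp add: algebra_simps)
  qed (rule *)
qed

section \<open>Weyl's bounds by induction on the degree\<close>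

lemma poly_seq_1_sum_le:
  assumes "poly_seq (Suc 0) c f" "ecis c \<noteq> 1"
  shows "norm (\<Sum>j<L. ecis (f j)) \<le> 2 / norm (ecis c - 1)"
proof -
  have f: "f j = f 0 + real j * c" for j
  proof -
    have "f (0 + j) - f 0 = c * real j" using assms(1) unfolding poly_seq.simps by blast
    then show ?thesis by (simp add: mult.commute)
  qed
  have "(\<Sum>j<L. ecis (f j)) = ecis (f 0) * (\<Sum>j<L. ecis c ^ j)"
    unfolding sum_distrib_left
    by (intro sum.cong refl) (metis f ecis_add ecis_of_nat_mult)
  also have "(\<Sum>j<L. ecis c ^ j) = (ecis c ^ L - 1) / (ecis c - 1)"
    using geometric_sum[OF assms(2)] .
  also have "norm (ecis (f 0) * \<dots>) = norm (ecis c ^ L - 1) / norm (ecis c - 1)"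
    by (simp add: norm_mult norm_divide)
  also have "norm (ecis c ^ L - 1) \<le> 2"
    by (rule order.trans[OF norm_triangle_ineq4]) (simp add: norm_power)
  finally show ?thesis by (simp add: divide_right_mono)
qed

lemma van_der_Corput_poly_seq:
  assumes "poly_seq (Suc d) c f" "H \<ge> 1"
    and B: "\<And>h k g. h < H \<Longrightarrow> k < H \<Longrightarrow> poly_seq d (c * (real h - real k)) g \<Longrightarrow>
      norm (\<Sum>j<L. ecis (g j)) \<le> B h k"
  shows "norm (\<Sum>j<L. ecis (f j)) \<le> real H + sqrt (real L * (\<Sum>h<H. \<Sum>k<H. B h k)) / real H"
proof -
  have "norm (\<Sum>j<L. ecis (f j)) \<le> real H + sqrt (real L *
      (\<Sum>h<H. \<Sum>k<H. norm (\<Sum>j<L. ecis (f (j + h)) * cnj (ecis (f (j + k)))))) / real H"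
    by (rule van_der_Corput) (use assms in auto)
  also have "\<dots> \<le> real H + sqrt (real L * (\<Sum>h<H. \<Sum>k<H. B h k)) / real H"
    by (intro add_left_mono divide_right_mono real_sqrt_le_mono mult_left_mono sum_mono)
       (auto simp flip: ecis_diff intro!: B poly_seq_diff assms)
  finally show ?thesis .
qed

text \<open>Uniformity in \<open>f\<close> is the point: one length \<open>L\<close> must serve for
  all starting points at once. The geometric sum bound depends on \<open>c\<close> alone, and
  differencing with a bounded \<open>H\<close> meets only finitely many parameters c (h - k), all
  irrational off the diagonal, so uniformity survives the induction.\<close>

theorem weyl_irrational:
  assumes "c \<notin> \<rat>" "\<epsilon> > 0"
  shows "eventually (\<lambda>L. \<forall>f. poly_seq (Suc d) c f \<longrightarrow>
    norm (\<Sum>j<L. ecis (f j)) \<le> \<epsilon> * real L) sequentially"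
  using assms
proof (induction d arbitrary: c \<epsilon>)
  case 0
  have "ecis c \<noteq> 1"
    using 0 Ints_subset_Rats by (auto simp: ecis_eq_1_iff)
  define C where "C = 2 / norm (ecis c - 1)"
  have "eventually (\<lambda>L. real L \<ge> C / \<epsilon>) sequentially"
    using filterlim_real_sequentially by (simp add: filterlim_at_top)
  then show ?case
  proof eventually_elim
    case (elim L)
    then have "C \<le> \<epsilon> * real L" using 0 by (simp add: field_simps)
    then show ?case
      using poly_seq_1_sum_le[OF _ \<open>ecis c \<noteq> 1\<close>, of _ L] unfolding C_def
      by (metis order.trans)
  qed
next
  case (Suc d)
  \<comment> \<open>The diagonal contributes 1/H and the other pairs \<eta>, together at most
    2\<eta> = (\<epsilon>/2)^2 under the square root. The other half of \<epsilon> pays for the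
    summand \<open>H\<close>.\<close>
  define \<eta> where "\<eta> = \<epsilon>\<^sup>2 / 8"
  have \<eta>: "\<eta> > 0" using Suc by (simp add: \<eta>_def)
  obtain H :: nat where H: "H \<ge> 1" "1 / real H \<le> \<eta>"
  proof -
    obtain n :: nat where n: "inverse (real (Suc n)) < \<eta>"
      using reals_Archimedean[OF \<eta>] by blast
    show ?thesis
      by (rule that[of "Suc n"]) (use n in \<open>simp_all add: field_simps\<close>)
  qed
  have "eventually (\<lambda>L. \<forall>p\<in>{..<H} \<times> {..<H}. fst p \<noteq> snd p \<longrightarrow>
      (\<forall>f. poly_seq (Suc d) (c * (real (fst p) - real (snd p))) f \<longrightarrow>
        norm (\<Sum>j<L. ecis (f j)) \<le> \<eta> * real L)) sequentially"
  proof (intro eventually_ball_finite ballI)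
    fix p assume "p \<in> {..<H} \<times> {..<H}"
    show "eventually (\<lambda>L. fst p \<noteq> snd p \<longrightarrow>
      (\<forall>f. poly_seq (Suc d) (c * (real (fst p) - real (snd p))) f \<longrightarrow>
        norm (\<Sum>j<L. ecis (f j)) \<le> \<eta> * real L)) sequentially"
    proof (cases "fst p = snd p")
      case False
      have "c * (real (fst p) - real (snd p)) \<notin> \<rat>"
      proof
        assume "c * (real (fst p) - real (snd p)) \<in> \<rat>"
        then have "c * (real (fst p) - real (snd p)) / (real (fst p) - real (snd p)) \<in> \<rat>"
          by (intro Rats_divide Rats_diff Rats_of_nat)
        then show False using False Suc.prems by simp
      qed
      from Suc.IH[OF this \<eta>] show ?thesis
        by eventually_elim simp
    qed simp
  qed simp
  moreover have "eventually (\<lambda>L. real L \<ge> 2 * real H / \<epsilon>) sequentially"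
    using filterlim_real_sequentially by (simp add: filterlim_at_top)
  ultimately show ?case
  proof eventually_elim
    case (elim L)
    show ?case
    proof (intro allI impI)
      fix f assume f: "poly_seq (Suc (Suc d)) c f"
      define B where "B h k = (if h = k then real L else 0) + \<eta> * real L" for h k :: nat
      have "norm (\<Sum>j<L. ecis (f j)) \<le> real H + sqrt (real L * (\<Sum>h<H. \<Sum>k<H. B h k)) / real H"
      proof (rule van_der_Corput_poly_seq[OF f H(1)])
        fix h k g assume hk: "h < H" "k < H" "poly_seq (Suc d) (c * (real h - real k)) g"
        show "norm (\<Sum>j<L. ecis (g j)) \<le> B h k"
        proof (cases "h = k")
          case True
          then show ?thesis
            using norm_sum_le_card[of "{..<L}" "\<lambda>j. ecis (g j)"] \<eta> by (simp add: B_def add_increasing2)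
        next
          case False
          then show ?thesis using elim(1) hk by (force simp: B_def)
        qed
      qed
      also have "(\<Sum>h<H. \<Sum>k<H. B h k) = real H * real L + (real H)\<^sup>2 * (\<eta> * real L)"
        by (simp add: B_def sum.distrib power2_eq_square algebra_simps)
      also have "real L * \<dots> = (real H * real L)\<^sup>2 * (1 / real H + \<eta>)"
        using H by (simp add: field_simps power2_eq_square)
      also have "sqrt \<dots> / real H = real L * sqrt (1 / real H + \<eta>)"
        using H by (simp add: real_sqrt_mult)
      also have "sqrt (1 / real H + \<eta>) \<le> sqrt ((\<epsilon> / 2)\<^sup>2)"
        using H by (intro real_sqrt_le_mono) (simp add: \<eta>_def power2_eq_square field_simps)
      also have "\<dots> = \<epsilon> / 2" using Suc.prems by simp
      finally have "norm (\<Sum>j<L. ecis (f j)) \<le> real H + real L * (\<epsilon> / 2)"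
        by (simp add: mult_left_mono)
      also have "real H \<le> \<epsilon> * real L / 2"
        using elim(2) Suc.prems by (simp add: field_simps)
      finally show "norm (\<Sum>j<L. ecis (f j)) \<le> \<epsilon> * real L"
        by simp
    qed
  qed
qed

lemma card_near_le: "card {k. k < H \<and> \<bar>real h - real k\<bar> < real m} \<le> 2 * m"
proof -
  have "{k. k < H \<and> \<bar>real h - real k\<bar> < real m} \<subseteq> {Suc h - m..<h + m}"
    by auto
  then have "card {k. k < H \<and> \<bar>real h - real k\<bar> < real m} \<le> card {Suc h - m..<h + m}"
    by (intro card_mono) auto
  also have "\<dots> \<le> 2 * m" by simp
  finally show ?thesis .
qed

text \<open>Here the leading coefficient is so small that none of the differenced leading coefficients
  wraps around an integer, but still large enough for the phase to turn many times.\<close>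

theorem weyl_small_leading_coeff:
  assumes "\<epsilon> > 0"
  shows "\<exists>K>0. \<exists>\<delta>>0. \<forall>c L. \<bar>c\<bar> * real L ^ Suc d \<ge> K \<longrightarrow> \<bar>c\<bar> * real L ^ d \<le> \<delta> \<longrightarrow>
    (\<forall>f. poly_seq (Suc d) c f \<longrightarrow> norm (\<Sum>j<L. ecis (f j)) \<le> \<epsilon> * real L)"
  using assms
proof (induction d arbitrary: \<epsilon>)
  case 0
  show ?case
  proof (intro exI conjI allI impI)
    \<comment> \<open>For abs c <= 1/6 the norm of e(c) - 1 is at least pi abs c >= 2 abs c, so the
      geometric sum is at most 1 / abs c. The choice K = 1/\<epsilon> makes this at most
      \<epsilon>L.\<close>
    show "1 / \<epsilon> > 0" "(1/6::real) > 0" using 0 by auto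
    fix c L f
    assume K: "1 / \<epsilon> \<le> \<bar>c\<bar> * real L ^ Suc 0" and \<delta>: "\<bar>c\<bar> * real L ^ 0 \<le> 1 / 6"
      and f: "poly_seq (Suc 0) c f"
    have "1 / \<epsilon> > 0" using 0 by simp
    then have "c \<noteq> 0" using K by auto
    have "pi * \<bar>c\<bar> \<le> norm (ecis c - 1)"
      using norm_ecis_minus_1_ge[of c] \<delta> by simp
    moreover have "2 * \<bar>c\<bar> \<le> pi * \<bar>c\<bar>"
      using pi_gt3 by (intro mult_right_mono) auto
    ultimately have ge: "2 * \<bar>c\<bar> \<le> norm (ecis c - 1)"
      by linarith
    then have "ecis c \<noteq> 1" using \<open>c \<noteq> 0\<close> by auto
    have "norm (\<Sum>j<L. ecis (f j)) \<le> 2 / norm (ecis c - 1)"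
      by (rule poly_seq_1_sum_le[OF f \<open>ecis c \<noteq> 1\<close>])
    also have "\<dots> \<le> 2 / (2 * \<bar>c\<bar>)"
      by (rule divide_left_mono) (use ge \<open>c \<noteq> 0\<close> \<open>ecis c \<noteq> 1\<close> in \<open>auto intro!: mult_pos_pos\<close>)
    also have "\<dots> \<le> \<epsilon> * real L"
      using K \<open>c \<noteq> 0\<close> 0 by (simp add: field_simps)
    finally show "norm (\<Sum>j<L. ecis (f j)) \<le> \<epsilon> * real L" .
  qed
next
  case (Suc d \<epsilon>0)
  define \<epsilon> where "\<epsilon> = min \<epsilon>0 1"
  have \<epsilon>: "0 < \<epsilon>" "\<epsilon> \<le> 1" "\<epsilon> \<le> \<epsilon>0" using Suc.prems by (auto simp: \<epsilon>_def)
  \<comment> \<open>The constants are balanced by 4 \<eta> = \<epsilon>' \<epsilon> / 4: with H >=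
    \<epsilon>L/4, the near-diagonal pairs then contribute no more than the bound \<epsilon>' from
    the induction hypothesis does.\<close>
  define \<eta> where "\<eta> = \<epsilon> ^ 3 / 256"
  have \<eta>: "\<eta> > 0" using \<epsilon> by (simp add: \<eta>_def)
  define \<epsilon>' where "\<epsilon>' = \<epsilon>\<^sup>2 / 16"
  have \<epsilon>': "\<epsilon>' > 0" using \<epsilon> by (simp add: \<epsilon>'_def)
  obtain K' \<delta>' where K': "K' > 0" and \<delta>': "\<delta>' > 0" and IH:
    "\<And>c L f. K' \<le> \<bar>c\<bar> * real L ^ Suc d \<Longrightarrow> \<bar>c\<bar> * real L ^ d \<le> \<delta>' \<Longrightarrow> poly_seq (Suc d) c f \<Longrightarrow>
      norm (\<Sum>j<L. ecis (f j)) \<le> \<epsilon>' * real L"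
    using Suc.IH[OF \<epsilon>'] by blast
  define \<delta> where "\<delta> = min \<delta>' 1"
  have \<delta>: "\<delta> > 0" "\<delta> \<le> \<delta>'" "\<delta> \<le> 1" using \<delta>' by (auto simp: \<delta>_def)
  \<comment> \<open>The upper condition with \<delta> <= 1 turns the lower condition into L >= K.
    The entries 4/\<epsilon> and 1/\<eta> thus make \<epsilon>L and \<eta>L large enough for
    rounding; K'/\<eta> provides the lower condition after differencing.\<close>
  define K where "K = max (K' / \<eta>) (max (4 / \<epsilon>) (1 / \<eta>))"
  have K: "K > 0" "K' / \<eta> \<le> K" "4 / \<epsilon> \<le> K" "1 / \<eta> \<le> K"
    using K' \<eta> by (auto simp: K_def less_max_iff_disj)
  then have \<eta>K: "K' \<le> \<eta> * K"
    using \<eta> by (simp add: pos_divide_le_eq mult.commute)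
  show ?case
  proof (intro exI conjI allI impI)
    show "K > 0" "\<delta> > 0" by fact+
    fix c L f
    assume cK: "K \<le> \<bar>c\<bar> * real L ^ Suc (Suc d)" and c\<delta>: "\<bar>c\<bar> * real L ^ Suc d \<le> \<delta>"
      and f: "poly_seq (Suc (Suc d)) c f"
    have "K \<le> (\<bar>c\<bar> * real L ^ Suc d) * real L" using cK by (simp add: ac_simps)
    also have "\<dots> \<le> 1 * real L" using c\<delta> \<delta> by (intro mult_right_mono) auto
    finally have LK: "real L \<ge> K" by simp
    have L1: "\<epsilon> * real L \<ge> 4" "\<eta> * real L \<ge> 1" and Lpos: "real L > 0"
      using order.trans[OF K(3) LK] order.trans[OF K(4) LK] LK K(1) \<epsilon> \<eta> by (auto simp: field_simps)
    \<comment> \<open>In contrast to the irrational case, \<open>H\<close> is proportional to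
      \<open>L\<close>: the parameter is so small that only shifts comparable to \<open>L\<close>
      give differenced phases that still turn often.\<close>
    define H where "H = nat \<lfloor>\<epsilon> * real L / 2\<rfloor>"
    have H_le: "real H \<le> \<epsilon> * real L / 2" and "real H > \<epsilon> * real L / 2 - 1"
      using L1 unfolding H_def by linarith+
    then have H_ge: "real H \<ge> \<epsilon> * real L / 4" and "real H > 0" using L1 by linarith+
    then have H1: "H \<ge> 1" by simp
    have HL: "real H \<le> real L"
    proof -
      have "\<epsilon> * real L \<le> 1 * real L" using \<epsilon> by (intro mult_right_mono) auto
      then show ?thesis using H_le by simp
    qed
    \<comment> \<open>Pairs at distance below \<eta>L, for which the differenced coefficient may be
      too small, are estimated trivially. There are at most 2m of them for each
      \<open>h\<close>.\<close>
    define m where "m = nat \<lceil>\<eta> * real L\<rceil>"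
    have m: "real m \<ge> \<eta> * real L" "real m \<le> 2 * (\<eta> * real L)"
      using L1 unfolding m_def by linarith+
    define B where "B h k = (if \<bar>real h - real k\<bar> < real m then real L else 0) + \<epsilon>' * real L" for h k :: nat
    have "norm (\<Sum>j<L. ecis (f j)) \<le> real H + sqrt (real L * (\<Sum>h<H. \<Sum>k<H. B h k)) / real H"
    proof (rule van_der_Corput_poly_seq[OF f H1])
      fix h k g assume hk: "h < H" "k < H" and g: "poly_seq (Suc d) (c * (real h - real k)) g"
      show "norm (\<Sum>j<L. ecis (g j)) \<le> B h k"
      proof (cases "\<bar>real h - real k\<bar> < real m")
        case True
        then show ?thesis
          using norm_sum_le_card[of "{..<L}" "\<lambda>j. ecis (g j)"] \<epsilon>' by (simp add: B_def add_increasing2)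
      next
        case False
        have "norm (\<Sum>j<L. ecis (g j)) \<le> \<epsilon>' * real L"
        \<comment> \<open>The distance of \<open>h\<close> and \<open>k\<close> is at least \<eta>L,
          which preserves the lower condition, and at most \<open>L\<close>, which preserves the
          upper one with one power of \<open>L\<close> less.\<close>
        proof (rule IH[OF _ _ g])
          have "K' \<le> \<eta> * (\<bar>c\<bar> * real L ^ Suc (Suc d))"
            using \<eta>K cK \<eta> by (meson mult_left_mono less_imp_le order.trans)
          also have "\<dots> = (\<eta> * real L) * (\<bar>c\<bar> * real L ^ Suc d)" by simp
          also have "\<dots> \<le> \<bar>real h - real k\<bar> * (\<bar>c\<bar> * real L ^ Suc d)"
            using False m by (intro mult_right_mono) auto
          finally show "K' \<le> \<bar>c * (real h - real k)\<bar> * real L ^ Suc d"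
            by (simp add: abs_mult ac_simps)
          have "\<bar>real h - real k\<bar> \<le> real L" using hk HL by linarith
          then have "\<bar>c * (real h - real k)\<bar> * real L ^ d \<le> \<bar>c\<bar> * real L * real L ^ d"
            unfolding abs_mult by (intro mult_right_mono mult_left_mono) auto
          also have "\<dots> \<le> \<delta>'" using c\<delta> \<delta> by (simp add: ac_simps)
          finally show "\<bar>c * (real h - real k)\<bar> * real L ^ d \<le> \<delta>'" .
        qed
        then show ?thesis using False by (simp add: B_def)
      qed
    qed
    also have "\<dots> \<le> real H + real L * (\<epsilon> / 2)"
    proof -
      have "(\<Sum>k<H. B h k) \<le> 4 * (\<eta> * real L) * real L + real H * (\<epsilon>' * real L)" for h
      proof -
        have "(\<Sum>k<H. if \<bar>real h - real k\<bar> < real m then real L else 0) =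
          real (card {k. k < H \<and> \<bar>real h - real k\<bar> < real m}) * real L"
          by (simp add: sum.If_cases Int_def)
        also have "\<dots> \<le> real (2 * m) * real L"
          by (intro mult_right_mono of_nat_mono card_near_le) auto
        also have "\<dots> \<le> 4 * (\<eta> * real L) * real L"
          using m by (intro mult_right_mono) auto
        finally show ?thesis by (simp add: B_def sum.distrib)
      qed
      then have "(\<Sum>h<H. \<Sum>k<H. B h k) \<le> (\<Sum>h<H. 4 * (\<eta> * real L) * real L + real H * (\<epsilon>' * real L))"
        by (rule sum_mono)
      also have "\<dots> = real H * (4 * \<eta> * real L * real L) + (real H)\<^sup>2 * (\<epsilon>' * real L)"
        by (simp add: power2_eq_square algebra_simps)
      also have "real H * (4 * \<eta> * real L * real L) \<le> (real H)\<^sup>2 * (\<epsilon>' * real L)"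
      proof -
        have "4 * \<eta> * real L = \<epsilon>' * (\<epsilon> * real L / 4)"
          by (simp add: \<eta>_def \<epsilon>'_def power2_eq_square power3_eq_cube)
        also have "\<dots> \<le> \<epsilon>' * real H" using H_ge \<epsilon>' by (intro mult_left_mono) auto
        finally have "(4 * \<eta> * real L) * (real H * real L) \<le> (\<epsilon>' * real H) * (real H * real L)"
          by (rule mult_right_mono) simp
        then show ?thesis by (simp add: power2_eq_square ac_simps)
      qed
      finally have "real L * (\<Sum>h<H. \<Sum>k<H. B h k) \<le> real L * ((real H)\<^sup>2 * (2 * \<epsilon>' * real L))"
        by (intro mult_left_mono) (auto simp: ac_simps)
      also have "\<dots> = (real H * real L)\<^sup>2 * (\<epsilon>\<^sup>2 / 8)"
        by (simp add: \<epsilon>'_def power2_eq_square)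
      also have "\<dots> \<le> (real H * real L)\<^sup>2 * (\<epsilon> / 2)\<^sup>2"
        by (intro mult_left_mono) (auto simp: power2_eq_square)
      also have "\<dots> = (real H * real L * (\<epsilon> / 2))\<^sup>2"
        by (rule power_mult_distrib[symmetric])
      finally have "sqrt (real L * (\<Sum>h<H. \<Sum>k<H. B h k)) \<le> real H * real L * (\<epsilon> / 2)"
        using \<epsilon> by (intro real_le_lsqrt) auto
      then have "sqrt (real L * (\<Sum>h<H. \<Sum>k<H. B h k)) / real H \<le> real L * (\<epsilon> / 2)"
        using \<open>real H > 0\<close> by (simp add: field_simps)
      then show ?thesis by simp
    qed
    also have "\<dots> \<le> \<epsilon> * real L" using H_le by (simp add: algebra_simps)
    also have "\<dots> \<le> \<epsilon>0 * real L" using \<epsilon> by (intro mult_right_mono) auto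
    finally show "norm (\<Sum>j<L. ecis (f j)) \<le> \<epsilon>0 * real L" .
  qed
qed

section \<open>Binomial means\<close>

definition bmean :: "nat \<Rightarrow> (nat \<Rightarrow> 'a::real_vector) \<Rightarrow> 'a" where
  "bmean N b = (\<Sum>m\<le>N. (real (N choose m) / 2 ^ N) *\<^sub>R b m)"

lemma bmean_cong: "(\<And>m. m \<le> N \<Longrightarrow> b m = c m) \<Longrightarrow> bmean N b = bmean N c"
  by (simp add: bmean_def)

lemma bmean_0 [simp]: "bmean 0 b = b 0"
  by (simp add: bmean_def)

lemma bmean_add: "bmean N (\<lambda>m. b m + c m) = bmean N b + bmean N c"
  by (simp add: bmean_def scaleR_right_distrib sum.distrib)

lemma bmean_diff: "bmean N (\<lambda>m. b m - c m) = bmean N b - bmean N c"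
  by (simp add: bmean_def scaleR_right_diff_distrib sum_subtractf)

lemma bmean_scaleR: "bmean N (\<lambda>m. r *\<^sub>R b m) = r *\<^sub>R bmean N b"
  by (simp add: bmean_def scaleR_sum_right mult.commute)

lemma bmean_mult_left: "bmean N (\<lambda>m. z * b m) = z * bmean N (b :: nat \<Rightarrow> 'a :: real_algebra)"
  by (simp add: bmean_def sum_distrib_left)

lemma bmean_mult_right: "bmean N (\<lambda>m. b m * z) = bmean N (b :: nat \<Rightarrow> 'a :: real_algebra) * z"
  by (simp add: bmean_def sum_distrib_right)

lemma bmean_sum: "bmean N (\<lambda>m. \<Sum>i\<in>A. b i m) = (\<Sum>i\<in>A. bmean N (b i))"
  by (simp add: bmean_def scaleR_sum_right) (rule sum.swap)

lemma bmean_Suc: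
  "bmean (Suc N) b = (1 / 2) *\<^sub>R (bmean N b + bmean N (\<lambda>m. b (Suc m)))"
proof -
  have "(\<Sum>m\<le>Suc N. real (Suc N choose m) *\<^sub>R b m) =
    b 0 + (\<Sum>m\<le>N. real (N choose Suc m) *\<^sub>R b (Suc m)) + (\<Sum>m\<le>N. real (N choose m) *\<^sub>R b (Suc m))"
    by (subst sum.atMost_Suc_shift) (simp add: scaleR_left_distrib sum.distrib)
  also have "b 0 + (\<Sum>m\<le>N. real (N choose Suc m) *\<^sub>R b (Suc m)) =
      (\<Sum>m\<le>Suc N. real (N choose m) *\<^sub>R b m)"
    by (subst sum.atMost_Suc_shift) simp
  also have "\<dots> = (\<Sum>m\<le>N. real (N choose m) *\<^sub>R b m)"
    by simp
  finally have *: "(\<Sum>m\<le>Suc N. real (Suc N choose m) *\<^sub>R b m) =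
    (\<Sum>m\<le>N. real (N choose m) *\<^sub>R b m) + (\<Sum>m\<le>N. real (N choose m) *\<^sub>R b (Suc m))" .
  have **: "bmean M c = (1 / 2 ^ M) *\<^sub>R (\<Sum>m\<le>M. real (M choose m) *\<^sub>R c m)" for M and c :: "nat \<Rightarrow> 'a"
    by (simp add: bmean_def scaleR_sum_right)
  show ?thesis
    unfolding ** * by (simp add: scaleR_right_distrib)
qed

lemma bmean_const [simp]: "bmean N (\<lambda>_. c) = c"
  by (induction N) (auto simp: bmean_Suc simp flip: scaleR_2)

lemma bmean_mono:
  fixes b c :: "nat \<Rightarrow> real"
  assumes "\<And>m. m \<le> N \<Longrightarrow> b m \<le> c m"
  shows "bmean N b \<le> bmean N c"
  unfolding bmean_def real_scaleR_def using assms by (intro sum_mono mult_left_mono) auto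

lemma norm_bmean_le:
  assumes "\<And>m. m \<le> N \<Longrightarrow> norm (b m) \<le> c m"
  shows "norm (bmean N b) \<le> bmean N c"
  unfolding bmean_def using assms
  by (intro sum_norm_le) (auto intro!: mult_left_mono divide_right_mono)

text \<open>The shift \<open>c\<close> is what lets the induction close: one more step of the walk
  replaces it by c - 1 and c + 1, and the average of the two squares is c^2 + 1.\<close>

lemma bmean_square: "bmean N (\<lambda>m. (2 * real m - real N + c)\<^sup>2) = real N + c\<^sup>2"
proof (induction N arbitrary: c)
  case (Suc N)
  have "bmean (Suc N) (\<lambda>m. (2 * real m - real (Suc N) + c)\<^sup>2) =
    (bmean N (\<lambda>m. (2 * real m - real N + (c - 1))\<^sup>2) + bmean N (\<lambda>m. (2 * real m - real N + (c + 1))\<^sup>2)) / 2"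
    unfolding bmean_Suc by (simp add: algebra_simps)
  also have "\<dots> = real (Suc N) + c\<^sup>2"
    unfolding Suc.IH by (simp add: power2_eq_square algebra_simps)
  finally show ?case .
qed (simp add: power2_eq_square)

text \<open>The inequality abs x <= x^2/(2s) + s/2 with s = sqrt N plays the part of Cauchy-Schwarz
  and reduces the claim to the variance.\<close>

lemma bmean_abs_le: "bmean N (\<lambda>m. \<bar>2 * real m - real N\<bar>) \<le> sqrt (real N)"
proof (cases "N = 0")
  case False
  define s where "s = sqrt (real N)"
  have s: "s > 0" "s\<^sup>2 = real N" using False by (auto simp: s_def)
  have "\<bar>x\<bar> \<le> (1 / (2 * s)) * (x + 0)\<^sup>2 + s / 2" for x :: real
  proof -
    have "0 \<le> (\<bar>x\<bar> - s)\<^sup>2" by simp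
    then have "2 * s * \<bar>x\<bar> \<le> x\<^sup>2 + s\<^sup>2" by (simp add: power2_diff ac_simps)
    then show ?thesis using s(1) by (simp add: field_simps power2_eq_square)
  qed
  then have "bmean N (\<lambda>m. \<bar>2 * real m - real N\<bar>) \<le>
      bmean N (\<lambda>m. (1 / (2 * s)) * (2 * real m - real N + 0)\<^sup>2 + s / 2)"
    by (intro bmean_mono)
  also have "\<dots> = (1 / (2 * s)) * real N + s / 2"
    unfolding bmean_add bmean_mult_left bmean_square bmean_const by simp
  also have "\<dots> = s" using s by (simp add: power2_eq_square field_simps)
  finally show ?thesis by (simp add: s_def)
qed simp

text \<open>Chebyshev's inequality, the variance of 2m - N being N.\<close>

lemma bmean_tail_le:
  assumes "T > 0"
  shows "bmean N (\<lambda>m. if \<bar>2 * real m - real N\<bar> \<le> T * sqrt (real N) then 0 else 1) \<le> 1 / T\<^sup>2"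
proof (cases "N = 0")
  case False
  have "(if \<bar>x\<bar> \<le> T * sqrt (real N) then 0 else 1) \<le> (1 / (T\<^sup>2 * real N)) * (x + 0)\<^sup>2" for x :: real
  proof (cases "\<bar>x\<bar> \<le> T * sqrt (real N)")
    case False
    then have "(T * sqrt (real N))\<^sup>2 \<le> \<bar>x\<bar>\<^sup>2"
      using assms by (intro power_mono) auto
    then show ?thesis
      using False assms \<open>N \<noteq> 0\<close> by (simp add: power_mult_distrib field_simps)
  qed auto
  then have "bmean N (\<lambda>m. if \<bar>2 * real m - real N\<bar> \<le> T * sqrt (real N) then 0 else 1) \<le>
      bmean N (\<lambda>m. (1 / (T\<^sup>2 * real N)) * (2 * real m - real N + 0)\<^sup>2)"
    by (intro bmean_mono)
  also have "\<dots> = 1 / T\<^sup>2"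
    unfolding bmean_mult_left bmean_square using False by (simp add: power2_eq_square)
  finally show ?thesis .
qed simp

lemma norm_bmean_le_near:
  fixes b :: "nat \<Rightarrow> 'a :: real_normed_vector"
  assumes "T > 0" "C \<ge> 0" "e \<ge> 0"
    and near: "\<And>m. m \<le> N \<Longrightarrow> \<bar>2 * real m - real N\<bar> \<le> T * sqrt (real N) \<Longrightarrow> norm (b m) \<le> e"
    and far: "\<And>m. m \<le> N \<Longrightarrow> norm (b m) \<le> C"
  shows "norm (bmean N b) \<le> e + C / T\<^sup>2"
proof -
  have "norm (bmean N b) \<le>
      bmean N (\<lambda>m. e + C * (if \<bar>2 * real m - real N\<bar> \<le> T * sqrt (real N) then 0 else 1))"
    by (rule norm_bmean_le) (use assms in \<open>auto intro: add_increasing\<close>)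
  also have "\<dots> = e + C * bmean N (\<lambda>m. if \<bar>2 * real m - real N\<bar> \<le> T * sqrt (real N) then 0 else 1)"
    unfolding bmean_add bmean_mult_left bmean_const ..
  also have "\<dots> \<le> e + C * (1 / T\<^sup>2)"
    by (intro add_left_mono mult_left_mono bmean_tail_le assms)
  finally show ?thesis by simp
qed

text \<open>Both terms are means over row \<open>N + 1\<close> of Pascal's triangle, with weights \<open>2 (N + 1 - m) / (N + 1)\<close>
  and \<open>2 m / (N + 1)\<close>.\<close>

lemma bmean_shift:
  fixes b :: "nat \<Rightarrow> 'a :: real_normed_vector"
  assumes "\<And>m. norm (b m) \<le> 1"
  shows "norm (bmean N (\<lambda>m. b (Suc m)) - bmean N b) \<le> 2 / sqrt (real (Suc N))"
proof -
  have 1: "bmean N b = bmean (Suc N) (\<lambda>m. (2 * (real (Suc N) - real m) / real (Suc N)) *\<^sub>R b m)"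
  proof -
    have "real (N choose m) = real (Suc N choose m) * (real (Suc N) - real m) / real (Suc N)"
      if "m \<le> N" for m
    proof -
      have "Suc N * (N choose m) = (Suc N - m) * (Suc N choose m)"
        using binomial_absorb_comp[of "Suc N" m] by simp
      then have "real (Suc N) * real (N choose m) = (real (Suc N) - real m) * real (Suc N choose m)"
        using that by (metis of_nat_diff of_nat_mult le_SucI)
      then show ?thesis by (simp add: field_simps del: of_nat_Suc)
    qed
    moreover have "x / 2 ^ N = y / 2 ^ Suc N * (2 * t / s)" if "x = y * t / s" for x y t s :: real
      by (simp add: that)
    ultimately have "real (N choose m) / 2 ^ N =
        real (Suc N choose m) / 2 ^ Suc N * (2 * (real (Suc N) - real m) / real (Suc N))"
      if "m \<le> N" for m
      using that by blast
    then have "bmean N b = (\<Sum>m\<le>N. (real (Suc N choose m) / 2 ^ Suc N) *\<^sub>R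
        ((2 * (real (Suc N) - real m) / real (Suc N)) *\<^sub>R b m))"
      unfolding bmean_def scaleR_scaleR by (intro sum.cong refl) (simp only: atMost_iff)
    then show ?thesis by (simp add: bmean_def del: binomial_Suc_Suc)
  qed
  have 2: "bmean N (\<lambda>m. b (Suc m)) = bmean (Suc N) (\<lambda>m. (2 * real m / real (Suc N)) *\<^sub>R b m)"
  proof -
    have "real (N choose m) = real (Suc N choose Suc m) * real (Suc m) / real (Suc N)" for m
    proof -
      have "real (Suc N) * real (N choose m) = real (Suc m) * real (Suc N choose Suc m)"
        using Suc_times_binomial_eq[of N m] by (metis of_nat_mult mult.commute)
      then show ?thesis by (simp add: field_simps del: of_nat_Suc)
    qed
    then have "bmean N (\<lambda>m. b (Suc m)) = (\<Sum>m\<le>N. (real (Suc N choose Suc m) / 2 ^ Suc N) *\<^sub>R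
        ((2 * real (Suc m) / real (Suc N)) *\<^sub>R b (Suc m)))"
      unfolding bmean_def by (intro sum.cong refl) (simp del: of_nat_Suc binomial_Suc_Suc)
    then show ?thesis
      unfolding bmean_def by (subst sum.atMost_Suc_shift) (simp del: of_nat_Suc binomial_Suc_Suc)
  qed
  \<comment> \<open>The two weights differ by 2 (2m - (N+1)) / (N+1). The mean absolute deviation in
    row N + 1 is at most sqrt (N+1), which yields the bound.\<close>
  have "norm (bmean N (\<lambda>m. b (Suc m)) - bmean N b) =
      norm (bmean (Suc N) (\<lambda>m. (2 * (2 * real m - real (Suc N)) / real (Suc N)) *\<^sub>R b m))"
    unfolding 1 2 bmean_diff[symmetric] scaleR_left_diff_distrib[symmetric]
    by (simp add: diff_divide_distrib[symmetric] algebra_simps)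
  also have "\<dots> \<le> bmean (Suc N) (\<lambda>m. (2 / real (Suc N)) * \<bar>2 * real m - real (Suc N)\<bar>)"
  proof (rule norm_bmean_le)
    fix m
    have "\<bar>2 * (2 * real m - real (Suc N)) / real (Suc N)\<bar> * norm (b m) \<le>
        \<bar>2 * (2 * real m - real (Suc N)) / real (Suc N)\<bar> * 1"
      by (intro mult_left_mono assms) auto
    moreover have "\<bar>2 * x / real (Suc N)\<bar> = 2 / real (Suc N) * \<bar>x\<bar>" for x
      by (simp add: abs_mult)
    ultimately show "norm ((2 * (2 * real m - real (Suc N)) / real (Suc N)) *\<^sub>R b m) \<le>
        (2 / real (Suc N)) * \<bar>2 * real m - real (Suc N)\<bar>"
      by (simp only: norm_scaleR mult_1_right)
  qed
  also have "\<dots> = (2 / real (Suc N)) * bmean (Suc N) (\<lambda>m. \<bar>2 * real m - real (Suc N)\<bar>)"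
    by (rule bmean_mult_left)
  also have "\<dots> \<le> (2 / real (Suc N)) * sqrt (real (Suc N))"
    by (intro mult_left_mono bmean_abs_le) auto
  also have "\<dots> = 2 / sqrt (real (Suc N))"
    by (simp add: field_simps del: of_nat_Suc)
  finally show ?thesis .
qed

lemma bmean_shift_add:
  fixes b :: "nat \<Rightarrow> 'a :: real_normed_vector"
  assumes "\<And>m. norm (b m) \<le> 1"
  shows "norm (bmean N (\<lambda>m. b (m + r)) - bmean N b) \<le> 2 * real r / sqrt (real (Suc N))"
proof (induction r)
  case (Suc r)
  have "norm ((bmean N (\<lambda>m. b (Suc m + r)) - bmean N (\<lambda>m. b (m + r))) +
      (bmean N (\<lambda>m. b (m + r)) - bmean N b)) \<le>
      2 / sqrt (real (Suc N)) + 2 * real r / sqrt (real (Suc N))"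
    by (intro norm_triangle_mono Suc.IH bmean_shift assms)
  then show ?case by (simp add: add_divide_distrib)
qed simp

text \<open>Grouping \<open>n\<close> by parity gives two ordinary binomial means. The indices 0 and
  2N + 1, which the defining sum from 1 to 2N leaves out, are subtracted again; each has weight
  2^-(N+1).\<close>

lemma bin2_mean_eq:
  "bin2_mean N a = (1 / 2) *\<^sub>R (bmean N (\<lambda>m. a (2 * m)) + bmean N (\<lambda>m. a (2 * m + 1)))
    - (1 / 2 ^ (N + 1)) *\<^sub>R (a 0 + a (2 * N + 1))"
proof -
  define w where "w n = of_nat (N choose (n div 2)) * a n" for n
  have "(\<Sum>n<2 * M. w n) = (\<Sum>m<M. of_nat (N choose m) * (a (2 * m) + a (2 * m + 1)))" for M
    by (induction M) (auto simp: w_def algebra_simps)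
  from this[of "Suc N"] have "(\<Sum>n<2 * N + 2. w n) =
      (\<Sum>m\<le>N. of_nat (N choose m) * (a (2 * m) + a (2 * m + 1)))"
    by (simp add: lessThan_Suc_atMost)
  also have "(\<Sum>n<2 * N + 2. w n) = w 0 + (\<Sum>n = 1..2 * N. w n) + w (2 * N + 1)"
  proof -
    have "(\<Sum>n<2 * N + 2. w n) = (\<Sum>n<Suc (2 * N). w n) + w (2 * N + 1)"
      by simp
    also have "(\<Sum>n<Suc (2 * N). w n) = w 0 + (\<Sum>n = 1..2 * N. w n)"
      by (subst sum.lessThan_Suc_shift) (simp add: sum.atLeast1_atMost_eq)
    finally show ?thesis .
  qed
  finally have *: "(\<Sum>n = 1..2 * N. w n) =
      (\<Sum>m\<le>N. of_nat (N choose m) * (a (2 * m) + a (2 * m + 1))) - (a 0 + a (2 * N + 1))"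
    by (simp add: w_def algebra_simps)
  have "(1 / 2) *\<^sub>R bmean N c = 1 / 2 ^ (N + 1) * (\<Sum>m\<le>N. of_nat (N choose m) * c m)"
    for c :: "nat \<Rightarrow> complex"
    by (simp add: bmean_def scaleR_conv_of_real sum_distrib_left)
  moreover have "(1 / 2 ^ (N + 1)) *\<^sub>R z = 1 / 2 ^ (N + 1) * z" for z :: complex
    by (simp add: scaleR_conv_of_real)
  ultimately show ?thesis
    unfolding bin2_mean_def w_def[symmetric] bmean_add[symmetric] * by (simp only: right_diff_distrib)
qed

lemma norm_bin2_mean_diff_le:
  assumes "\<And>n. norm (a n) \<le> 1"
  shows "norm (bin2_mean N a - (1 / 2) *\<^sub>R (bmean N (\<lambda>m. a (2 * m)) + bmean N (\<lambda>m. a (2 * m + 1))))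
    \<le> 1 / 2 ^ N"
proof -
  have "norm (a 0 + a (2 * N + 1)) \<le> 1 + 1"
    by (intro norm_triangle_mono assms)
  moreover have "norm (X - Y - X) = norm Y" for X Y :: complex
    by simp
  ultimately show ?thesis
    unfolding bin2_mean_eq by (simp add: divide_simps del: scaleR_right_distrib)
qed

text \<open>The step 2Q is even, so that a shift of \<open>n\<close> by 2Qj stays within one parity
  class and becomes a shift of \<open>m\<close> by Qj, to which the near invariance of the weights
  applies. The extra 1 in the window makes room for the odd class n = 2m + 1.\<close>

lemma bin2_mean_tendsto_0:
  assumes a: "\<And>n. norm (a n) \<le> 1"
    and short: "\<And>\<epsilon> T. \<epsilon> > 0 \<Longrightarrow> T > 0 \<Longrightarrow> eventually (\<lambda>N. \<exists>L. 1 \<le> L \<and> real L \<le> \<epsilon> * sqrt (real N) \<and>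
      (\<forall>n. \<bar>real n - real N\<bar> \<le> T * sqrt (real N) + 1 \<longrightarrow>
        norm (\<Sum>j<L. a (n + 2 * Q * j)) \<le> \<epsilon> * real L)) sequentially"
  shows "(\<lambda>N. bin2_mean N a) \<longlonglongrightarrow> 0"
proof (rule tendstoI)
  fix e :: real assume e: "e > 0"
  \<comment> \<open>The budget for each parity class is e/2: shifting costs 2Q\<epsilon> <= e/4, and
    short sums and tail cost \<epsilon> each, the latter by T = 1 / sqrt \<epsilon>.\<close>
  define \<epsilon> where "\<epsilon> = e / (8 * (real Q + 1))"
  have \<epsilon>: "\<epsilon> > 0" "\<epsilon> \<le> e / 8" "2 * real Q * \<epsilon> \<le> e / 4"
    using e by (auto simp: \<epsilon>_def field_simps)
  define T where "T = 1 / sqrt \<epsilon>"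
  have T: "T > 0" "1 / T\<^sup>2 = \<epsilon>" using \<epsilon> by (auto simp: T_def power_divide)
  have "eventually (\<lambda>N. (1 / 2) ^ N < e / 4) sequentially"
    using e by (intro order_tendstoD(2)[OF LIMSEQ_power_zero]) auto
  with short[OF \<epsilon>(1) T(1)] show "eventually (\<lambda>N. dist (bin2_mean N a) 0 < e) sequentially"
    using eventually_gt_at_top[of 0]
  proof eventually_elim
    case (elim N)
    then obtain L where L: "1 \<le> L" "real L \<le> \<epsilon> * sqrt (real N)"
      "\<And>n. \<bar>real n - real N\<bar> \<le> T * sqrt (real N) + 1 \<Longrightarrow> norm (\<Sum>j<L. a (n + 2 * Q * j)) \<le> \<epsilon> * real L"
      by blast
    have *: "norm (bmean N b) \<le> e / 2"
      if b: "b = (\<lambda>m. a (2 * m + d))" and "d \<le> 1" for b d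
    proof -
      have b1: "norm (b m) \<le> 1" for m unfolding b by (rule a)
      have "norm (bmean N (\<lambda>m. \<Sum>j<L. b (m + Q * j))) \<le> \<epsilon> * real L + real L / T\<^sup>2"
      proof (rule norm_bmean_le_near)
        fix m
        show "norm (\<Sum>j<L. b (m + Q * j)) \<le> real L"
          using norm_sum_le_card[of "{..<L}" "\<lambda>j. b (m + Q * j)"] b1 by simp
        assume "\<bar>2 * real m - real N\<bar> \<le> T * sqrt (real N)"
        then have "\<bar>real (2 * m + d) - real N\<bar> \<le> T * sqrt (real N) + 1"
          using \<open>d \<le> 1\<close> by simp
        from L(3)[OF this] show "norm (\<Sum>j<L. b (m + Q * j)) \<le> \<epsilon> * real L"
          by (simp add: b algebra_simps)
      qed (use T \<epsilon> in auto)
      then have 1: "norm (bmean N (\<lambda>m. \<Sum>j<L. b (m + Q * j))) \<le> 2 * \<epsilon> * real L"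
        by (simp add: T(2)[symmetric])
      have "norm (bmean N (\<lambda>m. \<Sum>j<L. b (m + Q * j)) - real L *\<^sub>R bmean N b) =
        norm (\<Sum>j<L. bmean N (\<lambda>m. b (m + Q * j)) - bmean N b)"
        by (simp add: bmean_sum sum_subtractf scaleR_conv_of_real)
      also have "\<dots> \<le> (\<Sum>j<L. 2 * real (Q * L) / sqrt (real N))"
      proof (rule sum_norm_le)
        fix j assume "j \<in> {..<L}"
        have "norm (bmean N (\<lambda>m. b (m + Q * j)) - bmean N b) \<le> 2 * real (Q * j) / sqrt (real (Suc N))"
          by (rule bmean_shift_add) (rule b1)
        also have "\<dots> \<le> 2 * real (Q * L) / sqrt (real N)"
          using \<open>j \<in> {..<L}\<close> elim
          by (intro frac_le mult_left_mono of_nat_mono mult_le_mono) auto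
        finally show "norm (bmean N (\<lambda>m. b (m + Q * j)) - bmean N b) \<le> 2 * real (Q * L) / sqrt (real N)" .
      qed
      also have "\<dots> = real L * (2 * real Q * (real L / sqrt (real N)))"
        by simp
      also have "\<dots> \<le> real L * (2 * real Q * \<epsilon>)"
        using L(2) elim by (intro mult_left_mono) (auto simp: field_simps)
      also have "\<dots> \<le> real L * (e / 4)"
        using \<epsilon> by (intro mult_left_mono) auto
      finally have 2: "norm (bmean N (\<lambda>m. \<Sum>j<L. b (m + Q * j)) - real L *\<^sub>R bmean N b) \<le> real L * (e / 4)" .
      have "real L * norm (bmean N b) = norm (bmean N (\<lambda>m. \<Sum>j<L. b (m + Q * j)) -
        (bmean N (\<lambda>m. \<Sum>j<L. b (m + Q * j)) - real L *\<^sub>R bmean N b))"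
        by simp
      also have "\<dots> \<le> 2 * \<epsilon> * real L + real L * (e / 4)"
        by (rule order.trans[OF norm_triangle_ineq4 add_mono[OF 1 2]])
      also have "\<dots> = real L * (2 * \<epsilon> + e / 4)" by (simp add: algebra_simps)
      finally have "norm (bmean N b) \<le> 2 * \<epsilon> + e / 4" using L(1) by simp
      then show ?thesis using \<epsilon> by simp
    qed
    have "norm ((1 / 2) *\<^sub>R (bmean N (\<lambda>m. a (2 * m)) + bmean N (\<lambda>m. a (2 * m + 1)))) \<le> (e / 2 + e / 2) / 2"
      using norm_triangle_mono[OF *[of "\<lambda>m. a (2 * m)" 0] *[of "\<lambda>m. a (2 * m + 1)" 1]] by simp
    moreover have "norm (bin2_mean N a - (1 / 2) *\<^sub>R (bmean N (\<lambda>m. a (2 * m)) +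
        bmean N (\<lambda>m. a (2 * m + 1)))) \<le> (1 / 2) ^ N"
      using norm_bin2_mean_diff_le[OF a, of N] by (simp add: power_divide)
    ultimately have "norm (bin2_mean N a) \<le> (e / 2 + e / 2) / 2 + (1 / 2) ^ N"
      using norm_triangle_sub[of "bin2_mean N a"] by (meson add_mono order.trans)
    then show ?case using elim e by simp
  qed
qed

section \<open>Short sums along slowly varying derivatives\<close>

lemma eventually_sequentially_real:
  "eventually P at_top \<Longrightarrow> eventually (\<lambda>N. P (real N)) sequentially"
  by (rule eventually_compose_filterlim[OF _ filterlim_real_sequentially])

lemma eventually_window_small:
  assumes "T \<ge> 0" "\<delta> > 0"
  shows "eventually (\<lambda>N. T * sqrt (real N) + 1 \<le> \<delta> * real N) sequentially"
proof -
  have "eventually (\<lambda>x. sqrt x \<ge> (T + 1) / \<delta>) at_top"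
    using sqrt_at_top by (simp add: filterlim_at_top)
  then have "eventually (\<lambda>x. T * sqrt x + 1 \<le> \<delta> * x) at_top"
    using eventually_ge_at_top[of 1]
  proof eventually_elim
    case (elim x)
    have "T * sqrt x + 1 \<le> T * sqrt x + sqrt x" using elim by simp
    also have "\<dots> = (T + 1) * sqrt x" by (simp add: algebra_simps)
    also have "\<dots> \<le> \<delta> * sqrt x * sqrt x"
      using elim assms by (intro mult_right_mono) (auto simp: field_simps)
    also have "\<dots> = \<delta> * x" using elim by (simp add: mult.assoc)
    finally show ?case .
  qed
  then show ?thesis by (rule eventually_sequentially_real)
qed

lemma eventually_window_ge:
  assumes "T \<ge> 0"
  shows "eventually (\<lambda>N. \<forall>t. \<bar>t - real N\<bar> \<le> T * sqrt (real N) + 1 \<longrightarrow> X \<le> t) sequentially"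
proof -
  have "eventually (\<lambda>N. real N \<ge> 2 * \<bar>X\<bar>) sequentially"
    using filterlim_real_sequentially by (simp add: filterlim_at_top)
  with eventually_window_small[OF assms, of "1 / 2", simplified] show ?thesis
  proof eventually_elim
    case (elim N)
    have "X \<le> t" if "\<bar>t - real N\<bar> \<le> T * sqrt (real N) + 1" for t
      using elim that by linarith
    then show ?case by blast
  qed
qed

lemma ecis_periodic_sum:
  fixes P :: "nat \<Rightarrow> real"
  assumes "\<And>n j. P (n + 2 * Q * j) - P n \<in> \<int>"
  shows "norm (\<Sum>j<L. ecis (P (n + 2 * Q * j) + g (real (n + 2 * Q * j)))) =
    norm (\<Sum>j<L. ecis (g (real n + real (2 * Q * j))))"
proof -
  have "ecis (P (n + 2 * Q * j) + g (real (n + 2 * Q * j))) =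
      ecis (P n) * ecis (g (real n + real (2 * Q * j)))" for j
    using ecis_add_Ints[OF assms[of n j], of "P n + g (real (n + 2 * Q * j))"]
    by (simp add: add.commute add.left_commute flip: ecis_add)
  then show ?thesis by (simp add: norm_mult flip: sum_distrib_left)
qed

text \<open>Only the top derivative has to be controlled. The lower Taylor coefficients depend on
  the starting point in an arbitrary way, but they are swallowed by a bound \<open>B\<close> that is
  uniform over all polynomial sequences with the given leading parameter.\<close>

lemma taylor_exponential_sum:
  fixes D :: "nat \<Rightarrow> real \<Rightarrow> real"
  assumes "d > 0" "q > 0"
    and D: "\<And>m t. m < d \<Longrightarrow> t \<ge> x \<Longrightarrow> (D m has_real_derivative D (Suc m) t) (at t)"
    and close: "\<And>t. x \<le> t \<Longrightarrow> t \<le> x + real (q * L) \<Longrightarrow> \<bar>D d t - \<gamma>\<bar> \<le> \<eta>"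
    and W: "\<And>f. poly_seq d (\<gamma> * real q ^ d) f \<Longrightarrow> norm (\<Sum>j<L. ecis (f j)) \<le> B"
  shows "norm (\<Sum>j<L. ecis (D 0 (x + real (q * j)))) \<le> B + real L * (2 * pi * (\<eta> * real (q * L) ^ d))"
proof -
  \<comment> \<open>These are the Taylor coefficients at \<open>x\<close> in the variable
    \<open>j\<close>, the factor \<open>q ^ m\<close> coming from the step \<open>q\<close>. The top
    one uses \<gamma> in place of \<open>D d x\<close>, so that the leading parameter is the same at
    every starting point.\<close>
  define c where "c m = (if m = d then \<gamma> else D m x) / fact m * real q ^ m" for m
  define f where "f j = (\<Sum>m<d. c m * real j ^ m) + c d * real j ^ d" for j
  have "fact d * c d = \<gamma> * real q ^ d" by (simp add: c_def)
  then have "poly_seq d (\<gamma> * real q ^ d) f"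
    using poly_seq_polynomial[of d c] unfolding f_def by simp
  note Wf = W[OF this]
  have f_eq: "f j = (\<Sum>m<d. D m x / fact m * real (q * j) ^ m) + \<gamma> / fact d * real (q * j) ^ d" for j
    by (simp add: f_def c_def power_mult_distrib mult.assoc)
  have \<eta>: "\<eta> \<ge> 0" using close[of x] by fastforce
  have err: "\<bar>D 0 (x + real (q * j)) - f j\<bar> \<le> \<eta> * real (q * L) ^ d" if "j < L" for j
  proof (cases "j = 0")
    case True
    obtain e where "d = Suc e" using \<open>d > 0\<close> by (cases d) auto
    have "f 0 = D 0 x"
      unfolding f_eq \<open>d = Suc e\<close> by (subst sum.lessThan_Suc_shift) simp
    then show ?thesis using True \<eta> by simp
  next
    case False
    define y where "y = x + real (q * j)"
    have y: "x < y" "y \<le> x + real (q * L)"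
      using False \<open>q > 0\<close> that by (auto simp: y_def simp flip: of_nat_mult)
    have "\<exists>t. x < t \<and> t < y \<and> D 0 y = (\<Sum>m<d. D m x / fact m * (y - x) ^ m) + D d t / fact d * (y - x) ^ d"
      by (rule Taylor_up[OF \<open>d > 0\<close> refl, of x y]) (use D y in auto)
    then obtain t where t: "x < t" "t < y"
      "D 0 y = (\<Sum>m<d. D m x / fact m * (y - x) ^ m) + D d t / fact d * (y - x) ^ d"
      by blast
    have "D 0 y - f j = (D d t - \<gamma>) / fact d * real (q * j) ^ d"
      unfolding t(3) f_eq by (simp add: y_def algebra_simps diff_divide_distrib)
    also have "\<bar>\<dots>\<bar> = \<bar>D d t - \<gamma>\<bar> / fact d * real (q * j) ^ d"
      by (simp add: abs_mult)
    also have "\<dots> \<le> \<eta> / 1 * real (q * L) ^ d"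
    proof (intro mult_mono frac_le power_mono)
      show "\<bar>D d t - \<gamma>\<bar> \<le> \<eta>" using close[of t] t y by simp
    qed (use \<eta> that in \<open>auto intro: mult_left_mono\<close>)
    finally show ?thesis by (simp add: y_def)
  qed
  have "norm ((\<Sum>j<L. ecis (D 0 (x + real (q * j)))) - (\<Sum>j<L. ecis (f j))) \<le>
      (\<Sum>j<L. 2 * pi * (\<eta> * real (q * L) ^ d))"
    unfolding sum_subtractf[symmetric]
  proof (rule sum_norm_le)
    fix j assume "j \<in> {..<L}"
    then have "2 * pi * \<bar>D 0 (x + real (q * j)) - f j\<bar> \<le> 2 * pi * (\<eta> * real (q * L) ^ d)"
      by (intro mult_left_mono err) auto
    then show "norm (ecis (D 0 (x + real (q * j))) - ecis (f j)) \<le> 2 * pi * (\<eta> * real (q * L) ^ d)"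
      using norm_ecis_diff_le order.trans by blast
  qed
  then show ?thesis
    using Wf norm_triangle_sub[of "\<Sum>j<L. ecis (D 0 (x + real (q * j)))" "\<Sum>j<L. ecis (f j)"]
    by simp
qed

context hardy_functions_ln
begin

lemma iter_deriv_eventually:
  assumes "g \<in> F"
  obtains X where "\<And>m t. m < d \<Longrightarrow> t \<ge> X \<Longrightarrow>
    ((deriv ^^ m) g has_real_derivative (deriv ^^ Suc m) g t) (at t)"
proof -
  have "eventually (\<lambda>t. \<forall>m\<in>{..<d}. ((deriv ^^ m) g has_real_derivative (deriv ^^ Suc m) g t) (at t)) at_top"
    using has_deriv[OF iter_deriv[OF assms]] by (intro eventually_ball_finite) auto
  then obtain X where "\<And>t. t \<ge> X \<Longrightarrow>
      \<forall>m\<in>{..<d}. ((deriv ^^ m) g has_real_derivative (deriv ^^ Suc m) g t) (at t)"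
    unfolding eventually_at_top_linorder by blast
  then show ?thesis by (intro that) auto
qed

lemma bin2_mean_tendsto_0_irrational:
  fixes P :: "nat \<Rightarrow> real"
  assumes g: "g \<in> F" and "Q > 0" and P: "\<And>n j. P (n + 2 * Q * j) - P n \<in> \<int>"
    and "d > 0" and lim: "((deriv ^^ d) g \<longlongrightarrow> \<theta>) at_top" and "\<theta> \<notin> \<rat>"
  shows "(\<lambda>N. bin2_mean N (\<lambda>n. ecis (P n + g (real n)))) \<longlonglongrightarrow> 0"
proof (rule bin2_mean_tendsto_0)
  fix \<epsilon> T :: real assume "\<epsilon> > 0" "T > 0"
  define q where "q = 2 * Q"
  have q: "q > 0" using \<open>Q > 0\<close> by (simp add: q_def)
  obtain X where X: "\<And>m t. m < d \<Longrightarrow> t \<ge> X \<Longrightarrow>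
    ((deriv ^^ m) g has_real_derivative (deriv ^^ Suc m) g t) (at t)"
    using iter_deriv_eventually[OF g] by blast
  obtain e where e: "d = Suc e" using \<open>d > 0\<close> by (cases d) auto
  have "\<theta> * real q ^ d \<notin> \<rat>"
  proof
    assume "\<theta> * real q ^ d \<in> \<rat>"
    then have "\<theta> * real q ^ d / real q ^ d \<in> \<rat>" by (intro Rats_divide) auto
    then show False using q \<open>\<theta> \<notin> \<rat>\<close> by simp
  qed
  then have "eventually (\<lambda>L. \<forall>f. poly_seq d (\<theta> * real q ^ d) f \<longrightarrow>
      norm (\<Sum>j<L. ecis (f j)) \<le> \<epsilon> / 2 * real L) sequentially"
    unfolding e using \<open>\<epsilon> > 0\<close> by (intro weyl_irrational) auto
  then have "eventually (\<lambda>L. 1 \<le> L \<and> (\<forall>f. poly_seq d (\<theta> * real q ^ d) f \<longrightarrow>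
      norm (\<Sum>j<L. ecis (f j)) \<le> \<epsilon> / 2 * real L)) sequentially"
    using eventually_ge_at_top[of 1] by eventually_elim simp
  then obtain L where L: "1 \<le> L" "\<And>f. poly_seq d (\<theta> * real q ^ d) f \<Longrightarrow>
      norm (\<Sum>j<L. ecis (f j)) \<le> \<epsilon> / 2 * real L"
    using eventually_happens'[OF sequentially_bot] by blast
  \<comment> \<open>At this point \<open>L\<close> is already fixed, so \<eta> may depend on it; the
    Taylor error then costs \<epsilon>/2 per term.\<close>
  define \<eta> where "\<eta> = \<epsilon> / (4 * pi * real (q * L) ^ d)"
  have qL: "real (q * L) > 0" using q L by simp
  then have \<eta>: "\<eta> > 0" "2 * pi * (\<eta> * real (q * L) ^ d) = \<epsilon> / 2"
    using \<open>\<epsilon> > 0\<close> q L by (auto simp: \<eta>_def)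
  have "eventually (\<lambda>t. dist ((deriv ^^ d) g t) \<theta> < \<eta>) at_top"
    using lim \<eta>(1) by (rule tendstoD)
  then obtain Y where Y: "\<And>t. t \<ge> Y \<Longrightarrow> \<bar>(deriv ^^ d) g t - \<theta>\<bar> \<le> \<eta>"
    unfolding eventually_at_top_linorder dist_real_def by fastforce
  have "eventually (\<lambda>N. sqrt (real N) \<ge> real L / \<epsilon>) sequentially"
    using sqrt_at_top by (intro eventually_sequentially_real) (simp add: filterlim_at_top)
  with eventually_window_ge[of T "max X Y"]
  show "eventually (\<lambda>N. \<exists>L. 1 \<le> L \<and> real L \<le> \<epsilon> * sqrt (real N) \<and>
      (\<forall>n. \<bar>real n - real N\<bar> \<le> T * sqrt (real N) + 1 \<longrightarrow>
        norm (\<Sum>j<L. ecis (P (n + 2 * Q * j) + g (real (n + 2 * Q * j)))) \<le> \<epsilon> * real L)) sequentially"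
  proof (rule eventually_elim2)
    show "T \<ge> 0" using \<open>T > 0\<close> by simp
    fix N assume N: "\<forall>t. \<bar>t - real N\<bar> \<le> T * sqrt (real N) + 1 \<longrightarrow> max X Y \<le> t"
      "sqrt (real N) \<ge> real L / \<epsilon>"
    have "norm (\<Sum>j<L. ecis (g (real n + real (q * j)))) \<le> \<epsilon> * real L"
      if "\<bar>real n - real N\<bar> \<le> T * sqrt (real N) + 1" for n
    proof -
      have n: "real n \<ge> X" "real n \<ge> Y" using N(1) that by auto
      have "norm (\<Sum>j<L. ecis ((deriv ^^ 0) g (real n + real (q * j)))) \<le>
          \<epsilon> / 2 * real L + real L * (2 * pi * (\<eta> * real (q * L) ^ d))"
        by (rule taylor_exponential_sum[OF \<open>d > 0\<close> q]) (use X Y n L in auto)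
      also have "\<dots> = \<epsilon> * real L" unfolding \<eta> by simp
      finally show ?thesis by simp
    qed
    then show "\<exists>L. 1 \<le> L \<and> real L \<le> \<epsilon> * sqrt (real N) \<and>
      (\<forall>n. \<bar>real n - real N\<bar> \<le> T * sqrt (real N) + 1 \<longrightarrow>
        norm (\<Sum>j<L. ecis (P (n + 2 * Q * j) + g (real (n + 2 * Q * j)))) \<le> \<epsilon> * real L)"
      unfolding ecis_periodic_sum[OF P] using L(1) N(2) \<open>\<epsilon> > 0\<close>
      by (intro exI[of _ L]) (auto simp: q_def field_simps)
  qed
qed simp

text \<open>The length must meet three demands: at least K^(1/d) / abs c^(1/d) for cancellation,
  long enough that c L^(d-1) is small, and at most \<epsilon> sqrt N for the shift. The second
  follows from w -> 0, the third from the growth of abs w times x^(d/2), and slow variation lets one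
  coefficient \<open>c\<close> serve the whole window.\<close>

lemma bin2_mean_tendsto_0_vanishing:
  fixes P :: "nat \<Rightarrow> real"
  assumes g: "g \<in> F" and "Q > 0" and P: "\<And>n j. P (n + 2 * Q * j) - P n \<in> \<int>"
    and "d > 0" and lim0: "((deriv ^^ d) g \<longlongrightarrow> 0) at_top"
    and lim: "filterlim (\<lambda>x. \<bar>(deriv ^^ d) g x\<bar> * sqrt x ^ d) at_top at_top"
  shows "(\<lambda>N. bin2_mean N (\<lambda>n. ecis (P n + g (real n)))) \<longlonglongrightarrow> 0"
proof (rule bin2_mean_tendsto_0)
  fix \<epsilon> T :: real assume "\<epsilon> > 0" "T > 0"
  define q where "q = 2 * Q"
  have q: "q > 0" using \<open>Q > 0\<close> by (simp add: q_def)
  define w where "w = (deriv ^^ d) g"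
  have w: "w \<in> F" unfolding w_def by (rule iter_deriv[OF g])
  obtain X where X: "\<And>m t. m < d \<Longrightarrow> t \<ge> X \<Longrightarrow>
    ((deriv ^^ m) g has_real_derivative (deriv ^^ Suc m) g t) (at t)"
    using iter_deriv_eventually[OF g] by blast
  obtain e where e: "d = Suc e" using \<open>d > 0\<close> by (cases d) auto
  obtain K \<delta> where K: "K > 0" and \<delta>: "\<delta> > 0" and weyl:
    "\<And>c L f. K \<le> \<bar>c\<bar> * real L ^ d \<Longrightarrow> \<bar>c\<bar> * real L ^ e \<le> \<delta> \<Longrightarrow> poly_seq d c f \<Longrightarrow>
      norm (\<Sum>j<L. ecis (f j)) \<le> \<epsilon> / 2 * real L"
    using weyl_small_leading_coeff[of "\<epsilon> / 2" e] \<open>\<epsilon> > 0\<close> unfolding e by force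
  \<comment> \<open>The length chosen below satisfies abs c L^d <= 2^d K, so a relative error \<eta>
    in \<open>w\<close> costs at most \<epsilon>/2 per term.\<close>
  define \<eta> where "\<eta> = \<epsilon> / (4 * pi * (2 ^ d * K))"
  have \<eta>: "\<eta> > 0" "2 * pi * (\<eta> * (2 ^ d * K)) = \<epsilon> / 2"
    using \<open>\<epsilon> > 0\<close> K by (auto simp: \<eta>_def)
  obtain \<delta>' where \<delta>': "\<delta>' > 0"
    "eventually (\<lambda>x. \<forall>y. \<bar>y - x\<bar> \<le> \<delta>' * x \<longrightarrow> \<bar>w y - w x\<bar> \<le> \<eta> * \<bar>w x\<bar>) at_top"
    using slowly_varying[OF w lim0[folded w_def] lim[folded w_def] \<eta>(1)] by blast
  \<comment> \<open>A length L >= R makes abs c L^(d-1), as abs c L^d divided by L, at most 2^d K /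
    R <= \<delta>; and R >= 1 ensures that rounding up at most doubles the length.\<close>
  define R where "R = max 1 (2 ^ d * K / \<delta>)"
  have R: "R \<ge> 1" "2 ^ d * K / \<delta> \<le> R" by (auto simp: R_def)
  have pos: "K / (real q ^ d * R ^ d) > 0"
    using K q R by auto
  have "eventually (\<lambda>x. \<bar>w x\<bar> < K / (real q ^ d * R ^ d)) at_top"
    using order_tendstoD(2)[OF tendsto_rabs[OF lim0]] pos by (simp add: w_def)
  then have ev1: "eventually (\<lambda>N. \<bar>w (real N)\<bar> < K / (real q ^ d * R ^ d)) sequentially"
    by (rule eventually_sequentially_real)
  have "eventually (\<lambda>x. \<bar>w x\<bar> * sqrt x ^ d > K / (real q ^ d * (\<epsilon> / 2) ^ d)) at_top"
    using lim by (simp add: w_def filterlim_at_top_dense)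
  then have ev2: "eventually (\<lambda>N. \<bar>w (real N)\<bar> * sqrt (real N) ^ d > K / (real q ^ d * (\<epsilon> / 2) ^ d)) sequentially"
    by (rule eventually_sequentially_real)
  \<comment> \<open>Starting within T sqrt N + 1 of \<open>N\<close> and running through q L <= q
    \<epsilon> sqrt N further integers stays inside this larger window.\<close>
  have ev3: "eventually (\<lambda>N. (T + real q * \<epsilon>) * sqrt (real N) + 1 \<le> \<delta>' * real N) sequentially"
    using \<open>T > 0\<close> \<open>\<epsilon> > 0\<close> \<delta>' by (intro eventually_window_small) auto
  have ev4: "eventually (\<lambda>N. \<forall>t. \<bar>t - real N\<bar> \<le> T * sqrt (real N) + 1 \<longrightarrow> X \<le> t) sequentially"
    using \<open>T > 0\<close> by (intro eventually_window_ge) auto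
  show "eventually (\<lambda>N. \<exists>L. 1 \<le> L \<and> real L \<le> \<epsilon> * sqrt (real N) \<and>
      (\<forall>n. \<bar>real n - real N\<bar> \<le> T * sqrt (real N) + 1 \<longrightarrow>
        norm (\<Sum>j<L. ecis (P (n + 2 * Q * j) + g (real (n + 2 * Q * j)))) \<le> \<epsilon> * real L)) sequentially"
    using ev1 ev2 ev3 ev4 eventually_sequentially_real[OF \<delta>'(2)]
  proof eventually_elim
    case (elim N)
    define c where "c = w (real N) * real q ^ d"
    have "K / (real q ^ d * (\<epsilon> / 2) ^ d) > 0" using K q \<open>\<epsilon> > 0\<close> by auto
    then have "w (real N) \<noteq> 0" using elim(2) \<open>d > 0\<close> by auto
    then have c: "\<bar>c\<bar> > 0" using q by (simp add: c_def)
    \<comment> \<open>The shortest real length that meets the lower condition of the Weyl bound with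
      equality.\<close>
    define r where "r = root d (K / \<bar>c\<bar>)"
    have r0: "r \<ge> 0" using K c by (simp add: r_def real_root_ge_zero)
    have rd: "r ^ d = K / \<bar>c\<bar>"
      unfolding r_def using K c \<open>d > 0\<close> by (intro real_root_pow_pos2) auto
    have "R ^ d \<le> r ^ d"
      unfolding rd using elim(1) c K q R by (simp add: c_def abs_mult field_simps)
    then have r: "R \<le> r" using r0 R \<open>d > 0\<close> by (simp add: power_mono_iff)
    have "r ^ d \<le> (\<epsilon> / 2 * sqrt (real N)) ^ d"
      unfolding rd power_mult_distrib using elim(2) c K q \<open>\<epsilon> > 0\<close>
      by (simp add: c_def abs_mult field_simps)
    then have r_le: "r \<le> \<epsilon> / 2 * sqrt (real N)"
      using r0 \<open>\<epsilon> > 0\<close> \<open>d > 0\<close> by (subst (asm) power_mono_iff) auto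
    define L where "L = nat \<lceil>r\<rceil>"
    have L: "real L \<ge> r" "real L \<le> 2 * r" "1 \<le> L"
      using r R(1) unfolding L_def by linarith+
    have L_le: "real L \<le> \<epsilon> * sqrt (real N)" using L r_le by simp
    have cL: "\<bar>c\<bar> * real L ^ d \<ge> K"
    proof -
      have "K = \<bar>c\<bar> * r ^ d" using c by (simp add: rd)
      also have "\<dots> \<le> \<bar>c\<bar> * real L ^ d" using L r0 by (intro mult_left_mono power_mono) auto
      finally show ?thesis .
    qed
    have cL': "\<bar>c\<bar> * real L ^ d \<le> 2 ^ d * K"
    proof -
      have "\<bar>c\<bar> * real L ^ d \<le> \<bar>c\<bar> * (2 * r) ^ d" using L r0 by (intro mult_left_mono power_mono) auto
      also have "\<dots> = 2 ^ d * K" using c by (simp add: power_mult_distrib rd)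
      finally show ?thesis .
    qed
    have cL\<delta>: "\<bar>c\<bar> * real L ^ e \<le> \<delta>"
    proof -
      have "(\<bar>c\<bar> * real L ^ e) * real L \<le> 2 ^ d * K" using cL' by (simp add: e ac_simps)
      also have "\<dots> \<le> \<delta> * R" using R(2) \<delta> by (simp add: field_simps)
      also have "\<dots> \<le> \<delta> * real L" using r L \<delta> by (intro mult_left_mono) auto
      finally show ?thesis using L by simp
    qed
    have "norm (\<Sum>j<L. ecis (g (real n + real (q * j)))) \<le> \<epsilon> * real L"
      if n: "\<bar>real n - real N\<bar> \<le> T * sqrt (real N) + 1" for n
    proof -
      have close: "\<bar>w t - w (real N)\<bar> \<le> \<eta> * \<bar>w (real N)\<bar>"
        if "real n \<le> t" "t \<le> real n + real (q * L)" for t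
      proof -
        have "real (q * L) \<le> real q * (\<epsilon> * sqrt (real N))"
          unfolding of_nat_mult using L_le by (intro mult_left_mono) auto
        then have "\<bar>t - real N\<bar> \<le> (T + real q * \<epsilon>) * sqrt (real N) + 1"
          using that n by (simp add: algebra_simps)
        then show ?thesis using elim(3,5) by force
      qed
      have nX: "real n \<ge> X" using elim(4) n by blast
      have "norm (\<Sum>j<L. ecis ((deriv ^^ 0) g (real n + real (q * j)))) \<le>
          \<epsilon> / 2 * real L + real L * (2 * pi * (\<eta> * \<bar>w (real N)\<bar> * real (q * L) ^ d))"
      proof (rule taylor_exponential_sum[OF \<open>d > 0\<close> q])
        show "norm (\<Sum>j<L. ecis (f j)) \<le> \<epsilon> / 2 * real L"
          if "poly_seq d (w (real N) * real q ^ d) f" for f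
          using weyl[OF cL cL\<delta>] that by (simp add: c_def)
      qed (use X nX close in \<open>auto simp: w_def\<close>)
      also have "\<eta> * \<bar>w (real N)\<bar> * real (q * L) ^ d = \<eta> * (\<bar>c\<bar> * real L ^ d)"
        by (simp add: c_def abs_mult power_mult_distrib)
      also have "2 * pi * \<dots> \<le> 2 * pi * (\<eta> * (2 ^ d * K))"
        using cL' \<eta> by (intro mult_left_mono) auto
      also have "\<dots> = \<epsilon> / 2" by (rule \<eta>(2))
      finally have "norm (\<Sum>j<L. ecis (g (real n + real (q * j)))) \<le> \<epsilon> / 2 * real L + real L * (\<epsilon> / 2)"
        by (simp add: mult_left_mono)
      then show ?thesis by (simp add: algebra_simps)
    qed
    then show ?case
      unfolding ecis_periodic_sum[OF P] using L L_le by (intro exI[of _ L]) (auto simp: q_def)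
  qed
qed simp

end

section \<open>Lower bounds by the simple random walk\<close>

lemma one_minus_power_ge:
  assumes "0 \<le> A" "2 * A \<le> real N" "n \<le> N"
  shows "exp (- 2 * A) \<le> (1 - A / real N) ^ n"
proof (cases "N = 0")
  case False
  define u where "u = A / real N"
  have u: "0 \<le> u" "u \<le> 1 / 2" using assms False by (auto simp: u_def field_simps)
  have "u\<^sup>2 \<le> u / 2"
    using mult_left_mono[OF u(2) u(1)] by (simp add: power2_eq_square)
  then have "- 2 * u \<le> ln (1 - u)"
    using ln_one_minus_pos_lower_bound[OF u] by linarith
  then have "exp (- 2 * u) \<le> 1 - u"
    using u by (subst (asm) ln_ge_iff) auto
  then have "exp (- 2 * u) ^ N \<le> (1 - u) ^ N"
    by (rule power_mono) simp
  also have "exp (- 2 * u) ^ N = exp (- 2 * A)"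
    using False by (simp add: u_def flip: exp_of_nat_mult)
  also have "(1 - u) ^ N \<le> (1 - u) ^ n"
    using u assms by (intro power_decreasing) auto
  finally show ?thesis by (simp add: u_def)
qed (use assms in auto)

lemma cos_ge_one_minus: "cos x \<ge> 1 - x\<^sup>2 / 2" for x :: real
proof -
  have "cos x = 1 - 2 * (sin (x / 2))\<^sup>2"
    using cos_double_sin[of "x / 2"] by simp
  moreover have "\<bar>sin (x / 2)\<bar>\<^sup>2 \<le> \<bar>x / 2\<bar>\<^sup>2"
    by (intro power_mono abs_sin_x_le_abs_x) auto
  ultimately show ?thesis by (simp add: power_divide)
qed

text \<open>The mean of \<open>G\<close> over the position after \<open>N\<close> steps of the simple random walk.\<close>

definition walk_mean :: "nat \<Rightarrow> (int \<Rightarrow> 'a::real_vector) \<Rightarrow> 'a" where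
  "walk_mean N G = bmean N (\<lambda>m. G (2 * int m - int N))"

lemma walk_mean_0 [simp]: "walk_mean 0 G = G 0"
  by (simp add: walk_mean_def)

lemma walk_mean_Suc:
  "walk_mean (Suc N) G = (1 / 2) *\<^sub>R (walk_mean N (\<lambda>s. G (s - 1)) + walk_mean N (\<lambda>s. G (s + 1)))"
  unfolding walk_mean_def bmean_Suc
  by (intro arg_cong2[where f = "(*\<^sub>R)"] arg_cong2[where f = "(+)"] bmean_cong arg_cong[where f = G] refl) auto

lemma walk_mean_add: "walk_mean N (\<lambda>s. G s + H s) = walk_mean N G + walk_mean N H"
  by (simp add: walk_mean_def bmean_add)

lemma walk_mean_scaleR: "walk_mean N (\<lambda>s. r *\<^sub>R G s) = r *\<^sub>R walk_mean N G"
  by (simp add: walk_mean_def bmean_scaleR)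

lemma walk_mean_mult_left: "walk_mean N (\<lambda>s. z * G s) = z * walk_mean N (G :: int \<Rightarrow> 'a :: real_algebra)"
  by (simp add: walk_mean_def bmean_mult_left)

lemma walk_mean_mult_right: "walk_mean N (\<lambda>s. G s * z) = walk_mean N (G :: int \<Rightarrow> 'a :: real_algebra) * z"
  by (simp add: walk_mean_def bmean_mult_right)

lemma walk_mean_const [simp]: "walk_mean N (\<lambda>_. c) = c"
  by (simp add: walk_mean_def)

lemma walk_mean_cnj: "walk_mean N (\<lambda>s. cnj (G s)) = cnj (walk_mean N G)"
  by (simp add: walk_mean_def bmean_def)

lemma walk_mean_of_real: "walk_mean N (\<lambda>s. complex_of_real (G s)) = of_real (walk_mean N G)"
  by (simp add: walk_mean_def bmean_def scaleR_conv_of_real)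

lemma walk_mean_mono:
  "(\<And>s. G s \<le> H s) \<Longrightarrow> walk_mean N G \<le> (walk_mean N H :: real)"
  unfolding walk_mean_def by (intro bmean_mono)

lemma walk_mean_square: "walk_mean N (\<lambda>s. (real_of_int s)\<^sup>2) = real N"
  using bmean_square[of N 0] by (simp add: walk_mean_def)

lemma walk_mean_cis: "walk_mean N (\<lambda>s. cis (\<theta> * real_of_int s)) = of_real (cos \<theta>) ^ N"
proof (induction N)
  case (Suc N)
  have "cis (\<theta> * real_of_int (s - 1)) = cis (- \<theta>) * cis (\<theta> * real_of_int s)"
    "cis (\<theta> * real_of_int (s + 1)) = cis \<theta> * cis (\<theta> * real_of_int s)" for s
    by (simp_all add: cis_mult algebra_simps)
  then have "walk_mean (Suc N) (\<lambda>s. cis (\<theta> * real_of_int s)) =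
      (1 / 2) *\<^sub>R ((cis (- \<theta>) + cis \<theta>) * of_real (cos \<theta>) ^ N)"
    unfolding walk_mean_Suc by (simp add: walk_mean_mult_left Suc.IH distrib_right)
  also have "cis (- \<theta>) + cis \<theta> = 2 * of_real (cos \<theta>)"
    by (simp add: complex_eq_iff)
  finally show ?case by (simp add: scaleR_conv_of_real)
qed simp

text \<open>For two independent walks, \<open>(s + t) / 2\<close> and \<open>(s - t) / 2\<close> are themselves independent walks
  once it is known at which \<open>j\<close> times the two walks take equal steps.\<close>

lemma walk_mean_rotate:
  "walk_mean N (\<lambda>s. walk_mean N (\<lambda>t. K (s + t) (s - t))) =
   bmean N (\<lambda>j. walk_mean j (\<lambda>a. walk_mean (N - j) (\<lambda>b. K (2 * a) (2 * b))))"
proof (induction N arbitrary: K)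
  case (Suc N)
  define \<Phi> where "\<Phi> K = walk_mean N (\<lambda>s. walk_mean N (\<lambda>t. K (s + t) (s - t)))" for K :: "int \<Rightarrow> int \<Rightarrow> 'a"
  define X where "X K j l = walk_mean j (\<lambda>a. walk_mean l (\<lambda>b. K (2 * a) (2 * b)))"
    for K :: "int \<Rightarrow> int \<Rightarrow> 'a" and j l
  have IH: "\<Phi> K = bmean N (\<lambda>j. X K j (N - j))" for K
    unfolding \<Phi>_def X_def by (rule Suc.IH)
  have arith: "s - 1 + (t - 1) = s + t - 2" "s - 1 - (t - 1) = s - t" "s - 1 + (t + 1) = s + t"
    "s - 1 - (t + 1) = s - t - 2" "s + 1 + (t - 1) = s + t" "s + 1 - (t - 1) = s - t + 2"
    "s + 1 + (t + 1) = s + t + 2" "s + 1 - (t + 1) = s - t" for s t :: int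
    by auto
  have "walk_mean (Suc N) (\<lambda>s. walk_mean (Suc N) (\<lambda>t. K (s + t) (s - t))) =
    (1 / 2) *\<^sub>R ((1 / 2) *\<^sub>R (\<Phi> (\<lambda>u v. K (u - 2) v) + \<Phi> (\<lambda>u v. K u (v + 2))) +
      (1 / 2) *\<^sub>R (\<Phi> (\<lambda>u v. K u (v - 2)) + \<Phi> (\<lambda>u v. K (u + 2) v)))"
    unfolding walk_mean_Suc arith walk_mean_scaleR walk_mean_add \<Phi>_def ..
  \<comment> \<open>The four combinations of steps are regrouped: opposite steps move only s - t,
    equal steps move only s + t, each by 2 in either direction. The two groups are the two halves of
    Pascal's recursion for the number \<open>j\<close> of equal steps.\<close>
  also have "\<dots> = (1 / 2) *\<^sub>R ((1 / 2) *\<^sub>R (\<Phi> (\<lambda>u v. K u (v - 2)) + \<Phi> (\<lambda>u v. K u (v + 2))) +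
      (1 / 2) *\<^sub>R (\<Phi> (\<lambda>u v. K (u - 2) v) + \<Phi> (\<lambda>u v. K (u + 2) v)))"
    by (simp add: scaleR_right_distrib ac_simps)
  also have "(1 / 2) *\<^sub>R (\<Phi> (\<lambda>u v. K u (v - 2)) + \<Phi> (\<lambda>u v. K u (v + 2))) =
      bmean N (\<lambda>j. X K j (Suc (N - j)))"
  proof -
    have "X K j (Suc l) = (1 / 2) *\<^sub>R (X (\<lambda>u v. K u (v - 2)) j l + X (\<lambda>u v. K u (v + 2)) j l)" for j l
      unfolding X_def walk_mean_Suc walk_mean_scaleR walk_mean_add
      by (simp add: algebra_simps)
    then show ?thesis by (simp add: IH bmean_add bmean_scaleR scaleR_right_distrib)
  qed
  also have "(1 / 2) *\<^sub>R (\<Phi> (\<lambda>u v. K (u - 2) v) + \<Phi> (\<lambda>u v. K (u + 2) v)) =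
      bmean N (\<lambda>j. X K (Suc j) (N - j))"
  proof -
    have "X K (Suc j) l = (1 / 2) *\<^sub>R (X (\<lambda>u v. K (u - 2) v) j l + X (\<lambda>u v. K (u + 2) v) j l)" for j l
      unfolding X_def walk_mean_Suc
      by (simp add: algebra_simps)
    then show ?thesis by (simp add: IH bmean_add bmean_scaleR scaleR_right_distrib)
  qed
  also have "(1 / 2) *\<^sub>R (bmean N (\<lambda>j. X K j (Suc (N - j))) + bmean N (\<lambda>j. X K (Suc j) (N - j))) =
      bmean (Suc N) (\<lambda>j. X K j (Suc N - j))"
    unfolding bmean_Suc by (simp add: Suc_diff_le cong: bmean_cong)
  finally show ?case by (simp add: X_def)
qed simp

text \<open>The squared modulus is a mean of e(s^2 - t^2) over two walks, and s^2 - t^2 factors as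
  (s + t)(s - t). After the rotation the phase is bilinear, 4 \<theta> a b, and averaging over
  \<open>b\<close> gives a power of a cosine.\<close>

lemma norm_walk_mean_quadratic:
  "complex_of_real ((norm (walk_mean N (\<lambda>s. cis (\<theta> * (real_of_int s)\<^sup>2))))\<^sup>2) =
   of_real (bmean N (\<lambda>j. walk_mean j (\<lambda>a. cos (4 * \<theta> * real_of_int a) ^ (N - j))))"
proof -
  define K where "K u v = cis (\<theta> * real_of_int (u * v))" for u v
  have "complex_of_real ((norm (walk_mean N (\<lambda>s. cis (\<theta> * (real_of_int s)\<^sup>2))))\<^sup>2) =
    walk_mean N (\<lambda>s. cis (\<theta> * (real_of_int s)\<^sup>2)) * walk_mean N (\<lambda>t. cnj (cis (\<theta> * (real_of_int t)\<^sup>2)))"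
    by (simp add: complex_norm_square walk_mean_cnj del: of_real_power)
  also have "\<dots> = walk_mean N (\<lambda>s. walk_mean N (\<lambda>t. cis (\<theta> * (real_of_int s)\<^sup>2) * cnj (cis (\<theta> * (real_of_int t)\<^sup>2))))"
    by (simp only: walk_mean_mult_left walk_mean_mult_right)
  also have "\<dots> = walk_mean N (\<lambda>s. walk_mean N (\<lambda>t. K (s + t) (s - t)))"
    by (simp add: K_def cis_cnj cis_mult power2_eq_square algebra_simps)
  also have "\<dots> = bmean N (\<lambda>j. walk_mean j (\<lambda>a. walk_mean (N - j) (\<lambda>b. K (2 * a) (2 * b))))"
    by (rule walk_mean_rotate)
  also have "\<dots> = bmean N (\<lambda>j. walk_mean j (\<lambda>a. walk_mean (N - j) (\<lambda>b. cis ((4 * \<theta> * real_of_int a) * real_of_int b))))"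
    by (simp add: K_def ac_simps)
  also have "\<dots> = bmean N (\<lambda>j. complex_of_real (walk_mean j (\<lambda>a. cos (4 * \<theta> * real_of_int a) ^ (N - j))))"
    by (simp only: walk_mean_cis of_real_power[symmetric] walk_mean_of_real)
  also have "\<dots> = of_real (bmean N (\<lambda>j. walk_mean j (\<lambda>a. cos (4 * \<theta> * real_of_int a) ^ (N - j))))"
    by (simp add: bmean_def scaleR_conv_of_real)
  finally show ?thesis .
qed

text \<open>For far positions \<open>a\<close> the cosine may be negative, so its power has no
  useful sign. A quadratic function of \<open>a\<close> that lies below it everywhere avoids
  splitting off the tail: its mean depends only on the variance, which is at most
  \<open>N\<close>.\<close>

lemma walk_mean_quadratic_ge:
  assumes "C > 0"
  shows "\<exists>c>0. eventually (\<lambda>N. \<forall>\<theta>. \<bar>4 * \<theta>\<bar> * real N \<le> C \<longrightarrow>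
    norm (walk_mean N (\<lambda>s. cis (\<theta> * (real_of_int s)\<^sup>2))) \<ge> c) sequentially"
proof -
  define \<kappa> where "\<kappa> = exp (- 2 * (2 * C\<^sup>2))"
  have \<kappa>: "\<kappa> > 0" "\<kappa> \<le> 1" using assms by (auto simp: \<kappa>_def)
  have "eventually (\<lambda>N. real N \<ge> max 1 (max (2 * (2 * C\<^sup>2)) (4 * C\<^sup>2 / \<kappa>))) sequentially"
    using filterlim_real_sequentially unfolding filterlim_at_top by blast
  then have "eventually (\<lambda>N. \<forall>\<theta>. \<bar>4 * \<theta>\<bar> * real N \<le> C \<longrightarrow>
    norm (walk_mean N (\<lambda>s. cis (\<theta> * (real_of_int s)\<^sup>2))) \<ge> sqrt (\<kappa> / 2)) sequentially"
  proof (eventually_elim, intro allI impI)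
    fix N \<theta> assume "real N \<ge> max 1 (max (2 * (2 * C\<^sup>2)) (4 * C\<^sup>2 / \<kappa>))"
    then have N: "real N \<ge> 1" "2 * (2 * C\<^sup>2) \<le> real N" "4 * C\<^sup>2 / \<kappa> \<le> real N" by auto
    assume \<theta>: "\<bar>4 * \<theta>\<bar> * real N \<le> C"
    have Npos: "real N > 0" using N by simp
    \<comment> \<open>For x^2 <= 4N the angle is at most 2C / sqrt N, and the power stays above
      \<kappa>. Beyond that the first term is nonpositive, and a negative cosine forces the squared
      angle above 1, so that the second term alone brings the left side to -1 or less.\<close>
    have pt: "\<kappa> * (1 - x\<^sup>2 / (4 * real N)) - C\<^sup>2 * x\<^sup>2 / (real N)\<^sup>2 \<le> cos (4 * \<theta> * x) ^ n" if "n \<le> N" for n x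
    proof -
      have "\<bar>4 * \<theta> * x\<bar> * real N \<le> C * \<bar>x\<bar>"
        using mult_right_mono[OF \<theta>, of "\<bar>x\<bar>"] by (simp add: abs_mult ac_simps)
      then have "\<bar>4 * \<theta> * x\<bar> \<le> C * \<bar>x\<bar> / real N" using Npos by (simp add: field_simps)
      then have "\<bar>4 * \<theta> * x\<bar>\<^sup>2 \<le> (C * \<bar>x\<bar> / real N)\<^sup>2" by (intro power_mono) auto
      then have sq: "(4 * \<theta> * x)\<^sup>2 \<le> C\<^sup>2 * x\<^sup>2 / (real N)\<^sup>2"
        by (simp add: power_mult_distrib power_divide)
      have nn: "C\<^sup>2 * x\<^sup>2 / (real N)\<^sup>2 \<ge> 0" by simp
      show ?thesis
      proof (cases "x\<^sup>2 \<le> 4 * real N")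
        case True
        have "C\<^sup>2 * x\<^sup>2 / (real N)\<^sup>2 \<le> C\<^sup>2 * (4 * real N) / (real N)\<^sup>2"
          using True by (intro divide_right_mono mult_left_mono) auto
        also have "\<dots> = 2 * (2 * C\<^sup>2 / real N)" using Npos by (simp add: power2_eq_square)
        finally have "1 - 2 * C\<^sup>2 / real N \<le> cos (4 * \<theta> * x)"
          using cos_ge_one_minus[of "4 * \<theta> * x"] sq by linarith
        moreover have "0 \<le> 1 - 2 * C\<^sup>2 / real N"
          using N Npos by (simp add: field_simps)
        ultimately have "(1 - 2 * C\<^sup>2 / real N) ^ n \<le> cos (4 * \<theta> * x) ^ n"
          by (rule power_mono)
        moreover have "\<kappa> \<le> (1 - 2 * C\<^sup>2 / real N) ^ n"
          unfolding \<kappa>_def by (rule one_minus_power_ge) (use N that in auto)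
        moreover have "\<kappa> * (1 - x\<^sup>2 / (4 * real N)) \<le> \<kappa> * 1"
          using \<kappa> Npos by (intro mult_left_mono) auto
        ultimately show ?thesis using nn by linarith
      next
        case False
        then have neg: "\<kappa> * (1 - x\<^sup>2 / (4 * real N)) \<le> 0"
          using \<kappa> Npos by (intro mult_nonneg_nonpos) (auto simp: field_simps)
        show ?thesis
        proof (cases "cos (4 * \<theta> * x) \<ge> 0")
          case True
          then have "0 \<le> cos (4 * \<theta> * x) ^ n" by simp
          then show ?thesis using neg nn by linarith
        next
          case False
          then have "(4 * \<theta> * x)\<^sup>2 \<ge> 1" using cos_ge_one_minus[of "4 * \<theta> * x"] by linarith
          then have "C\<^sup>2 * x\<^sup>2 / (real N)\<^sup>2 \<ge> 1" using sq by linarith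
          moreover have "\<bar>cos (4 * \<theta> * x) ^ n\<bar> \<le> 1"
            unfolding power_abs by (intro power_le_one) auto
          ultimately show ?thesis using neg by linarith
        qed
      qed
    qed
    have inner: "\<kappa> / 2 \<le> walk_mean j (\<lambda>a. cos (4 * \<theta> * real_of_int a) ^ (N - j))" if "j \<le> N" for j
    proof -
      have "real j / (4 * real N) \<le> 1 / 4" using that Npos by (simp add: field_simps)
      then have "\<kappa> * (real j / (4 * real N)) \<le> \<kappa> * (1 / 4)" using \<kappa> by (intro mult_left_mono) auto
      moreover have "C\<^sup>2 * real j / (real N)\<^sup>2 \<le> \<kappa> / 4"
      proof -
        have "C\<^sup>2 * real j / (real N)\<^sup>2 \<le> C\<^sup>2 * real N / (real N)\<^sup>2"
          using that by (intro divide_right_mono mult_left_mono) auto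
        also have "\<dots> \<le> \<kappa> / 4" using N(3) Npos \<kappa> by (simp add: power2_eq_square field_simps)
        finally show ?thesis .
      qed
      ultimately have "\<kappa> / 2 \<le> \<kappa> - \<kappa> * (real j / (4 * real N)) - C\<^sup>2 * real j / (real N)\<^sup>2" by linarith
      also have "\<dots> = walk_mean j (\<lambda>a. \<kappa> + (- \<kappa> / (4 * real N) - C\<^sup>2 / (real N)\<^sup>2) * (real_of_int a)\<^sup>2)"
        unfolding walk_mean_add walk_mean_mult_left walk_mean_square walk_mean_const
        by (simp add: algebra_simps)
      also have "\<dots> \<le> walk_mean j (\<lambda>a. cos (4 * \<theta> * real_of_int a) ^ (N - j))"
      proof (rule walk_mean_mono)
        fix a
        show "\<kappa> + (- \<kappa> / (4 * real N) - C\<^sup>2 / (real N)\<^sup>2) * (real_of_int a)\<^sup>2 \<le>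
            cos (4 * \<theta> * real_of_int a) ^ (N - j)"
          using pt[of "N - j" "real_of_int a"] by (simp add: algebra_simps)
      qed
      finally show ?thesis .
    qed
    have "\<kappa> / 2 = bmean N (\<lambda>_. \<kappa> / 2)" by simp
    also have "\<dots> \<le> bmean N (\<lambda>j. walk_mean j (\<lambda>a. cos (4 * \<theta> * real_of_int a) ^ (N - j)))"
      by (intro bmean_mono inner)
    also have "\<dots> = (norm (walk_mean N (\<lambda>s. cis (\<theta> * (real_of_int s)\<^sup>2))))\<^sup>2"
      using norm_walk_mean_quadratic[of N \<theta>] of_real_eq_iff by metis
    finally show "sqrt (\<kappa> / 2) \<le> norm (walk_mean N (\<lambda>s. cis (\<theta> * (real_of_int s)\<^sup>2)))"
      by (intro real_le_lsqrt) auto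
  qed
  then show ?thesis using \<kappa> by (intro exI[of _ "sqrt (\<kappa> / 2)"]) auto
qed

lemma walk_mean_linear_ge:
  assumes "C > 0"
  shows "\<exists>c>0. eventually (\<lambda>N. \<forall>\<theta>. \<bar>\<theta>\<bar> * sqrt (real N) \<le> C \<longrightarrow>
    norm (walk_mean N (\<lambda>s. cis (\<theta> * real_of_int s))) \<ge> c) sequentially"
proof -
  have "eventually (\<lambda>N. real N \<ge> max 1 (2 * (C\<^sup>2 / 2))) sequentially"
    using filterlim_real_sequentially unfolding filterlim_at_top by blast
  then have "eventually (\<lambda>N. \<forall>\<theta>. \<bar>\<theta>\<bar> * sqrt (real N) \<le> C \<longrightarrow>
    norm (walk_mean N (\<lambda>s. cis (\<theta> * real_of_int s))) \<ge> exp (- 2 * (C\<^sup>2 / 2))) sequentially"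
  proof (eventually_elim, intro allI impI)
    fix N \<theta> assume N: "real N \<ge> max 1 (2 * (C\<^sup>2 / 2))" and \<theta>: "\<bar>\<theta>\<bar> * sqrt (real N) \<le> C"
    have Npos: "real N > 0" using N by simp
    have "(\<bar>\<theta>\<bar> * sqrt (real N))\<^sup>2 \<le> C\<^sup>2" using \<theta> by (intro power_mono) auto
    then have "\<theta>\<^sup>2 / 2 \<le> C\<^sup>2 / 2 / real N" using Npos by (simp add: power_mult_distrib field_simps)
    then have *: "1 - C\<^sup>2 / 2 / real N \<le> cos \<theta>"
      using cos_ge_one_minus[of \<theta>] by linarith
    have "0 \<le> 1 - C\<^sup>2 / 2 / real N" using N Npos by (simp add: field_simps)
    with * have "(1 - C\<^sup>2 / 2 / real N) ^ N \<le> \<bar>cos \<theta>\<bar> ^ N"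
      by (intro power_mono) auto
    moreover have "exp (- 2 * (C\<^sup>2 / 2)) \<le> (1 - C\<^sup>2 / 2 / real N) ^ N"
      by (rule one_minus_power_ge) (use N in auto)
    ultimately show "exp (- 2 * (C\<^sup>2 / 2)) \<le> norm (walk_mean N (\<lambda>s. cis (\<theta> * real_of_int s)))"
      unfolding walk_mean_cis by (simp add: norm_power)
  qed
  then show ?thesis by (intro exI[of _ "exp (- 2 * (C\<^sup>2 / 2))"]) auto
qed

text \<open>One function \<phi> of the walk position serves both n = 2m and n = 2m + 1, so the two
  parity means cannot cancel each other. The lower bound \<open>c\<close> is kept apart from
  \<epsilon> and \<open>T\<close>, which are later chosen in terms of it.\<close>

definition walk_approx :: "real \<Rightarrow> real \<Rightarrow> real \<Rightarrow> (nat \<Rightarrow> complex) \<Rightarrow> nat \<Rightarrow> bool" where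
  "walk_approx c \<epsilon> T a N \<longleftrightarrow> (\<exists>\<phi>. (\<forall>s. norm (\<phi> s) \<le> 1) \<and> norm (walk_mean N \<phi>) \<ge> c \<and>
    (\<forall>m d. d \<le> 1 \<longrightarrow> \<bar>2 * real m - real N\<bar> \<le> T * sqrt (real N) \<longrightarrow>
      norm (a (2 * m + d) - \<phi> (2 * int m - int N)) \<le> \<epsilon>))"

lemma bin2_mean_not_tendsto_0:
  assumes a: "\<And>n. norm (a n) \<le> 1" and "c > 0"
    and approx: "\<And>\<epsilon> T. \<epsilon> > 0 \<Longrightarrow> T > 0 \<Longrightarrow> frequently (walk_approx c \<epsilon> T a) sequentially"
  shows "\<not> (\<lambda>N. bin2_mean N a) \<longlonglongrightarrow> 0"
proof
  assume lim: "(\<lambda>N. bin2_mean N a) \<longlonglongrightarrow> 0"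
  \<comment> \<open>The two functions differ by at most 2 in the tail, so this \<open>T\<close>
    gives a tail error of c/8. Approximation error, boundary terms and the supposedly small mean
    then add up to at most 3c/4.\<close>
  define T where "T = 4 / sqrt c"
  have T: "T > 0" "2 / T\<^sup>2 = c / 8" using \<open>c > 0\<close> by (auto simp: T_def power_divide)
  have "eventually (\<lambda>N. dist (bin2_mean N a) 0 < c / 4) sequentially"
    using lim \<open>c > 0\<close> by (intro tendstoD) auto
  moreover have "eventually (\<lambda>N. (1 / 2) ^ N < c / 4) sequentially"
    using \<open>c > 0\<close> by (intro order_tendstoD(2)[OF LIMSEQ_power_zero]) auto
  ultimately have "eventually (\<lambda>N. norm (bin2_mean N a) < c / 4 \<and> (1 / 2) ^ N < c / 4) sequentially"
    by eventually_elim simp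
  moreover have "c / 8 > 0" using \<open>c > 0\<close> by simp
  ultimately have "frequently (\<lambda>N. walk_approx c (c / 8) T a N \<and>
      norm (bin2_mean N a) < c / 4 \<and> (1 / 2) ^ N < c / 4) sequentially"
    using frequently_eventually_frequently[OF approx[OF _ T(1)]] by blast
  then obtain N \<phi> where \<phi>: "\<And>s. norm (\<phi> s) \<le> 1" "norm (walk_mean N \<phi>) \<ge> c"
    and close: "\<And>m d. d \<le> 1 \<Longrightarrow> \<bar>2 * real m - real N\<bar> \<le> T * sqrt (real N) \<Longrightarrow>
        norm (a (2 * m + d) - \<phi> (2 * int m - int N)) \<le> c / 8"
    and small: "norm (bin2_mean N a) < c / 4" "(1 / 2) ^ N < c / 4"
    unfolding walk_approx_def using frequently_ex by blast
  have *: "norm (bmean N (\<lambda>m. a (2 * m + d)) - walk_mean N \<phi>) \<le> c / 4" if "d \<le> 1" for d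
  proof -
    have "norm (bmean N (\<lambda>m. a (2 * m + d) - \<phi> (2 * int m - int N))) \<le> c / 8 + 2 / T\<^sup>2"
    proof (rule norm_bmean_le_near[OF T(1)])
      fix m
      show "norm (a (2 * m + d) - \<phi> (2 * int m - int N)) \<le> 2"
        using norm_triangle_le_diff[OF add_mono[OF a \<phi>(1)]] by simp
    qed (use close that \<open>c > 0\<close> in auto)
    then show ?thesis unfolding bmean_diff walk_mean_def T(2) by simp
  qed
  define A where "A = (1 / 2) *\<^sub>R (bmean N (\<lambda>m. a (2 * m)) + bmean N (\<lambda>m. a (2 * m + 1)))"
  have "A - walk_mean N \<phi> = (1 / 2) *\<^sub>R ((bmean N (\<lambda>m. a (2 * m)) - walk_mean N \<phi>) +
      (bmean N (\<lambda>m. a (2 * m + 1)) - walk_mean N \<phi>))"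
    by (simp add: A_def algebra_simps flip: scaleR_add_left)
  also have "norm \<dots> \<le> (1 / 2) * (c / 4 + c / 4)"
    unfolding norm_scaleR using *[of 0] *[of 1]
    by (intro mult_mono norm_triangle_mono) auto
  finally have 1: "norm (A - walk_mean N \<phi>) \<le> c / 4" by simp
  have 2: "norm (bin2_mean N a - A) \<le> (1 / 2) ^ N"
    using norm_bin2_mean_diff_le[OF a, of N] unfolding A_def by (simp add: power_divide)
  have "walk_mean N \<phi> = bin2_mean N a - (bin2_mean N a - A) - (A - walk_mean N \<phi>)" by simp
  also have "norm \<dots> \<le> norm (bin2_mean N a) + norm (bin2_mean N a - A) + norm (A - walk_mean N \<phi>)"
    by (intro order.trans[OF norm_triangle_ineq4] add_mono norm_triangle_ineq4 order.refl)
  also have "\<dots> < c" using 1 2 small \<open>c > 0\<close> by linarith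
  finally show False using \<phi>(2) by simp
qed

text \<open>Over the window the second derivative may be replaced by M/N: the error is o(1/N) and is
  multiplied by (t - N)^2 = O(N). For M = 0 the expansion is linear.\<close>

lemma second_order_expansion:
  fixes g g1 g2 :: "real \<Rightarrow> real"
  assumes g1: "eventually (\<lambda>x. (g has_real_derivative g1 x) (at x)) at_top"
    and g2: "eventually (\<lambda>x. (g1 has_real_derivative g2 x) (at x)) at_top"
    and lim: "((\<lambda>x. g2 x * x) \<longlongrightarrow> M) at_top" and "\<epsilon> > 0" "T \<ge> 0"
  shows "eventually (\<lambda>N. \<forall>t. \<bar>t - real N\<bar> \<le> T * sqrt (real N) + 1 \<longrightarrow>
    \<bar>g t - (g (real N) + g1 (real N) * (t - real N) + M / (2 * real N) * (t - real N)\<^sup>2)\<bar> \<le> \<epsilon>) sequentially"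
proof -
  \<comment> \<open>The second derivative will be off by at most 4 \<epsilon>'/N; half of that times
    (T+1)^2 N is \<epsilon>.\<close>
  define \<epsilon>' where "\<epsilon>' = \<epsilon> / (2 * (T + 1)\<^sup>2)"
  have \<epsilon>': "\<epsilon>' > 0" "\<epsilon>' * (2 * (T + 1)\<^sup>2) = \<epsilon>" using assms by (auto simp: \<epsilon>'_def)
  have "eventually (\<lambda>x. (g has_real_derivative g1 x) (at x) \<and> (g1 has_real_derivative g2 x) (at x) \<and>
      \<bar>g2 x * x - M\<bar> < \<epsilon>') at_top"
    using g1 g2 tendstoD[OF lim \<epsilon>'(1)] by eventually_elim (simp add: dist_real_def)
  then obtain X where X: "\<And>x. x \<ge> X \<Longrightarrow> (g has_real_derivative g1 x) (at x) \<and>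
      (g1 has_real_derivative g2 x) (at x) \<and> \<bar>g2 x * x - M\<bar> < \<epsilon>'"
    unfolding eventually_at_top_linorder by blast
  have "eventually (\<lambda>N. \<forall>t. \<bar>t - real N\<bar> \<le> T * sqrt (real N) + 1 \<longrightarrow> X \<le> t) sequentially"
    using \<open>T \<ge> 0\<close> by (rule eventually_window_ge)
  moreover have "eventually (\<lambda>N. T * sqrt (real N) + 1 \<le> (1 / 2) * real N) sequentially"
    using \<open>T \<ge> 0\<close> by (intro eventually_window_small) auto
  moreover have "eventually (\<lambda>N. T * sqrt (real N) + 1 \<le> (\<epsilon>' / (\<bar>M\<bar> + 1)) * real N) sequentially"
    using \<open>T \<ge> 0\<close> \<epsilon>' by (intro eventually_window_small) auto
  ultimately show ?thesis
    using eventually_ge_at_top[of 1]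
  proof (eventually_elim, intro allI impI)
    fix N t
    assume N: "\<forall>t. \<bar>t - real N\<bar> \<le> T * sqrt (real N) + 1 \<longrightarrow> X \<le> t"
      "T * sqrt (real N) + 1 \<le> (1 / 2) * real N"
      "T * sqrt (real N) + 1 \<le> (\<epsilon>' / (\<bar>M\<bar> + 1)) * real N" "1 \<le> N"
      and t: "\<bar>t - real N\<bar> \<le> T * sqrt (real N) + 1"
    define n where "n = real N"
    have n: "n \<ge> 1" "n > 0" using N by (auto simp: n_def)
    define D where "D k = (if k = 0 then g else if k = 1 then g1 else g2)" for k :: nat
    have D_simps: "D 0 = g" "D (Suc 0) = g1" "D 2 = g2" "D (Suc (Suc 0)) = g2" by (auto simp: D_def)
    show "\<bar>g t - (g (real N) + g1 (real N) * (t - real N) + M / (2 * real N) * (t - real N)\<^sup>2)\<bar> \<le> \<epsilon>"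
      unfolding n_def[symmetric]
    proof (cases "t = n")
      case False
      have "\<exists>z. (if t < n then t < z \<and> z < n else n < z \<and> z < t) \<and>
          g t = (\<Sum>m<2. D m n / fact m * (t - n) ^ m) + D 2 z / fact 2 * (t - n) ^ 2"
      proof (rule Taylor[where diff = D and a = "min t n" and b = "max t n"])
        show "\<forall>m s. m < 2 \<and> min t n \<le> s \<and> s \<le> max t n \<longrightarrow> (D m has_real_derivative D (Suc m) s) (at s)"
        proof (intro allI impI)
          fix m s assume ms: "m < (2::nat) \<and> min t n \<le> s \<and> s \<le> max t n"
          then have "\<bar>s - n\<bar> \<le> \<bar>t - n\<bar>" by (auto simp: min_def max_def split: if_splits)
          then have "X \<le> s" using N(1) t by (simp add: n_def)
          then show "(D m has_real_derivative D (Suc m) s) (at s)"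
            using X[of s] ms by (cases m) (auto simp: D_simps less_2_cases_iff)
        qed
      qed (use False D_simps in auto)
      then obtain z where z': "if t < n then t < z \<and> z < n else n < z \<and> z < t"
        and gt': "g t = (\<Sum>m<2. D m n / fact m * (t - n) ^ m) + D 2 z / fact 2 * (t - n) ^ 2"
        by blast
      have z: "\<bar>z - n\<bar> \<le> \<bar>t - n\<bar>" using z' by (auto split: if_splits)
      have "(\<Sum>m<2. D m n / fact m * (t - n) ^ m) = g n + g1 n * (t - n)"
        by (simp add: numeral_2_eq_2 D_simps)
      then have gt: "g t = g n + g1 n * (t - n) + g2 z / 2 * (t - n)\<^sup>2"
        using gt' by (simp add: D_simps)
      have zn: "\<bar>z - n\<bar> \<le> T * sqrt n + 1" using z t by (simp add: n_def)
      have zX: "X \<le> z" using N(1) zn by (simp add: n_def)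
      have z2: "z \<ge> n / 2" using zn N(2) by (simp add: n_def abs_le_iff)
      have "\<bar>(g2 z - M / n) * z\<bar> = \<bar>(g2 z * z - M) - M / n * (z - n)\<bar>"
        using n by (simp add: field_simps)
      also have "\<dots> \<le> \<bar>g2 z * z - M\<bar> + \<bar>M / n * (z - n)\<bar>" by (rule abs_triangle_ineq4)
      also have "\<bar>M / n * (z - n)\<bar> \<le> \<epsilon>'"
      proof -
        have "\<bar>z - n\<bar> \<le> \<epsilon>' / (\<bar>M\<bar> + 1) * n" using zn N(3) by (simp add: n_def)
        then have "\<bar>M\<bar> / n * \<bar>z - n\<bar> \<le> \<bar>M\<bar> / n * (\<epsilon>' / (\<bar>M\<bar> + 1) * n)"
          using n by (intro mult_left_mono) auto
        also have "\<dots> = \<bar>M\<bar> / (\<bar>M\<bar> + 1) * \<epsilon>'" using n by simp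
        also have "\<dots> \<le> 1 * \<epsilon>'" using \<epsilon>' by (intro mult_right_mono) auto
        finally show ?thesis using n by (simp add: abs_mult)
      qed
      also have "\<bar>g2 z * z - M\<bar> \<le> \<epsilon>'" using X[OF zX] by simp
      finally have "\<bar>g2 z - M / n\<bar> * \<bar>z\<bar> \<le> 2 * \<epsilon>'" by (simp add: abs_mult)
      moreover have "\<bar>g2 z - M / n\<bar> * (n / 2) \<le> \<bar>g2 z - M / n\<bar> * \<bar>z\<bar>"
        using z2 by (intro mult_left_mono) auto
      ultimately have "\<bar>g2 z - M / n\<bar> * (n / 2) \<le> 2 * \<epsilon>'" by linarith
      moreover have "u \<le> 4 * \<epsilon>' / n" if "u * (n / 2) \<le> 2 * \<epsilon>'" for u
        using n that by (simp add: field_simps)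
      ultimately have diff: "\<bar>g2 z - M / n\<bar> \<le> 4 * \<epsilon>' / n" by blast
      have tn: "(t - n)\<^sup>2 \<le> (T + 1)\<^sup>2 * n"
      proof -
        have "\<bar>t - n\<bar> \<le> (T + 1) * sqrt n"
        proof -
          have "1 \<le> sqrt n" using n by simp
          moreover have "(T + 1) * sqrt n = T * sqrt n + sqrt n" by (simp add: algebra_simps)
          ultimately show ?thesis using t unfolding n_def by linarith
        qed
        then have "\<bar>t - n\<bar>\<^sup>2 \<le> ((T + 1) * sqrt n)\<^sup>2" by (intro power_mono) auto
        then show ?thesis using n by (simp add: power_mult_distrib)
      qed
      have "g t - (g n + g1 n * (t - n) + M / (2 * n) * (t - n)\<^sup>2) = (g2 z - M / n) / 2 * (t - n)\<^sup>2"
        unfolding gt by (simp add: algebra_simps diff_divide_distrib)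
      also have "\<bar>\<dots>\<bar> = \<bar>g2 z - M / n\<bar> / 2 * (t - n)\<^sup>2" by (simp add: abs_mult)
      also have "\<dots> \<le> (4 * \<epsilon>' / n) / 2 * ((T + 1)\<^sup>2 * n)"
        using diff tn \<epsilon>' n by (intro mult_mono divide_right_mono) auto
      also have "\<dots> = \<epsilon>" using \<epsilon>'(2) n by (simp add: field_simps)
      finally show "\<bar>g t - (g n + g1 n * (t - n) + M / (2 * n) * (t - n)\<^sup>2)\<bar> \<le> \<epsilon>" .
    qed (use \<open>\<epsilon> > 0\<close> in simp)
  qed
qed

section \<open>Rational polynomial parts\<close>

lemma tendsto_power_quotient:
  "((\<lambda>x::real. x ^ i / x ^ m) \<longlongrightarrow> (if i = m then 1 else 0)) at_top" if "i \<le> m"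
proof -
  have "eventually (\<lambda>x::real. x ^ i / x ^ m = 1 / x ^ (m - i)) at_top"
    using eventually_gt_at_top[of 0] by eventually_elim (use that in \<open>simp add: power_diff\<close>)
  moreover have "((\<lambda>x::real. 1 / x ^ (m - i)) \<longlongrightarrow> (if i = m then 1 else 0)) at_top"
  proof (cases "i = m")
    case False
    then have "((\<lambda>x::real. 1 / x ^ (m - i)) \<longlongrightarrow> 0) at_top"
      using that by (intro tendsto_divide_0[OF tendsto_const] filterlim_at_top_imp_at_infinity
        filterlim_pow_at_top filterlim_ident) auto
    then show ?thesis using False by simp
  qed simp
  ultimately show ?thesis by (subst filterlim_cong[OF refl refl]) auto
qed

lemma poly_quotient_tendsto:
  fixes p :: "real poly"
  assumes "degree p \<le> m"
  shows "((\<lambda>x. poly p x / x ^ m) \<longlongrightarrow> coeff p m) at_top"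
proof -
  have "((\<lambda>x. \<Sum>i\<le>m. coeff p i * (x ^ i / x ^ m)) \<longlongrightarrow> (\<Sum>i\<le>m. coeff p i * (if i = m then 1 else 0))) at_top"
    by (intro tendsto_sum tendsto_mult tendsto_const tendsto_power_quotient) auto
  moreover have "poly p x = (\<Sum>i\<le>m. coeff p i * x ^ i)" for x
    unfolding poly_altdef using assms
    by (intro sum.mono_neutral_left) (auto simp: coeff_eq_0)
  moreover have "(\<Sum>i\<le>m. coeff p i * (if i = m then 1 else 0)) = (\<Sum>i\<le>m. if i = m then coeff p i else 0)"
    by (intro sum.cong) auto
  ultimately show ?thesis
    by (simp add: sum_divide_distrib)
qed

abbreviation rpoly :: "rat poly \<Rightarrow> real \<Rightarrow> real" where
  "rpoly p x \<equiv> poly (map_poly of_rat p) x"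

lemma rpoly_pCons: "rpoly (pCons a p) x = of_rat a + x * rpoly p x"
  by (simp add: map_poly_pCons)

lemma map_poly_of_rat_add:
  "map_poly of_rat (p + q) = (map_poly of_rat p + map_poly of_rat q :: real poly)"
  by (rule poly_eqI) (simp add: coeff_map_poly of_rat_add)

lemma rpoly_add: "rpoly (p + q) x = rpoly p x + rpoly q x"
  by (simp add: map_poly_of_rat_add)

lemma rpoly_monom: "rpoly (monom r n) x = of_rat r * x ^ n"
  by (simp add: map_poly_monom poly_monom)

lemma degree_map_poly_of_rat: "degree (map_poly of_rat p :: real poly) = degree p"
  by (rule degree_map_poly) auto

lemma rpoly_integer_multiple: "\<exists>k>0. \<forall>n. real k * rpoly p (real n) \<in> \<int>"
proof (induction p)
  case (pCons a p)
  then obtain k where k: "k > 0" "\<And>n. real k * rpoly p (real n) \<in> \<int>" by blast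
  obtain u v where uv: "a = Rat.Fract u v" "v > 0"
    by (cases a) blast
  then have a: "real_of_rat a * real (nat v) = of_int u" by (simp add: of_rat_rat)
  have "real (k * nat v) * rpoly (pCons a p) (real n) \<in> \<int>" for n
  proof -
    have "real (k * nat v) * rpoly (pCons a p) (real n) =
      real k * (real_of_rat a * real (nat v)) + real n * (real (nat v) * (real k * rpoly p (real n)))"
      by (simp add: rpoly_pCons algebra_simps)
    also have "\<dots> \<in> \<int>"
      unfolding a by (intro Ints_add Ints_mult k Ints_of_nat Ints_of_int)
    finally show ?thesis .
  qed
  moreover have "k * nat v > 0" using k uv by simp
  ultimately show ?case by blast
qed (auto intro: exI[of _ 1])

text \<open>For n' = n + 2Qkj, the difference n' p(n') - n p(n) equals n (p(n') - p(n)) + 2Qj k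
  p(n'). The first part is an integer by induction, the second because \<open>k\<close> clears the
  denominators of \<open>p\<close>.\<close>

lemma rpoly_periodic_mod_Ints:
  "\<exists>Q>0. \<forall>n j. rpoly p (real (n + 2 * Q * j)) - rpoly p (real n) \<in> \<int>"
proof (induction p)
  case (pCons a p)
  then obtain Q where Q: "Q > 0" "\<And>n j. rpoly p (real (n + 2 * Q * j)) - rpoly p (real n) \<in> \<int>" by blast
  obtain k where k: "k > 0" "\<And>n. real k * rpoly p (real n) \<in> \<int>"
    using rpoly_integer_multiple by blast
  have "rpoly (pCons a p) (real (n + 2 * (Q * k) * j)) - rpoly (pCons a p) (real n) \<in> \<int>" for n j
  proof -
    have "rpoly (pCons a p) (real (n + 2 * (Q * k) * j)) - rpoly (pCons a p) (real n) =
      real n * (rpoly p (real (n + 2 * Q * (k * j))) - rpoly p (real n)) +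
      real (2 * Q * j) * (real k * rpoly p (real (n + 2 * Q * (k * j))))"
      unfolding rpoly_pCons by (simp add: algebra_simps)
    also have "\<dots> \<in> \<int>"
      by (intro Ints_add Ints_mult k Q Ints_of_nat)
    finally show ?thesis .
  qed
  moreover have "Q * k > 0" using k Q by simp
  ultimately show ?case by blast
qed (auto intro: exI[of _ 1])

context hardy_functions_ln
begin

lemma rpoly_mem: "(\<lambda>x. rpoly p x) \<in> F"
proof (induction p)
  case 0
  then show ?case by (simp add: zero)
next
  case (pCons a p)
  then show ?case unfolding rpoly_pCons by (intro add of_rat mult ident)
qed

text \<open>Rational leading terms are removed one degree at a time, until an irrational or infinite
  leading coefficient appears.\<close>

lemma rational_polynomial_part:
  assumes "h \<in> F" "((\<lambda>x. h x / x ^ Suc D) \<longlongrightarrow> 0) at_top"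
  obtains (sublinear) p where "((\<lambda>x. (h x - rpoly p x) / x) \<longlongrightarrow> 0) at_top"
    | (irrational) p l \<alpha> where "l \<ge> 1" "\<alpha> \<notin> \<rat>" "((\<lambda>x. (h x - rpoly p x) / x ^ l) \<longlongrightarrow> \<alpha>) at_top"
    | (between) p l where "l \<ge> 1" "filterlim (\<lambda>x. \<bar>(h x - rpoly p x) / x ^ l\<bar>) at_top at_top"
        "((\<lambda>x. (h x - rpoly p x) / x ^ Suc l) \<longlongrightarrow> 0) at_top"
  using assms
proof (induction D arbitrary: h thesis)
  case 0
  then show ?case using "0.prems"(1)[of 0] by simp
next
  case (Suc D)
  have "(\<lambda>x. h x / x ^ Suc D) \<in> F"
    by (intro divide Suc.prems ident_power)
  then show ?case
  proof (cases rule: abs_limit_cases)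
    case 2
    then show ?thesis using Suc.prems(3)[of "Suc D" 0] Suc.prems(5) by simp
  next
    case (1 c)
    show ?thesis
    proof (cases "c \<in> \<rat>")
      case False
      then show ?thesis using Suc.prems(2)[of "Suc D" c 0] 1 by simp
    next
      case True
      then obtain r where r: "c = of_rat r" by (auto elim: Rats_cases)
      define h' where "h' x = h x - rpoly (monom r (Suc D)) x" for x
      have h'_minus: "h' x - rpoly p x = h x - rpoly (p + monom r (Suc D)) x" for p x
        by (simp add: h'_def rpoly_add)
      have "h' \<in> F"
        unfolding h'_def by (intro diff Suc.prems rpoly_mem)
      moreover have "((\<lambda>x. h' x / x ^ Suc D) \<longlongrightarrow> 0) at_top"
      proof -
        have "((\<lambda>x. h x / x ^ Suc D - c) \<longlongrightarrow> c - c) at_top"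
          by (intro tendsto_diff 1 tendsto_const)
        moreover have "eventually (\<lambda>x. h x / x ^ Suc D - c = h' x / x ^ Suc D) at_top"
          using eventually_gt_at_top[of 0]
          by eventually_elim (simp add: h'_def rpoly_monom r diff_divide_distrib)
        ultimately have "((\<lambda>x. h' x / x ^ Suc D) \<longlongrightarrow> c - c) at_top"
          by (rule Lim_transform_eventually)
        then show ?thesis by simp
      qed
      ultimately show ?thesis
        by (rule Suc.IH[rotated -2]) (use Suc.prems in \<open>simp_all only: h'_minus\<close>)
    qed
  qed
qed

end

section \<open>Distance to rational polynomials\<close>

lemma abs_ge_of_quotient_tendsto:
  fixes f :: "real \<Rightarrow> real"
  assumes "((\<lambda>x. f x / x ^ m) \<longlongrightarrow> c) at_top" "c \<noteq> 0"
  shows "eventually (\<lambda>x. \<bar>f x\<bar> \<ge> \<bar>c\<bar> / 2 * x ^ m) at_top"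
proof -
  have "eventually (\<lambda>x. \<bar>f x / x ^ m\<bar> > \<bar>c\<bar> / 2) at_top"
    using assms(2) by (intro order_tendstoD(1)[OF tendsto_rabs[OF assms(1)]]) simp
  then show ?thesis
    using eventually_gt_at_top[of 0] by eventually_elim (simp add: field_simps)
qed

lemma quotient_tendsto_0_less:
  fixes f :: "real \<Rightarrow> real"
  assumes "((\<lambda>x. f x / x ^ l) \<longlongrightarrow> c) at_top" "l < m"
  shows "((\<lambda>x. f x / x ^ m) \<longlongrightarrow> 0) at_top"
proof -
  have "((\<lambda>x. (f x / x ^ l) * (x ^ l / x ^ m)) \<longlongrightarrow> c * (if l = m then 1 else 0)) at_top"
    using assms by (intro tendsto_mult tendsto_power_quotient) auto
  then have "((\<lambda>x. (f x / x ^ l) * (x ^ l / x ^ m)) \<longlongrightarrow> 0) at_top" using assms by simp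
  then show ?thesis
    by (rule Lim_transform_eventually)
       (use eventually_gt_at_top[of 0] in eventually_elim, simp)
qed

text \<open>This and the next two lemmas show that no further rational polynomial approximates
  \<open>g\<close> substantially better than 0 does. Here the leading term of \<open>r\<close>
  dominates \<open>g\<close>; for low degree against an infinite quotient, \<open>g\<close>
  dominates \<open>r\<close>.\<close>

lemma minus_rpoly_ge_high_degree:
  assumes lim: "((\<lambda>x. g x / x ^ Suc l) \<longlongrightarrow> 0) at_top" and "degree r > l"
  shows "\<exists>c>0. eventually (\<lambda>x. c * x ^ Suc l \<le> \<bar>g x - rpoly r x\<bar>) at_top"
proof -
  define m where "m = degree r"
  define c where "c = coeff (map_poly of_rat r :: real poly) m"
  have c: "c \<noteq> 0" using assms by (auto simp: c_def m_def coeff_map_poly)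
  have "((\<lambda>x. g x / x ^ m) \<longlongrightarrow> 0) at_top"
  proof (cases "m = Suc l")
    case False
    then show ?thesis using assms by (intro quotient_tendsto_0_less[OF lim]) (auto simp: m_def)
  qed (use lim in simp)
  then have "((\<lambda>x. g x / x ^ m - rpoly r x / x ^ m) \<longlongrightarrow> 0 - c) at_top"
    unfolding c_def
    by (intro tendsto_diff poly_quotient_tendsto) (auto simp: degree_map_poly_of_rat m_def)
  then have "((\<lambda>x. (g x - rpoly r x) / x ^ m) \<longlongrightarrow> - c) at_top"
    by (simp add: diff_divide_distrib)
  then have "eventually (\<lambda>x. \<bar>- c\<bar> / 2 * x ^ m \<le> \<bar>g x - rpoly r x\<bar>) at_top"
    using c by (intro abs_ge_of_quotient_tendsto) auto
  then have "eventually (\<lambda>x. \<bar>c\<bar> / 2 * x ^ Suc l \<le> \<bar>g x - rpoly r x\<bar>) at_top"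
    using eventually_ge_at_top[of 1]
  proof eventually_elim
    case (elim x)
    have "\<bar>c\<bar> / 2 * x ^ Suc l \<le> \<bar>c\<bar> / 2 * x ^ m"
      using elim assms by (intro mult_left_mono power_increasing) (auto simp: m_def)
    then show ?case using elim by simp
  qed
  then show ?thesis using c by (intro exI[of _ "\<bar>c\<bar> / 2"]) simp
qed

text \<open>The coefficient of \<open>r\<close> at x^l is rational and cannot cancel \<alpha>; if
  \<open>r\<close> has higher degree, it dominates instead.\<close>

lemma minus_rpoly_ge_irrational:
  assumes lim: "((\<lambda>x. g x / x ^ l) \<longlongrightarrow> \<alpha>) at_top" and "\<alpha> \<notin> \<rat>"
  shows "\<exists>c>0. eventually (\<lambda>x. c * x ^ l \<le> \<bar>g x - rpoly r x\<bar>) at_top"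
proof (cases "degree r \<le> l")
  case True
  have "((\<lambda>x. g x / x ^ l - rpoly r x / x ^ l) \<longlongrightarrow> \<alpha> - coeff (map_poly of_rat r) l) at_top"
    using True by (intro tendsto_diff lim poly_quotient_tendsto) (simp add: degree_map_poly_of_rat)
  then have "((\<lambda>x. (g x - rpoly r x) / x ^ l) \<longlongrightarrow> \<alpha> - coeff (map_poly of_rat r) l) at_top"
    by (simp add: diff_divide_distrib)
  moreover have ne: "\<alpha> - coeff (map_poly of_rat r) l \<noteq> 0"
    using \<open>\<alpha> \<notin> \<rat>\<close> by (auto simp: coeff_map_poly)
  ultimately have "eventually (\<lambda>x. \<bar>\<alpha> - coeff (map_poly of_rat r) l\<bar> / 2 * x ^ l \<le> \<bar>g x - rpoly r x\<bar>) at_top"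
    by (rule abs_ge_of_quotient_tendsto)
  then show ?thesis using ne by (intro exI[of _ "\<bar>\<alpha> - coeff (map_poly of_rat r) l\<bar> / 2"]) simp
next
  case False
  have "((\<lambda>x. g x / x ^ Suc l) \<longlongrightarrow> 0) at_top"
    by (rule quotient_tendsto_0_less[OF lim]) simp
  then obtain c where c: "c > 0" "eventually (\<lambda>x. c * x ^ Suc l \<le> \<bar>g x - rpoly r x\<bar>) at_top"
    using minus_rpoly_ge_high_degree[of g l r] False by auto
  have "eventually (\<lambda>x. c * x ^ l \<le> \<bar>g x - rpoly r x\<bar>) at_top"
    using c(2) eventually_ge_at_top[of 1]
  proof eventually_elim
    case (elim x)
    have "c * x ^ l \<le> c * x ^ Suc l"
      using elim c by (intro mult_left_mono power_increasing) auto
    then show ?case using elim by simp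
  qed
  with c(1) show ?thesis by blast
qed

lemma minus_rpoly_ge_low_degree:
  assumes lim: "filterlim (\<lambda>x. \<bar>g x / x ^ l\<bar>) at_top at_top" and "degree r \<le> l"
  shows "eventually (\<lambda>x. \<bar>g x\<bar> / 2 \<le> \<bar>g x - rpoly r x\<bar>) at_top"
proof -
  define c where "c = \<bar>coeff (map_poly of_rat r :: real poly) l\<bar> + 1"
  have "((\<lambda>x. rpoly r x / x ^ l) \<longlongrightarrow> coeff (map_poly of_rat r) l) at_top"
    using assms by (intro poly_quotient_tendsto) (simp add: degree_map_poly_of_rat)
  then have "eventually (\<lambda>x. \<bar>rpoly r x / x ^ l\<bar> < c) at_top"
    by (intro order_tendstoD(2)[OF tendsto_rabs]) (auto simp: c_def)
  then show ?thesis
    using lim[unfolded filterlim_at_top, rule_format, of "2 * c"] eventually_gt_at_top[of 0]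
  proof eventually_elim
    case (elim x)
    then have "\<bar>rpoly r x\<bar> < c * x ^ l" "2 * c * x ^ l \<le> \<bar>g x\<bar>" by (auto simp: field_simps)
    then show ?case by linarith
  qed
qed

lemma filterlim_quotient_mono:
  fixes f \<psi> k :: "real \<Rightarrow> real"
  assumes "filterlim (\<lambda>x. k x / \<psi> x) at_top at_top" and "eventually (\<lambda>x. k x \<le> f x) at_top"
    and "eventually (\<lambda>x. \<psi> x > 0) at_top"
  shows "filterlim (\<lambda>x. f x / \<psi> x) at_top at_top"
  by (rule filterlim_at_top_mono[OF assms(1)])
     (use assms(2,3) in eventually_elim, simp add: divide_right_mono)

lemma filterlim_const_mult_at_top:
  fixes f :: "real \<Rightarrow> real"
  assumes "filterlim f at_top at_top" "c > 0"
  shows "filterlim (\<lambda>x. c * f x) at_top at_top"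
  using filterlim_tendsto_pos_mult_at_top[OF tendsto_const assms(2,1)] .

lemma filterlim_half_quotient:
  fixes g \<psi> :: "real \<Rightarrow> real"
  assumes "filterlim (\<lambda>x. \<bar>g x / \<psi> x\<bar>) at_top at_top" "eventually (\<lambda>x. \<psi> x > 0) at_top"
  shows "filterlim (\<lambda>x. \<bar>g x\<bar> / 2 / \<psi> x) at_top at_top"
proof -
  have "filterlim (\<lambda>x. 1 / 2 * \<bar>g x / \<psi> x\<bar>) at_top at_top"
    by (rule filterlim_const_mult_at_top[OF assms(1)]) simp
  then show ?thesis
    by (rule filterlim_at_top_mono) (use assms(2) in eventually_elim, simp)
qed

lemma xlnx_pos: "eventually (\<lambda>x::real. x * ln x > 0) at_top"
  using eventually_gt_at_top[of 1] by eventually_elim auto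

lemma sqrt_pos: "eventually (\<lambda>x::real. sqrt x > 0) at_top"
  using eventually_gt_at_top[of 0] by eventually_elim auto

lemma filterlim_square_over_xlnx:
  assumes "c > 0" "m \<ge> 2"
  shows "filterlim (\<lambda>x::real. c * x ^ m / (x * ln x)) at_top at_top"
proof -
  have "filterlim (\<lambda>x::real. inverse (ln x / x)) at_top at_top"
  proof (rule filterlim_inverse_at_top[OF ln_x_over_x_tendsto_0])
    show "eventually (\<lambda>x::real. 0 < ln x / x) at_top"
      using eventually_gt_at_top[of 1] by eventually_elim simp
  qed
  then have "filterlim (\<lambda>x::real. c * inverse (ln x / x)) at_top at_top"
    using assms by (intro filterlim_const_mult_at_top)
  then show ?thesis
  proof (rule filterlim_at_top_mono)
    show "eventually (\<lambda>x::real. c * inverse (ln x / x) \<le> c * x ^ m / (x * ln x)) at_top"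
      using eventually_gt_at_top[of 1]
    proof eventually_elim
      case (elim x)
      have "x ^ 2 \<le> x ^ m" using elim assms by (intro power_increasing) auto
      then have "c * (x ^ 2 / (x * ln x)) \<le> c * (x ^ m / (x * ln x))"
        using elim assms by (intro mult_left_mono divide_right_mono) auto
      then show ?case using elim by (simp add: power2_eq_square field_simps)
    qed
  qed
qed

lemma filterlim_power_over_sqrt:
  assumes "c > 0" "m \<ge> 1"
  shows "filterlim (\<lambda>x::real. c * x ^ m / sqrt x) at_top at_top"
proof -
  have "filterlim (\<lambda>x::real. c * sqrt x) at_top at_top"
    using assms by (intro filterlim_const_mult_at_top sqrt_at_top)
  then show ?thesis
  proof (rule filterlim_at_top_mono)
    show "eventually (\<lambda>x::real. c * sqrt x \<le> c * x ^ m / sqrt x) at_top"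
      using eventually_gt_at_top[of 1]
    proof eventually_elim
      case (elim x)
      have "x ^ 1 \<le> x ^ m" using elim assms by (intro power_increasing) auto
      then have "c * (x / sqrt x) \<le> c * (x ^ m / sqrt x)"
        using elim assms by (intro mult_left_mono divide_right_mono) auto
      then show ?case using elim by (simp add: real_div_sqrt)
    qed
  qed
qed

section \<open>Conditions (a) and (b) in terms of the remainder\<close>

lemma rpoly_diff: "rpoly (p - q) x = rpoly p x - rpoly q x"
  using rpoly_add[of "p - q" q x] by simp

lemma rat_poly_dist_eq: "rat_poly_dist h p' x = \<bar>(h x - rpoly p x) - rpoly (p' - p) x\<bar>"
  by (simp add: rat_poly_dist_def rpoly_diff)

lemma not_linear_if_superlinear:
  assumes "filterlim (\<lambda>x. rat_poly_dist h q x / (x * ln x)) at_top at_top"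
    and "((\<lambda>x. rat_poly_dist h q x / x) \<longlongrightarrow> L) at_top"
  shows False
proof -
  have "((\<lambda>x::real. rat_poly_dist h q x / x * inverse (ln x)) \<longlongrightarrow> L * 0) at_top"
    by (intro tendsto_mult assms tendsto_inverse_0_at_top ln_at_top)
  then have "((\<lambda>x. rat_poly_dist h q x / (x * ln x)) \<longlongrightarrow> 0) at_top"
    by (simp add: field_simps)
  moreover have "filterlim (\<lambda>x. \<bar>rat_poly_dist h q x / (x * ln x)\<bar>) at_top at_top"
    using assms(1) by (rule filterlim_at_top_mono) (intro always_eventually allI abs_ge_self)
  ultimately show False by (rule tendsto_not_abs_at_top)
qed

definition superlinear_gap :: "(real \<Rightarrow> real) \<Rightarrow> bool" where
  "superlinear_gap h \<longleftrightarrow> (\<forall>p. filterlim (\<lambda>x. rat_poly_dist h p x / (x * ln x)) at_top at_top)"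

definition sqrt_gap :: "(real \<Rightarrow> real) \<Rightarrow> bool" where
  "sqrt_gap h \<longleftrightarrow> (\<forall>p. filterlim (\<lambda>x. rat_poly_dist h p x / sqrt x) at_top at_top)"

definition linear_distance :: "(real \<Rightarrow> real) \<Rightarrow> bool" where
  "linear_distance h \<longleftrightarrow> (\<exists>q. \<exists>L :: real. ((\<lambda>x. rat_poly_dist h q x / x) \<longlongrightarrow> L) at_top)"

lemma not_superlinear_gap_if_linear_distance:
  assumes "linear_distance h"
  shows "\<not> superlinear_gap h"
proof
  assume "superlinear_gap h"
  then have "filterlim (\<lambda>x. rat_poly_dist h q x / (x * ln x)) at_top at_top" for q
    by (simp add: superlinear_gap_def)
  moreover obtain q L where "((\<lambda>x. rat_poly_dist h q x / x) \<longlongrightarrow> L) at_top"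
    using assms unfolding linear_distance_def by auto
  ultimately show False by (rule not_linear_if_superlinear)
qed

text \<open>Since the remainder g is o(x), \<open>p\<close> itself witnesses linear distance and (a)
  is excluded. For the square root condition only \<open>p\<close> matters: a constant difference is
  negligible against abs g tending to infinity, and a nonconstant one is at least linear.\<close>

lemma gap_sublinear:
  assumes lim: "((\<lambda>x. (h x - rpoly p x) / x) \<longlongrightarrow> 0) at_top"
  shows "superlinear_gap h \<or> sqrt_gap h \<and> linear_distance h \<longleftrightarrow>
    filterlim (\<lambda>x. \<bar>(h x - rpoly p x) / sqrt x\<bar>) at_top at_top"
proof -
  define g where "g x = h x - rpoly p x" for x
  have g: "((\<lambda>x. g x / x) \<longlongrightarrow> 0) at_top" using lim by (simp add: g_def)
  have dist: "rat_poly_dist h p' x = \<bar>g x - rpoly (p' - p) x\<bar>" for p' x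
    unfolding g_def by (rule rat_poly_dist_eq)
  have "((\<lambda>x. \<bar>g x / x\<bar>) \<longlongrightarrow> 0) at_top" using tendsto_rabs[OF g] by simp
  then have "((\<lambda>x. rat_poly_dist h p x / x) \<longlongrightarrow> 0) at_top"
    by (rule Lim_transform_eventually)
       (use eventually_gt_at_top[of 0] in eventually_elim, simp add: dist)
  then have "linear_distance h"
    unfolding linear_distance_def by blast
  moreover from this have "\<not> superlinear_gap h"
    using not_superlinear_gap_if_linear_distance by blast
  moreover have "sqrt_gap h \<longleftrightarrow> filterlim (\<lambda>x. \<bar>g x / sqrt x\<bar>) at_top at_top"
  proof
    assume "sqrt_gap h"
    then have "filterlim (\<lambda>x. rat_poly_dist h p x / sqrt x) at_top at_top"
      by (simp add: sqrt_gap_def)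
    then show "filterlim (\<lambda>x. \<bar>g x / sqrt x\<bar>) at_top at_top"
      by (rule filterlim_at_top_mono) (use sqrt_pos in eventually_elim, simp add: dist)
  next
    assume gs: "filterlim (\<lambda>x. \<bar>g x / sqrt x\<bar>) at_top at_top"
    show "sqrt_gap h"
      unfolding sqrt_gap_def
    proof
      fix p'
      define r where "r = p' - p"
      show "filterlim (\<lambda>x. rat_poly_dist h p' x / sqrt x) at_top at_top"
        unfolding dist r_def[symmetric]
      proof (cases "degree r = 0")
        case True
        have "filterlim (\<lambda>x. \<bar>g x / x ^ 0\<bar>) at_top at_top"
          using gs
        proof (rule filterlim_at_top_mono)
          show "eventually (\<lambda>x. \<bar>g x / sqrt x\<bar> \<le> \<bar>g x / x ^ 0\<bar>) at_top"
            using eventually_ge_at_top[of 1]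
          proof eventually_elim
            case (elim x)
            then have "\<bar>g x\<bar> / sqrt x \<le> \<bar>g x\<bar> / 1" by (intro divide_left_mono) auto
            then show ?case using elim by simp
          qed
        qed
        then have ge: "eventually (\<lambda>x. \<bar>g x\<bar> / 2 \<le> \<bar>g x - rpoly r x\<bar>) at_top"
          using minus_rpoly_ge_low_degree[of g 0 r] True by simp
        show "filterlim (\<lambda>x. \<bar>g x - rpoly r x\<bar> / sqrt x) at_top at_top"
          by (rule filterlim_quotient_mono[OF filterlim_half_quotient[OF gs sqrt_pos] ge sqrt_pos])
      next
        case False
        then obtain c where c: "c > 0" "eventually (\<lambda>x. c * x ^ Suc 0 \<le> \<bar>g x - rpoly r x\<bar>) at_top"
          using minus_rpoly_ge_high_degree[of g 0 r] g by auto
        show "filterlim (\<lambda>x. \<bar>g x - rpoly r x\<bar> / sqrt x) at_top at_top"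
          by (rule filterlim_quotient_mono[OF _ c(2) sqrt_pos], rule filterlim_power_over_sqrt) (use c in auto)
      qed
    qed
  qed
  ultimately show ?thesis unfolding g_def by blast
qed

text \<open>No rational polynomial comes closer than a multiple of x^l. This is (b) for l = 1, with
  \<open>p\<close> at linear distance, and (a) for l >= 2, where x^l beats x ln x.\<close>

lemma gap_irrational:
  assumes "l \<ge> 1" "\<alpha> \<notin> \<rat>" and lim: "((\<lambda>x. (h x - rpoly p x) / x ^ l) \<longlongrightarrow> \<alpha>) at_top"
  shows "superlinear_gap h \<or> sqrt_gap h \<and> linear_distance h"
proof -
  define g where "g x = h x - rpoly p x" for x
  have g: "((\<lambda>x. g x / x ^ l) \<longlongrightarrow> \<alpha>) at_top" using lim by (simp add: g_def)
  have dist: "rat_poly_dist h p' x = \<bar>g x - rpoly (p' - p) x\<bar>" for p' x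
    unfolding g_def by (rule rat_poly_dist_eq)
  show ?thesis
  proof (cases "l = 1")
    case True
    have "((\<lambda>x. \<bar>g x / x\<bar>) \<longlongrightarrow> \<bar>\<alpha>\<bar>) at_top" using tendsto_rabs[OF g] True by simp
    then have "((\<lambda>x. rat_poly_dist h p x / x) \<longlongrightarrow> \<bar>\<alpha>\<bar>) at_top"
      by (rule Lim_transform_eventually)
         (use eventually_gt_at_top[of 0] in eventually_elim, simp add: dist)
    then have "linear_distance h" unfolding linear_distance_def by blast
    moreover have "sqrt_gap h"
      unfolding sqrt_gap_def dist
    proof
      fix p'
      obtain c where c: "c > 0" "eventually (\<lambda>x. c * x ^ l \<le> \<bar>g x - rpoly (p' - p) x\<bar>) at_top"
        using minus_rpoly_ge_irrational[OF g \<open>\<alpha> \<notin> \<rat>\<close>] by blast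
      show "filterlim (\<lambda>x. \<bar>g x - rpoly (p' - p) x\<bar> / sqrt x) at_top at_top"
        by (rule filterlim_quotient_mono[OF _ c(2) sqrt_pos], rule filterlim_power_over_sqrt)
           (use c \<open>l \<ge> 1\<close> in auto)
    qed
    ultimately show ?thesis by blast
  next
    case False
    have "superlinear_gap h"
      unfolding superlinear_gap_def dist
    proof
      fix p'
      obtain c where c: "c > 0" "eventually (\<lambda>x. c * x ^ l \<le> \<bar>g x - rpoly (p' - p) x\<bar>) at_top"
        using minus_rpoly_ge_irrational[OF g \<open>\<alpha> \<notin> \<rat>\<close>] by blast
      show "filterlim (\<lambda>x. \<bar>g x - rpoly (p' - p) x\<bar> / (x * ln x)) at_top at_top"
        by (rule filterlim_quotient_mono[OF _ c(2) xlnx_pos], rule filterlim_square_over_xlnx)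
           (use c False \<open>l \<ge> 1\<close> in auto)
    qed
    then show ?thesis ..
  qed
qed

text \<open>The remainder outgrows x and cannot be cancelled by a rational polynomial of any degree,
  so linear distance is impossible and (a) alone decides. For (a) it is enough to test
  \<open>p\<close>.\<close>

lemma gap_between:
  assumes l: "l \<ge> 1" and lim: "filterlim (\<lambda>x. \<bar>(h x - rpoly p x) / x ^ l\<bar>) at_top at_top"
    and lim0: "((\<lambda>x. (h x - rpoly p x) / x ^ Suc l) \<longlongrightarrow> 0) at_top"
  shows "superlinear_gap h \<or> sqrt_gap h \<and> linear_distance h \<longleftrightarrow>
    filterlim (\<lambda>x. \<bar>(h x - rpoly p x) / (x * ln x)\<bar>) at_top at_top"
proof -
  define g where "g x = h x - rpoly p x" for x
  have g: "filterlim (\<lambda>x. \<bar>g x / x ^ l\<bar>) at_top at_top" using lim by (simp add: g_def)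
  have g0: "((\<lambda>x. g x / x ^ Suc l) \<longlongrightarrow> 0) at_top" using lim0 by (simp only: g_def)
  have dist: "rat_poly_dist h p' x = \<bar>g x - rpoly (p' - p) x\<bar>" for p' x
    unfolding g_def by (rule rat_poly_dist_eq)
  have g1: "filterlim (\<lambda>x. \<bar>g x / x\<bar>) at_top at_top"
    using g
  proof (rule filterlim_at_top_mono)
    show "eventually (\<lambda>x. \<bar>g x / x ^ l\<bar> \<le> \<bar>g x / x\<bar>) at_top"
      using eventually_ge_at_top[of 1]
    proof eventually_elim
      case (elim x)
      then have "x ^ 1 \<le> x ^ l" using l by (intro power_increasing) auto
      then have "\<bar>g x\<bar> / x ^ l \<le> \<bar>g x\<bar> / x" using elim by (intro divide_left_mono) auto
      then show ?case using elim by simp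
    qed
  qed
  have nlin: "\<not> linear_distance h"
  proof
    assume "linear_distance h"
    then obtain q L where qL: "((\<lambda>x. rat_poly_dist h q x / x) \<longlongrightarrow> L) at_top"
      unfolding linear_distance_def by blast
    define r where "r = q - p"
    have "filterlim (\<lambda>x. \<bar>g x - rpoly r x\<bar> / x) at_top at_top"
    proof (cases "degree r \<le> l")
      case True
      have "filterlim (\<lambda>x. \<bar>g x\<bar> / 2 / x) at_top at_top"
        by (rule filterlim_half_quotient[OF g1 eventually_gt_at_top[of 0]])
      then show ?thesis
        using filterlim_quotient_mono[OF _ minus_rpoly_ge_low_degree[OF g True] eventually_gt_at_top[of 0]]
        by simp
    next
      case False
      then obtain c where c: "c > 0" "eventually (\<lambda>x. c * x ^ Suc l \<le> \<bar>g x - rpoly r x\<bar>) at_top"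
        using minus_rpoly_ge_high_degree[OF g0, of r] by auto
      have "filterlim (\<lambda>x::real. c * x ^ l) at_top at_top"
        using c l by (intro filterlim_const_mult_at_top filterlim_pow_at_top filterlim_ident) auto
      then have "filterlim (\<lambda>x. c * x ^ Suc l / x) at_top at_top"
        by (rule filterlim_at_top_mono) (use eventually_gt_at_top[of 0] in eventually_elim, simp)
      then show ?thesis
        using filterlim_quotient_mono[OF _ c(2) eventually_gt_at_top[of 0]] by simp
    qed
    then have "filterlim (\<lambda>x. \<bar>rat_poly_dist h q x / x\<bar>) at_top at_top"
      unfolding dist r_def by (rule filterlim_at_top_mono) (intro always_eventually allI abs_ge_self)
    then show False using tendsto_not_abs_at_top[OF qL] by blast
  qed
  have "superlinear_gap h \<longleftrightarrow> filterlim (\<lambda>x. \<bar>g x / (x * ln x)\<bar>) at_top at_top"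
  proof
    assume "superlinear_gap h"
    then have "filterlim (\<lambda>x. rat_poly_dist h p x / (x * ln x)) at_top at_top"
      by (simp add: superlinear_gap_def)
    then show "filterlim (\<lambda>x. \<bar>g x / (x * ln x)\<bar>) at_top at_top"
      by (rule filterlim_at_top_mono) (use xlnx_pos in eventually_elim, simp add: dist)
  next
    assume gs: "filterlim (\<lambda>x. \<bar>g x / (x * ln x)\<bar>) at_top at_top"
    show "superlinear_gap h"
      unfolding superlinear_gap_def
    proof
      fix p'
      define r where "r = p' - p"
      show "filterlim (\<lambda>x. rat_poly_dist h p' x / (x * ln x)) at_top at_top"
        unfolding dist r_def[symmetric]
      proof (cases "degree r \<le> l")
        case True
        have "filterlim (\<lambda>x. \<bar>g x\<bar> / 2 / (x * ln x)) at_top at_top"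
          by (rule filterlim_half_quotient[OF gs xlnx_pos])
        then show "filterlim (\<lambda>x. \<bar>g x - rpoly r x\<bar> / (x * ln x)) at_top at_top"
          by (rule filterlim_quotient_mono[OF _ minus_rpoly_ge_low_degree[OF g True] xlnx_pos])
      next
        case False
        then obtain c where c: "c > 0" "eventually (\<lambda>x. c * x ^ Suc l \<le> \<bar>g x - rpoly r x\<bar>) at_top"
          using minus_rpoly_ge_high_degree[OF g0, of r] by auto
        show "filterlim (\<lambda>x. \<bar>g x - rpoly r x\<bar> / (x * ln x)) at_top at_top"
          by (rule filterlim_quotient_mono[OF _ c(2) xlnx_pos], rule filterlim_square_over_xlnx)
             (use c l in auto)
      qed
    qed
  qed
  with nlin show ?thesis unfolding g_def by blast
qed

lemma quotient_xlnx_at_top: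
  assumes l: "l \<ge> 2" and g: "filterlim (\<lambda>x. \<bar>g x / x ^ l\<bar>) at_top at_top"
  shows "filterlim (\<lambda>x::real. \<bar>g x / (x * ln x)\<bar>) at_top at_top"
proof -
  have "eventually (\<lambda>x. 1 * x ^ l \<le> \<bar>g x\<bar>) at_top"
    using g[unfolded filterlim_at_top, rule_format, of 1] eventually_gt_at_top[of 0]
    by eventually_elim (simp add: field_simps)
  then have "filterlim (\<lambda>x. \<bar>g x\<bar> / (x * ln x)) at_top at_top"
    by (rule filterlim_quotient_mono[OF _ _ xlnx_pos, rotated]) (rule filterlim_square_over_xlnx, use l in auto)
  then show ?thesis
    by (rule filterlim_at_top_mono) (use xlnx_pos in eventually_elim, simp)
qed

section \<open>The equivalence\<close>

context hardy_functions_ln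
begin

lemma bin2_mean_tendsto_0_sublinear:
  fixes P :: "nat \<Rightarrow> real"
  assumes g: "g \<in> F" and "Q > 0" and P: "\<And>n j. P (n + 2 * Q * j) - P n \<in> \<int>"
    and lim: "((\<lambda>x. g x / x) \<longlongrightarrow> 0) at_top"
    and inf: "filterlim (\<lambda>x. \<bar>g x / sqrt x\<bar>) at_top at_top"
  shows "(\<lambda>N. bin2_mean N (\<lambda>n. ecis (P n + g (real n)))) \<longlonglongrightarrow> 0"
proof (rule bin2_mean_tendsto_0_vanishing[OF g \<open>Q > 0\<close> P, of 1])
  show "((deriv ^^ 1) g \<longlongrightarrow> 0) at_top"
    using iter_deriv_tendsto[OF g, of 1 0] lim by simp
  show "filterlim (\<lambda>x. \<bar>(deriv ^^ 1) g x\<bar> * sqrt x ^ 1) at_top at_top"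
    using deriv_sqrt_abs_at_top[OF g inf] by simp
qed simp

text \<open>The derivative of order l + 1 is the first one that tends to 0. For l = 1 its size is
  governed by the scale x ln x. For l >= 2 the derivative of order \<open>l\<close> is unbounded,
  which already gives the factor x^(3/2), and 3/2 <= (l+1)/2.\<close>

lemma bin2_mean_tendsto_0_between:
  fixes P :: "nat \<Rightarrow> real"
  assumes g: "g \<in> F" and "Q > 0" and P: "\<And>n j. P (n + 2 * Q * j) - P n \<in> \<int>"
    and l: "l \<ge> 1" and inf: "filterlim (\<lambda>x. \<bar>g x / x ^ l\<bar>) at_top at_top"
    and lim: "((\<lambda>x. g x / x ^ Suc l) \<longlongrightarrow> 0) at_top"
    and inf': "filterlim (\<lambda>x. \<bar>g x / (x * ln x)\<bar>) at_top at_top"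
  shows "(\<lambda>N. bin2_mean N (\<lambda>n. ecis (P n + g (real n)))) \<longlonglongrightarrow> 0"
proof (rule bin2_mean_tendsto_0_vanishing[OF g \<open>Q > 0\<close> P, of "Suc l"])
  show "((deriv ^^ Suc l) g \<longlongrightarrow> 0) at_top"
    using iter_deriv_tendsto[OF g lim] by simp
  show "filterlim (\<lambda>x. \<bar>(deriv ^^ Suc l) g x\<bar> * sqrt x ^ Suc l) at_top at_top"
  proof (cases "l = 1")
    case True
    have "filterlim (\<lambda>x. \<bar>(deriv ^^ 2) g x\<bar> * x) at_top at_top"
      by (rule second_deriv_abs_at_top[OF g inf'])
    then show ?thesis
      by (rule filterlim_at_top_mono)
         (use eventually_gt_at_top[of 0] in eventually_elim, simp add: True numeral_2_eq_2)
  next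
    case False
    have "filterlim (\<lambda>x. \<bar>deriv ((deriv ^^ l) g) x\<bar> * sqrt x ^ 3) at_top at_top"
      by (intro deriv_abs_at_top_of_abs_at_top iter_deriv g iter_deriv_abs_at_top inf)
    then show ?thesis
    proof (rule filterlim_at_top_mono)
      show "eventually (\<lambda>x. \<bar>deriv ((deriv ^^ l) g) x\<bar> * sqrt x ^ 3 \<le> \<bar>(deriv ^^ Suc l) g x\<bar> * sqrt x ^ Suc l) at_top"
        using eventually_ge_at_top[of 1]
      proof eventually_elim
        case (elim x)
        then have "sqrt x ^ 3 \<le> sqrt x ^ Suc l"
          using False l by (intro power_increasing) auto
        then show ?case by (simp add: mult_left_mono del: power_Suc)
      qed
    qed
  qed
qed (use l in simp)

text \<open>Over the window the phase is nearly linear with slope O(1 / sqrt N), so its mean is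
  close in modulus to a power cos(\<theta>)^N with \<theta> = O(1 / sqrt N), which stays away from
  0. This holds for all large \<open>N\<close>.\<close>

lemma bin2_mean_not_tendsto_0_sqrt:
  assumes g: "g \<in> F" and lim: "((\<lambda>x. g x / sqrt x) \<longlongrightarrow> c) at_top"
  shows "\<not> (\<lambda>N. bin2_mean N (\<lambda>n. ecis (g (real n)))) \<longlonglongrightarrow> 0"
proof -
  define g1 g2 where "g1 = deriv g" and "g2 = deriv g1"
  have F1: "g1 \<in> F" and F2: "g2 \<in> F" unfolding g1_def g2_def by (intro deriv g)+
  have lim1: "((\<lambda>x. g1 x * sqrt x) \<longlongrightarrow> c / 2) at_top"
    unfolding g1_def by (rule deriv_sqrt_tendsto[OF g lim])
  have div_sqrt: "(f \<longlongrightarrow> 0) at_top" if "((\<lambda>x. f x * sqrt x) \<longlongrightarrow> e) at_top" for f and e :: real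
  proof -
    have "((\<lambda>x. f x * sqrt x * inverse (sqrt x)) \<longlongrightarrow> e * 0) at_top"
      by (intro tendsto_mult that tendsto_inverse_0_at_top sqrt_at_top)
    then have "((\<lambda>x. f x * sqrt x * inverse (sqrt x)) \<longlongrightarrow> 0) at_top" by simp
    then show ?thesis
      by (rule Lim_transform_eventually) (use sqrt_pos in eventually_elim, simp)
  qed
  have g1_0: "(g1 \<longlongrightarrow> 0) at_top" by (rule div_sqrt[OF lim1])
  \<comment> \<open>To bound the second derivative, the square root scale is applied once more, to x
    g' instead of g'. Its derivative g' + x g'' tends to 0, and so does g', hence x g'' tends to
    0.\<close>
  have "((\<lambda>x. (x * g1 x) / sqrt x) \<longlongrightarrow> c / 2) at_top"
    using lim1
  proof (rule Lim_transform_eventually)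
    show "eventually (\<lambda>x. g1 x * sqrt x = (x * g1 x) / sqrt x) at_top"
      using eventually_gt_at_top[of 0]
    proof eventually_elim
      case (elim x)
      then have "x / sqrt x = sqrt x" by (simp add: real_div_sqrt)
      then show ?case by (metis mult.commute times_divide_eq_right)
    qed
  qed
  then have "((\<lambda>x. deriv (\<lambda>x. x * g1 x) x * sqrt x) \<longlongrightarrow> c / 2 / 2) at_top"
    by (intro deriv_sqrt_tendsto mult ident F1)
  then have "(deriv (\<lambda>x. x * g1 x) \<longlongrightarrow> 0) at_top" by (rule div_sqrt)
  then have "((\<lambda>x. deriv (\<lambda>x. x * g1 x) x - g1 x) \<longlongrightarrow> 0 - 0) at_top"
    by (intro tendsto_diff g1_0)
  then have "((\<lambda>x. deriv (\<lambda>x. x * g1 x) x - g1 x) \<longlongrightarrow> 0) at_top" by simp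
  then have lim2: "((\<lambda>x. g2 x * x) \<longlongrightarrow> 0) at_top"
  proof (rule Lim_transform_eventually)
    show "eventually (\<lambda>x. deriv (\<lambda>x. x * g1 x) x - g1 x = g2 x * x) at_top"
      using has_deriv[OF F1]
    proof eventually_elim
      case (elim x)
      have "((\<lambda>x. x * g1 x) has_real_derivative 1 * g1 x + g2 x * x) (at x)"
        unfolding g2_def by (rule DERIV_mult[OF DERIV_ident elim])
      then have "deriv (\<lambda>x. x * g1 x) x = 1 * g1 x + g2 x * x" by (rule DERIV_imp_deriv)
      then show ?case by simp
    qed
  qed
  define C where "C = 2 * pi * (\<bar>c / 2\<bar> + 1)"
  have "C > 0" by (simp add: C_def add_nonneg_pos)
  then obtain b where b: "b > 0" and walk: "eventually (\<lambda>N. \<forall>\<theta>. \<bar>\<theta>\<bar> * sqrt (real N) \<le> C \<longrightarrow>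
    norm (walk_mean N (\<lambda>s. cis (\<theta> * real_of_int s))) \<ge> b) sequentially"
    using walk_mean_linear_ge by blast
  have "eventually (\<lambda>x. \<bar>g1 x * sqrt x\<bar> < \<bar>c / 2\<bar> + 1) at_top"
    by (rule order_tendstoD[OF tendsto_rabs[OF lim1]]) simp
  then have ev1: "eventually (\<lambda>N. \<bar>g1 (real N) * sqrt (real N)\<bar> < \<bar>c / 2\<bar> + 1) sequentially"
    by (rule eventually_sequentially_real)
  show ?thesis
  proof (rule bin2_mean_not_tendsto_0[OF _ b])
    fix \<epsilon> T :: real assume "\<epsilon> > 0" "T > 0"
    define \<epsilon>' where "\<epsilon>' = \<epsilon> / (4 * pi)"
    have \<epsilon>': "\<epsilon>' > 0" "2 * pi * (2 * \<epsilon>') = \<epsilon>" using \<open>\<epsilon> > 0\<close> by (auto simp: \<epsilon>'_def)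
    have "eventually (\<lambda>x. \<bar>g1 x\<bar> < \<epsilon>') at_top"
      using order_tendstoD(2)[OF tendsto_rabs[OF g1_0]] \<epsilon>'(1) by simp
    then have ev2: "eventually (\<lambda>N. \<bar>g1 (real N)\<bar> < \<epsilon>') sequentially"
      by (rule eventually_sequentially_real)
    have "eventually (walk_approx b \<epsilon> T (\<lambda>n. ecis (g (real n)))) sequentially"
      using walk ev1 ev2 second_order_expansion[OF has_deriv[OF g, folded g1_def]
        has_deriv[OF F1, folded g2_def] lim2 \<epsilon>'(1) less_imp_le[OF \<open>T > 0\<close>]]
    proof eventually_elim
      case (elim N)
      define \<phi> where "\<phi> s = ecis (g (real N) + g1 (real N) * real_of_int s)" for s
      have \<phi>_eq: "\<phi> s = ecis (g (real N)) * cis (2 * pi * g1 (real N) * real_of_int s)" for s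
        unfolding \<phi>_def ecis_add by (simp add: ecis_def mult.assoc)
      have "\<bar>2 * pi * g1 (real N)\<bar> * sqrt (real N) = 2 * pi * \<bar>g1 (real N) * sqrt (real N)\<bar>"
        by (simp add: abs_mult)
      also have "\<dots> \<le> C"
        unfolding C_def using elim(2) by (intro mult_left_mono) auto
      finally have "norm (walk_mean N \<phi>) \<ge> b"
        unfolding \<phi>_eq walk_mean_mult_left using elim(1) by (simp add: norm_mult)
      moreover have "norm (ecis (g (real (2 * m + d))) - \<phi> (2 * int m - int N)) \<le> \<epsilon>"
        if md: "d \<le> 1" "\<bar>2 * real m - real N\<bar> \<le> T * sqrt (real N)" for m d
      proof -
        define n where "n = real (2 * m + d)"
        have "\<bar>n - real N\<bar> \<le> T * sqrt (real N) + 1" using md by (simp add: n_def)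
        then have "\<bar>g n - (g (real N) + g1 (real N) * (n - real N))\<bar> \<le> \<epsilon>'"
          using elim(4) by force
        moreover have "\<bar>g1 (real N) * real d\<bar> \<le> \<epsilon>'"
        proof -
          have "\<bar>g1 (real N)\<bar> * real d \<le> \<epsilon>' * 1" using elim(3) md(1) by (intro mult_mono) auto
          then show ?thesis by (simp add: abs_mult)
        qed
        moreover have "g1 (real N) * (n - real N) =
            g1 (real N) * real_of_int (2 * int m - int N) + g1 (real N) * real d"
          by (simp add: n_def algebra_simps)
        ultimately have "\<bar>g n - (g (real N) + g1 (real N) * real_of_int (2 * int m - int N))\<bar> \<le> 2 * \<epsilon>'"
          by linarith
        then have "2 * pi * \<bar>g n - (g (real N) + g1 (real N) * real_of_int (2 * int m - int N))\<bar> \<le> 2 * pi * (2 * \<epsilon>')"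
          by (intro mult_left_mono) auto
        then show ?thesis
          unfolding \<phi>_def \<epsilon>'(2) n_def using norm_ecis_diff_le order.trans by blast
      qed
      ultimately show ?case
        unfolding walk_approx_def by (intro exI[of _ \<phi>]) (auto simp: \<phi>_def)
    qed
    then show "frequently (walk_approx b \<epsilon> T (\<lambda>n. ecis (g (real n)))) sequentially"
      by (rule eventually_frequently[OF sequentially_bot])
  qed simp
qed

text \<open>By continuity \<open>g1\<close> takes integer values at arbitrarily large real points.
  Rounding such a point up to an integer \<open>N\<close> changes \<open>g1\<close> by O(1/N) only,
  since its derivative is O(1/x).\<close>

lemma frequently_deriv_near_int:
  assumes g1: "g1 \<in> F" and inf: "filterlim (\<lambda>x. \<bar>g1 x\<bar>) at_top at_top"
    and bound: "eventually (\<lambda>x. \<bar>deriv g1 x * x\<bar> \<le> B) at_top"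
  shows "frequently (\<lambda>N. \<exists>k::int. \<bar>g1 (real N) - of_int k\<bar> \<le> 2 * B / real N) sequentially"
  unfolding frequently_sequentially
proof
  fix N0 :: nat
  have "eventually (\<lambda>x. (g1 has_real_derivative deriv g1 x) (at x) \<and> \<bar>deriv g1 x * x\<bar> \<le> B) at_top"
    using has_deriv[OF g1] bound by eventually_elim simp
  then obtain X0 where X0: "\<And>x. x \<ge> X0 \<Longrightarrow>
      (g1 has_real_derivative deriv g1 x) (at x) \<and> \<bar>deriv g1 x * x\<bar> \<le> B"
    unfolding eventually_at_top_linorder by blast
  define X where "X = max X0 (real N0 + 1)"
  have X: "(g1 has_real_derivative deriv g1 x) (at x)" "\<bar>deriv g1 x * x\<bar> \<le> B" if "x \<ge> X" for x
    using X0[of x] that by (auto simp: X_def)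
  have "X \<ge> real N0 + 1" by (simp add: X_def)
  \<comment> \<open>An integer level at or above the value at \<open>X\<close>, reached later
    because \<open>\<bar>g1\<bar>\<close> is unbounded. Taking absolute values treats both signs of
    \<open>g1\<close> together.\<close>
  define i where "i = \<lceil>\<bar>g1 X\<bar>\<rceil>"
  have "eventually (\<lambda>x. of_int i \<le> \<bar>g1 x\<bar> \<and> X \<le> x) at_top"
    using inf[unfolded filterlim_at_top, rule_format, of "of_int i"] eventually_ge_at_top[of X]
    by eventually_elim simp
  then obtain y where y: "of_int i \<le> \<bar>g1 y\<bar>" "X \<le> y"
    unfolding eventually_at_top_linorder by blast
  have "\<exists>x. X \<le> x \<and> x \<le> y \<and> \<bar>g1 x\<bar> = of_int i"
  proof (rule IVT'[of "\<lambda>x. \<bar>g1 x\<bar>"])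
    show "continuous_on {X..y} (\<lambda>x. \<bar>g1 x\<bar>)"
    proof (intro continuous_at_imp_continuous_on ballI)
      fix x assume "x \<in> {X..y}"
      then have "isCont g1 x" using X(1)[of x] by (auto intro: DERIV_isCont)
      then show "isCont (\<lambda>x. \<bar>g1 x\<bar>) x" by (rule isCont_rabs)
    qed
  qed (use y in \<open>auto simp: i_def\<close>)
  then obtain x where x: "X \<le> x" "\<bar>g1 x\<bar> = of_int i" by blast
  obtain k :: int where k: "g1 x = of_int k"
    using x(2) by (cases "g1 x \<ge> 0") (auto intro: that[of i] that[of "- i"])
  define N where "N = nat \<lceil>x\<rceil>"
  have N: "x \<le> real N" "real N \<le> x + 1" using x \<open>X \<ge> real N0 + 1\<close> unfolding N_def by linarith+
  have x1: "x \<ge> 1" using x \<open>X \<ge> real N0 + 1\<close> by simp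
  have B: "B \<ge> 0" using X(2)[of X] by simp
  have "\<bar>g1 (real N) - g1 x\<bar> \<le> 2 * B / real N"
  proof (cases "x = real N")
    case False
    then have "x < real N" using N by simp
    then have "\<exists>z>x. z < real N \<and> g1 (real N) - g1 x = (real N - x) * deriv g1 z"
      by (rule MVT2) (use X x in auto)
    then obtain z where z: "z > x" "g1 (real N) - g1 x = (real N - x) * deriv g1 z" by blast
    have "\<bar>deriv g1 z\<bar> * \<bar>z\<bar> \<le> B" using X(2)[of z] z x by (simp add: abs_mult)
    moreover have "\<bar>deriv g1 z\<bar> * (real N / 2) \<le> \<bar>deriv g1 z\<bar> * \<bar>z\<bar>"
      using z N x1 by (intro mult_left_mono) auto
    ultimately have "\<bar>deriv g1 z\<bar> * (real N / 2) \<le> B" by linarith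
    then have "\<bar>deriv g1 z\<bar> \<le> 2 * B / real N" using N x1 by (simp add: field_simps)
    moreover have "\<bar>g1 (real N) - g1 x\<bar> \<le> 1 * \<bar>deriv g1 z\<bar>"
      unfolding z(2) abs_mult using N by (intro mult_right_mono) auto
    ultimately show ?thesis by linarith
  qed (use B in simp)
  moreover have "N \<ge> N0" using N x \<open>X \<ge> real N0 + 1\<close> by linarith
  ultimately show "\<exists>n\<ge>N0. \<exists>k::int. \<bar>g1 (real n) - of_int k\<bar> \<le> 2 * B / real n"
    unfolding k by blast
qed

text \<open>At an \<open>N\<close> where g' is within O(1/N) of an integer \<open>k\<close>, the
  linear phase k t is trivial on integers, and the rest of the slope contributes O(1 / sqrt N). What
  remains is the quadratic phase with coefficient M/(2N), whose walk mean is bounded below.\<close>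

lemma bin2_mean_not_tendsto_0_xlnx:
  assumes g: "g \<in> F" and inf: "filterlim (\<lambda>x. \<bar>g x / x\<bar>) at_top at_top"
    and lim: "((\<lambda>x. g x / (x * ln x)) \<longlongrightarrow> M) at_top"
  shows "\<not> (\<lambda>N. bin2_mean N (\<lambda>n. ecis (g (real n)))) \<longlonglongrightarrow> 0"
proof -
  define g1 g2 where "g1 = deriv g" and "g2 = deriv g1"
  have F1: "g1 \<in> F" unfolding g1_def by (intro deriv g)
  have inf1: "filterlim (\<lambda>x. \<bar>g1 x\<bar>) at_top at_top"
    using iter_deriv_abs_at_top[OF g, of 1] inf by (simp add: g1_def)
  have lim2: "((\<lambda>x. g2 x * x) \<longlongrightarrow> M) at_top"
    using second_deriv_tendsto[OF g lim] by (simp add: g1_def g2_def numeral_2_eq_2)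
  define B where "B = \<bar>M\<bar> + 1"
  have B: "B > 0" by (simp add: B_def)
  have "eventually (\<lambda>x. \<bar>g2 x * x\<bar> < B) at_top"
    by (rule order_tendstoD[OF tendsto_rabs[OF lim2]]) (simp add: B_def)
  then have "eventually (\<lambda>x. \<bar>deriv g1 x * x\<bar> \<le> B) at_top"
    unfolding g2_def by eventually_elim simp
  then have freq: "frequently (\<lambda>N. \<exists>k::int. \<bar>g1 (real N) - of_int k\<bar> \<le> 2 * B / real N) sequentially"
    by (rule frequently_deriv_near_int[OF F1 inf1])
  \<comment> \<open>The quadratic phase is cis (pi M/N s^2), and 4 pi abs M <= 4 pi B.\<close>
  define C where "C = 4 * pi * B"
  have "C > 0" using B by (simp add: C_def)
  then obtain b where b: "b > 0" and walk: "eventually (\<lambda>N. \<forall>\<theta>. \<bar>4 * \<theta>\<bar> * real N \<le> C \<longrightarrow>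
    norm (walk_mean N (\<lambda>s. cis (\<theta> * (real_of_int s)\<^sup>2))) \<ge> b) sequentially"
    using walk_mean_quadratic_ge by blast
  show ?thesis
  proof (rule bin2_mean_not_tendsto_0[OF _ b])
    fix \<epsilon> T :: real assume "\<epsilon> > 0" "T > 0"
    \<comment> \<open>Three errors of size \<epsilon>' occur: the Taylor remainder, the distance of
      the slope to \<open>k\<close>, and the passage from t = s + d to the walk position
      \<open>s\<close> in the square.\<close>
    define \<epsilon>' where "\<epsilon>' = \<epsilon> / (6 * pi)"
    have \<epsilon>': "\<epsilon>' > 0" "2 * pi * (3 * \<epsilon>') = \<epsilon>" using \<open>\<epsilon> > 0\<close> by (auto simp: \<epsilon>'_def)
    have ev1: "eventually (\<lambda>N. T * sqrt (real N) + 1 \<le> (\<epsilon>' / (2 * B)) * real N) sequentially"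
      using \<open>T > 0\<close> \<epsilon>' B by (intro eventually_window_small) auto
    have "eventually (\<lambda>N. (\<forall>\<theta>. \<bar>4 * \<theta>\<bar> * real N \<le> C \<longrightarrow>
        norm (walk_mean N (\<lambda>s. cis (\<theta> * (real_of_int s)\<^sup>2))) \<ge> b) \<and>
      T * sqrt (real N) + 1 \<le> (\<epsilon>' / (2 * B)) * real N \<and> N \<ge> 1 \<and>
      (\<forall>t. \<bar>t - real N\<bar> \<le> T * sqrt (real N) + 1 \<longrightarrow>
        \<bar>g t - (g (real N) + g1 (real N) * (t - real N) + M / (2 * real N) * (t - real N)\<^sup>2)\<bar> \<le> \<epsilon>')) sequentially"
      using walk ev1 second_order_expansion[OF has_deriv[OF g, folded g1_def]
        has_deriv[OF F1, folded g2_def] lim2 \<epsilon>'(1) less_imp_le[OF \<open>T > 0\<close>]] eventually_ge_at_top[of 1]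
      by eventually_elim blast
    from frequently_eventually_frequently[OF freq this]
    show "frequently (walk_approx b \<epsilon> T (\<lambda>n. ecis (g (real n)))) sequentially"
    proof (rule frequently_elim1, elim conjE exE)
      fix N and k :: int
      assume k: "\<bar>g1 (real N) - of_int k\<bar> \<le> 2 * B / real N"
        and walk: "\<forall>\<theta>. \<bar>4 * \<theta>\<bar> * real N \<le> C \<longrightarrow>
          norm (walk_mean N (\<lambda>s. cis (\<theta> * (real_of_int s)\<^sup>2))) \<ge> b"
        and small: "T * sqrt (real N) + 1 \<le> (\<epsilon>' / (2 * B)) * real N" and "N \<ge> 1"
        and expand: "\<forall>t. \<bar>t - real N\<bar> \<le> T * sqrt (real N) + 1 \<longrightarrow>
          \<bar>g t - (g (real N) + g1 (real N) * (t - real N) + M / (2 * real N) * (t - real N)\<^sup>2)\<bar> \<le> \<epsilon>'"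
      have Npos: "real N > 0" using \<open>N \<ge> 1\<close> by simp
      have small': "2 * B / real N * (T * sqrt (real N) + 1) \<le> \<epsilon>'"
        using small Npos B by (simp add: field_simps)
      define \<phi> where "\<phi> s = ecis (g (real N) + M / (2 * real N) * (real_of_int s)\<^sup>2)" for s
      have \<phi>_eq: "\<phi> s = ecis (g (real N)) * cis (pi * M / real N * (real_of_int s)\<^sup>2)" for s
        unfolding \<phi>_def ecis_add by (simp add: ecis_def mult.assoc)
      have "\<bar>4 * (pi * M / real N)\<bar> * real N = 4 * pi * \<bar>M\<bar>"
        using Npos by (simp add: abs_mult)
      also have "\<dots> \<le> C" unfolding C_def by (intro mult_left_mono) (auto simp: B_def)
      finally have "b \<le> norm (walk_mean N (\<lambda>s. cis (pi * M / real N * (real_of_int s)\<^sup>2)))"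
        by (rule walk[rule_format])
      also have "\<dots> = norm (walk_mean N \<phi>)"
        unfolding \<phi>_eq[abs_def] walk_mean_mult_left norm_mult norm_ecis by simp
      finally have "norm (walk_mean N \<phi>) \<ge> b" .
      moreover have "norm (ecis (g (real (2 * m + d))) - \<phi> (2 * int m - int N)) \<le> \<epsilon>"
        if md: "d \<le> 1" "\<bar>2 * real m - real N\<bar> \<le> T * sqrt (real N)" for m d
      proof -
        define t where "t = real (2 * m + d) - real N"
        define s where "s = 2 * real m - real N"
        have ts: "t = s + real d" by (simp add: t_def s_def)
        have t: "\<bar>t\<bar> \<le> T * sqrt (real N) + 1" using md by (simp add: t_def)
        have "\<bar>g (real (2 * m + d)) - (g (real N) + g1 (real N) * t + M / (2 * real N) * t\<^sup>2)\<bar> \<le> \<epsilon>'"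
          using expand t unfolding t_def by blast
        moreover have "\<bar>(g1 (real N) - of_int k) * t\<bar> \<le> \<epsilon>'"
        proof -
          have "\<bar>g1 (real N) - of_int k\<bar> * \<bar>t\<bar> \<le> 2 * B / real N * (T * sqrt (real N) + 1)"
            using k t B by (intro mult_mono) auto
          then show ?thesis using small' by (simp add: abs_mult)
        qed
        moreover have "\<bar>M / (2 * real N) * (t\<^sup>2 - s\<^sup>2)\<bar> \<le> \<epsilon>'"
        proof -
          have "t\<^sup>2 - s\<^sup>2 = real d * (t + s)" by (simp add: ts power2_eq_square algebra_simps)
          also have "\<bar>\<dots>\<bar> \<le> 1 * (2 * (T * sqrt (real N) + 1))"
            unfolding abs_mult using md t by (intro mult_mono) (auto simp: s_def)
          finally have "\<bar>M / (2 * real N)\<bar> * \<bar>t\<^sup>2 - s\<^sup>2\<bar> \<le> \<bar>M / (2 * real N)\<bar> * (2 * (T * sqrt (real N) + 1))"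
            by (intro mult_left_mono) auto
          also have "\<dots> = \<bar>M\<bar> / real N * (T * sqrt (real N) + 1)"
            using Npos by (simp add: abs_mult field_simps)
          also have "\<dots> \<le> 2 * B / real N * (T * sqrt (real N) + 1)"
            using \<open>T > 0\<close> by (intro mult_right_mono divide_right_mono) (auto simp: B_def)
          finally show ?thesis using small' by (simp add: abs_mult)
        qed
        moreover have "g1 (real N) * t = (g1 (real N) - of_int k) * t + of_int k * t"
          "M / (2 * real N) * t\<^sup>2 = M / (2 * real N) * (t\<^sup>2 - s\<^sup>2) + M / (2 * real N) * s\<^sup>2"
          by (simp_all add: algebra_simps)
        ultimately have "\<bar>(g (real (2 * m + d)) - of_int k * t) - (g (real N) + M / (2 * real N) * s\<^sup>2)\<bar> \<le> 3 * \<epsilon>'"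
          by linarith
        then have "2 * pi * \<bar>(g (real (2 * m + d)) - of_int k * t) - (g (real N) + M / (2 * real N) * s\<^sup>2)\<bar> \<le> 2 * pi * (3 * \<epsilon>')"
          by (intro mult_left_mono) auto
        then have "norm (ecis (g (real (2 * m + d)) - of_int k * t) - ecis (g (real N) + M / (2 * real N) * s\<^sup>2)) \<le> \<epsilon>"
          unfolding \<epsilon>'(2) using norm_ecis_diff_le order.trans by blast
        moreover have "ecis (g (real (2 * m + d)) - of_int k * t) = ecis (g (real (2 * m + d)))"
        proof -
          have "- (of_int k * t) = of_int (- k * (2 * int m + int d - int N))" by (simp add: t_def)
          then have "- (of_int k * t) \<in> \<int>" by (metis Ints_of_int)
          from ecis_add_Ints[OF this] show ?thesis by simp
        qed
        moreover have "ecis (g (real N) + M / (2 * real N) * s\<^sup>2) = \<phi> (2 * int m - int N)"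
          by (simp add: \<phi>_def s_def)
        ultimately show ?thesis by simp
      qed
      ultimately show "walk_approx b \<epsilon> T (\<lambda>n. ecis (g (real n))) N"
        unfolding walk_approx_def by (intro exI[of _ \<phi>]) (auto simp: \<phi>_def)
    qed
  qed simp
qed

end

section \<open>Reduction to exponential means and assembly of the cases\<close>

lemma uniformly_distributed_iff_ecis:
  "bin2_uniformly_distributed_mod_1 x \<longleftrightarrow>
    (\<forall>k::int. k \<noteq> 0 \<longrightarrow> (\<lambda>N. bin2_mean N (\<lambda>n. ecis (of_int k * x n))) \<longlonglongrightarrow> 0)"
proof -
  have "exp (2 * complex_of_real pi * \<i> * of_int k * complex_of_real y) = ecis (of_int k * y)" for k :: int and y
    by (simp add: ecis_def cis_conv_exp ac_simps)
  then show ?thesis unfolding bin2_uniformly_distributed_mod_1_def by simp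
qed

text \<open>The polynomial enters only through its periodicity modulo 1, which multiplication by
  \<open>k\<close> preserves; hence the arbitrary \<open>P\<close> in the hypothesis.\<close>

lemma uniformly_distributedI:
  assumes "\<And>k Q P. k \<noteq> 0 \<Longrightarrow> Q > 0 \<Longrightarrow> (\<And>n j. P (n + 2 * Q * j) - P n \<in> \<int>) \<Longrightarrow>
    (\<lambda>N. bin2_mean N (\<lambda>n. ecis (P n + real_of_int k * (h (real n) - rpoly p (real n))))) \<longlonglongrightarrow> 0"
  shows "bin2_uniformly_distributed_mod_1 (\<lambda>n. h (real n))"
  unfolding uniformly_distributed_iff_ecis
proof (intro allI impI)
  fix k :: int assume "k \<noteq> 0"
  obtain Q where Q: "Q > 0" "\<And>n j. rpoly p (real (n + 2 * Q * j)) - rpoly p (real n) \<in> \<int>"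
    using rpoly_periodic_mod_Ints by blast
  have "real_of_int k * rpoly p (real (n + 2 * Q * j)) - real_of_int k * rpoly p (real n) \<in> \<int>" for n j
    unfolding right_diff_distrib[symmetric] by (intro Ints_mult Q Ints_of_int)
  from assms[OF \<open>k \<noteq> 0\<close> Q(1) this]
  show "(\<lambda>N. bin2_mean N (\<lambda>n. ecis (of_int k * h (real n)))) \<longlonglongrightarrow> 0"
    by (simp add: algebra_simps)
qed

text \<open>One bad frequency is enough: a \<open>k\<close> that clears all denominators makes k
  p(n) an integer and leaves only the remainder. Since this \<open>k\<close> depends on
  \<open>p\<close>, failure is assumed at every nonzero frequency.\<close>

lemma not_uniformly_distributedI:
  assumes "\<And>k. k \<noteq> 0 \<Longrightarrow>
    \<not> (\<lambda>N. bin2_mean N (\<lambda>n. ecis (real_of_int k * (h (real n) - rpoly p (real n))))) \<longlonglongrightarrow> 0"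
  shows "\<not> bin2_uniformly_distributed_mod_1 (\<lambda>n. h (real n))"
proof
  assume ud: "bin2_uniformly_distributed_mod_1 (\<lambda>n. h (real n))"
  obtain k where k: "k > 0" "\<And>n. real k * rpoly p (real n) \<in> \<int>"
    using rpoly_integer_multiple by blast
  have "ecis (real_of_int (int k) * (h (real n) - rpoly p (real n))) =
      ecis (real_of_int (int k) * h (real n))" for n
    using ecis_add_Ints[of "- (real k * rpoly p (real n))" "real k * h (real n)"] k(2)
    by (simp add: algebra_simps)
  moreover have "(\<lambda>N. bin2_mean N (\<lambda>n. ecis (real_of_int (int k) * h (real n)))) \<longlonglongrightarrow> 0"
    using ud[unfolded uniformly_distributed_iff_ecis, rule_format, of "int k"] k(1) by simp
  ultimately show False using assms[of "int k"] k(1) by simp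
qed

lemma abs_at_top_scale:
  fixes f :: "real \<Rightarrow> real"
  assumes "filterlim (\<lambda>x. \<bar>f x\<bar>) at_top at_top" "k \<noteq> 0"
  shows "filterlim (\<lambda>x. \<bar>k * f x\<bar>) at_top at_top"
  using filterlim_const_mult_at_top[OF assms(1), of "\<bar>k\<bar>"] assms(2) by (simp add: abs_mult)

context hardy_functions_ln
begin

lemma uniformly_distributed_iff_gap:
  assumes h: "h \<in> F" and growth: "((\<lambda>x. h x / x ^ Suc D) \<longlongrightarrow> 0) at_top"
  shows "bin2_uniformly_distributed_mod_1 (\<lambda>n. h (real n)) \<longleftrightarrow>
    superlinear_gap h \<or> sqrt_gap h \<and> linear_distance h"
  using h growth
proof (cases rule: rational_polynomial_part)
  case (sublinear p)
  define g where "g x = h x - rpoly p x" for x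
  have g: "g \<in> F" unfolding g_def by (intro diff h rpoly_mem)
  have kg: "(\<lambda>x. real_of_int k * g x) \<in> F" for k
    by (intro mult of_int g)
  have lim: "((\<lambda>x. g x / x) \<longlongrightarrow> 0) at_top" using sublinear by (simp add: g_def)
  have "(\<lambda>x. g x / sqrt x) \<in> F" by (intro divide g sqrt)
  then show ?thesis
  proof (cases rule: abs_limit_cases)
    case (1 c)
    have "\<not> bin2_uniformly_distributed_mod_1 (\<lambda>n. h (real n))"
    proof (rule not_uniformly_distributedI[where p = p], fold g_def)
      fix k :: int
      have "((\<lambda>x. real_of_int k * g x / sqrt x) \<longlongrightarrow> real_of_int k * c) at_top"
        using tendsto_mult_left[OF 1, of "real_of_int k"] by simp
      then show "\<not> (\<lambda>N. bin2_mean N (\<lambda>n. ecis (real_of_int k * g (real n)))) \<longlonglongrightarrow> 0"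
        by (rule bin2_mean_not_tendsto_0_sqrt[OF kg])
    qed
    then show ?thesis
      using gap_sublinear[OF sublinear, folded g_def] tendsto_not_abs_at_top[OF 1] by blast
  next
    case 2
    have "bin2_uniformly_distributed_mod_1 (\<lambda>n. h (real n))"
    proof (rule uniformly_distributedI[where p = p], fold g_def)
      fix k :: int and Q and P :: "nat \<Rightarrow> real"
      assume "k \<noteq> 0" "Q > 0" and P: "\<And>n j. P (n + 2 * Q * j) - P n \<in> \<int>"
      show "(\<lambda>N. bin2_mean N (\<lambda>n. ecis (P n + real_of_int k * g (real n)))) \<longlonglongrightarrow> 0"
      proof (rule bin2_mean_tendsto_0_sublinear[OF kg \<open>Q > 0\<close> P])
        show "((\<lambda>x. real_of_int k * g x / x) \<longlongrightarrow> 0) at_top"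
          using tendsto_mult_left[OF lim, of "real_of_int k"] by simp
        show "filterlim (\<lambda>x. \<bar>real_of_int k * g x / sqrt x\<bar>) at_top at_top"
          using abs_at_top_scale[OF 2, of "real_of_int k"] \<open>k \<noteq> 0\<close> by simp
      qed
    qed
    then show ?thesis
      using gap_sublinear[OF sublinear, folded g_def] 2 by blast
  qed
next
  case (irrational p l \<alpha>)
  define g where "g x = h x - rpoly p x" for x
  have g: "g \<in> F" unfolding g_def by (intro diff h rpoly_mem)
  have kg: "(\<lambda>x. real_of_int k * g x) \<in> F" for k
    by (intro mult of_int g)
  have "bin2_uniformly_distributed_mod_1 (\<lambda>n. h (real n))"
  proof (rule uniformly_distributedI[where p = p], fold g_def)
    fix k :: int and Q and P :: "nat \<Rightarrow> real"
    assume "k \<noteq> 0" "Q > 0" and P: "\<And>n j. P (n + 2 * Q * j) - P n \<in> \<int>"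
    show "(\<lambda>N. bin2_mean N (\<lambda>n. ecis (P n + real_of_int k * g (real n)))) \<longlonglongrightarrow> 0"
    proof (rule bin2_mean_tendsto_0_irrational[OF kg \<open>Q > 0\<close> P])
      have "((\<lambda>x. real_of_int k * g x / x ^ l) \<longlongrightarrow> real_of_int k * \<alpha>) at_top"
        using tendsto_mult_left[OF irrational(3)[folded g_def], of "real_of_int k"] by simp
      then show "((deriv ^^ l) (\<lambda>x. real_of_int k * g x) \<longlongrightarrow> fact l * (real_of_int k * \<alpha>)) at_top"
        by (rule iter_deriv_tendsto[OF kg])
      show "fact l * (real_of_int k * \<alpha>) \<notin> \<rat>"
      proof
        assume "fact l * (real_of_int k * \<alpha>) \<in> \<rat>"
        then have "fact l * (real_of_int k * \<alpha>) / of_int (fact l * k) \<in> \<rat>"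
          by (rule Rats_divide[OF _ Rats_of_int])
        then show False using \<open>k \<noteq> 0\<close> irrational(2) by simp
      qed
    qed (use irrational(1) in simp)
  qed
  then show ?thesis using gap_irrational[OF irrational] by simp
next
  case (between p l)
  define g where "g x = h x - rpoly p x" for x
  have g: "g \<in> F" unfolding g_def by (intro diff h rpoly_mem)
  have kg: "(\<lambda>x. real_of_int k * g x) \<in> F" for k
    by (intro mult of_int g)
  have "(\<lambda>x. g x / (x * ln x)) \<in> F" by (intro divide g xlnx)
  then show ?thesis
  proof (cases rule: abs_limit_cases)
    case (1 c)
    \<comment> \<open>For l >= 2 the remainder eventually exceeds x^l and so outgrows x ln x,
      against the finite limit. With l = 1, case \<open>between\<close> says that it outgrows x, as
      the lower bound requires.\<close>
    have "l = 1"
    proof (rule ccontr)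
      assume "l \<noteq> 1"
      then have "filterlim (\<lambda>x. \<bar>g x / (x * ln x)\<bar>) at_top at_top"
        using between by (intro quotient_xlnx_at_top[of l]) (auto simp: g_def)
      then show False by (rule tendsto_not_abs_at_top[OF 1])
    qed
    have "\<not> bin2_uniformly_distributed_mod_1 (\<lambda>n. h (real n))"
    proof (rule not_uniformly_distributedI[where p = p], fold g_def)
      fix k :: int assume "k \<noteq> 0"
      show "\<not> (\<lambda>N. bin2_mean N (\<lambda>n. ecis (real_of_int k * g (real n)))) \<longlonglongrightarrow> 0"
      proof (rule bin2_mean_not_tendsto_0_xlnx[OF kg])
        show "((\<lambda>x. real_of_int k * g x / (x * ln x)) \<longlongrightarrow> real_of_int k * c) at_top"
          using tendsto_mult_left[OF 1, of "real_of_int k"] by simp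
        show "filterlim (\<lambda>x. \<bar>real_of_int k * g x / x\<bar>) at_top at_top"
          using abs_at_top_scale[OF between(2), of "real_of_int k"] \<open>k \<noteq> 0\<close> \<open>l = 1\<close> by (simp add: g_def)
      qed
    qed
    then show ?thesis
      using gap_between[OF between, folded g_def] tendsto_not_abs_at_top[OF 1] by blast
  next
    case 2
    have "bin2_uniformly_distributed_mod_1 (\<lambda>n. h (real n))"
    proof (rule uniformly_distributedI[where p = p], fold g_def)
      fix k :: int and Q and P :: "nat \<Rightarrow> real"
      assume "k \<noteq> 0" "Q > 0" and P: "\<And>n j. P (n + 2 * Q * j) - P n \<in> \<int>"
      show "(\<lambda>N. bin2_mean N (\<lambda>n. ecis (P n + real_of_int k * g (real n)))) \<longlonglongrightarrow> 0"
      proof (rule bin2_mean_tendsto_0_between[OF kg \<open>Q > 0\<close> P between(1)])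
        show "filterlim (\<lambda>x. \<bar>real_of_int k * g x / x ^ l\<bar>) at_top at_top"
          using abs_at_top_scale[OF between(2), of "real_of_int k"] \<open>k \<noteq> 0\<close> by (simp add: g_def)
        show "((\<lambda>x. real_of_int k * g x / x ^ Suc l) \<longlongrightarrow> 0) at_top"
          using tendsto_mult_left[OF between(3), of "real_of_int k"] by (simp add: g_def)
        show "filterlim (\<lambda>x. \<bar>real_of_int k * g x / (x * ln x)\<bar>) at_top at_top"
          using abs_at_top_scale[OF 2, of "real_of_int k"] \<open>k \<noteq> 0\<close> by simp
      qed
    qed
    then show ?thesis
      using gap_between[OF between, folded g_def] 2 by blast
  qed
qed

end

lemma polynomial_growth_tendsto_0:
  fixes h :: "real \<Rightarrow> real"
  assumes "\<And>x. x \<ge> c \<Longrightarrow> \<bar>h x\<bar> \<le> x powr d"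
  shows "\<exists>D. ((\<lambda>x. h x / x ^ Suc D) \<longlongrightarrow> 0) at_top"
proof -
  define D where "D = nat \<lceil>\<bar>d\<bar>\<rceil>"
  have D: "d \<le> real D" unfolding D_def by linarith
  have "((\<lambda>x. h x / x ^ Suc D) \<longlongrightarrow> 0) at_top"
  proof (rule Lim_null_comparison)
    show "eventually (\<lambda>x. norm (h x / x ^ Suc D) \<le> inverse x) at_top"
      using eventually_ge_at_top[of "max c 1"]
    proof eventually_elim
      case (elim x)
      have "\<bar>h x\<bar> \<le> x powr real D"
        using assms[of x] powr_mono[OF D, of x] elim by simp
      also have "\<dots> = x ^ D" using elim by (simp add: powr_realpow)
      finally show ?case using elim by (simp add: field_simps)
    qed
    show "((\<lambda>x::real. inverse x) \<longlongrightarrow> 0) at_top"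
      by (rule tendsto_inverse_0_at_top[OF filterlim_ident])
  qed
  then show ?thesis ..
qed

theorem theorem5p1:
  fixes h :: "real \<Rightarrow> real" and H :: "real_germ set"
  assumes "hardy_field H" and "germ h \<in> H"
    and "\<exists>c d :: real. c \<ge> 1 \<and> d \<ge> 1 \<and> (\<forall>x\<ge>c. \<bar>h x\<bar> \<le> x powr d)"
  shows
    "(bin2_uniformly_distributed_mod_1 (\<lambda>n. h (real n)) \<longleftrightarrow>
       (\<forall>p. filterlim (\<lambda>x. rat_poly_dist h p x / (x * ln x)) at_top at_top) \<or>
       ((\<forall>p. filterlim (\<lambda>x. rat_poly_dist h p x / sqrt x) at_top at_top) \<and>
        (\<exists>q. \<exists>L :: real. ((\<lambda>x. rat_poly_dist h q x / x) \<longlongrightarrow> L) at_top))) \<and>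
     \<not> ((\<forall>p. filterlim (\<lambda>x. rat_poly_dist h p x / (x * ln x)) at_top at_top) \<and>
        ((\<forall>p. filterlim (\<lambda>x. rat_poly_dist h p x / sqrt x) at_top at_top) \<and>
         (\<exists>q. \<exists>L :: real. ((\<lambda>x. rat_poly_dist h q x / x) \<longlongrightarrow> L) at_top)))"
proof -
  \<comment> \<open>The conclusion mentions only \<open>h\<close>, so the given field may be
    exchanged for any larger one that also contains the comparison functions.\<close>
  obtain F where F: "hardy_functions_ln F" "{f. germ f \<in> H} \<subseteq> F"
    using hardy_functions_extend[OF hardy_functions_of_hardy_field[OF assms(1)]] .
  then have "h \<in> F" using assms(2) by blast
  moreover obtain c d :: real where "\<forall>x\<ge>c. \<bar>h x\<bar> \<le> x powr d"
    using assms(3) by auto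
  then have "\<exists>D. ((\<lambda>x. h x / x ^ Suc D) \<longlongrightarrow> 0) at_top"
    by (intro polynomial_growth_tendsto_0[of c h d]) simp
  then obtain D where "((\<lambda>x. h x / x ^ Suc D) \<longlongrightarrow> 0) at_top" ..
  ultimately have "bin2_uniformly_distributed_mod_1 (\<lambda>n. h (real n)) \<longleftrightarrow>
      superlinear_gap h \<or> sqrt_gap h \<and> linear_distance h"
    by (rule hardy_functions_ln.uniformly_distributed_iff_gap[OF F(1)])
  moreover have "\<not> (superlinear_gap h \<and> sqrt_gap h \<and> linear_distance h)"
    using not_superlinear_gap_if_linear_distance by blast
  ultimately show ?thesis
    unfolding superlinear_gap_def sqrt_gap_def linear_distance_def by (rule conjI)
qed

end
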